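(* Let $n\ge 6$ be an integer. The Stiefel manifold $V_4\mathbb{R}^n=\mathrm{SO}(n)/\mathrm{SO}(n-4)$ admits at least four $\mathrm{SO}(n)$-invariant Einstein metrics that are pairwise distinct up to scaling by a positive constant. Two of them are Jensen's metrics. The other two are given by $\mathrm{Ad}(\mathrm{SO}(3)\times\mathrm{SO}(n-4))$-invariant scalar products on $\mathfrak{p}$ of the form $$\langle\cdot,\cdot\rangle = x_2\,(-B)|_{\mathfrak{so}(3)}+x_{12}\,(-B)|_{\mathfrak{m}_{12}}+x_{13}\,(-B)|_{\mathfrak{m}_{13}}+x_{23}\,(-B)|_{\mathfrak{m}_{23}},\qquad x_2,x_{12},x_{13},x_{23}>0.$$
   Context: A Riemannian metric $g$ is Einstein if $\mathrm{Ric}_g=\lambda g$ for some $\lambda\in\mathbb{R}$. Let $G=\mathrm{SO}(n)$ and let $B(X,Y)=(n-2)\,\mathrm{tr}(XY)$ be the Killing form of $\mathfrak{so}(n)$, so that $-B$ is an $\mathrm{Ad}(G)$-invariant inner product. Split the index set $\{1,\dots,n\}$ into consecutive blocks $I_1,I_2,I_3$ of sizes $1$, $3$, $n-4$, and write $n\times n$ skew-symmetric matrices in the corresponding block form. Let $H=\mathrm{SO}(n-4)$ be embedded in $G$ as the subgroup acting on the coordinates in $I_3$ and fixing those in $I_1\cup I_2$. Let $\mathfrak{so}(3)$ be the subalgebra of matrices supported in the diagonal block $I_2\times I_2$. For $1\le a<b\le 3$ let $\mathfrak{m}_{ab}$ be the subspace of skew-symmetric matrices whose only nonzero blocks are the $(a,b)$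 block and, correspondingly, the $(b,a)$ block. Then the $(-B)$-orthogonal complement of $\mathfrak{h}=\mathfrak{so}(n-4)$ in $\mathfrak{so}(n)$ is $$\mathfrak{p}=\mathfrak{so}(3)\oplus\mathfrak{m}_{12}\oplus\mathfrak{m}_{13}\oplus\mathfrak{m}_{23},$$ which is identified with the tangent space of $G/H$ at $eH$. The group $\mathrm{SO}(3)\times\mathrm{SO}(n-4)$ acts on $\mathfrak{p}$ by $\mathrm{Ad}$, with the factors embedded in the blocks $I_2$ and $I_3$. The $G$-invariant metrics on $G/H$ correspond to $\mathrm{Ad}(H)$-invariant scalar products on $\mathfrak{p}$. Jensen's metrics on $V_4\mathbb{R}^n$ are (up to scale) the two $\mathrm{SO}(n)$-invariant Einstein metrics of the displayed form with $x_{13}=x_{23}=1$ and $x_{12}=x_2=\dfrac{n-2\pm\sqrt{n^2-6n+6}}{n-1}$. *)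

theory Defs
  imports "HOL-Analysis.Analysis"
begin

section \<open>Riemannian geometry of embedded submanifolds in local coordinates\<close>

text \<open>
  Manifolds are embedded submanifolds \<open>M\<close> of a Euclidean space \<open>'a\<close>; their dimension is the
  cardinality of the index type \<open>'d\<close> of the coordinate space \<open>real ^ 'd\<close>, which is passed as a
  type argument where it is not determined otherwise. A metric is a function \<open>g p v w\<close> of which
  only the values at \<open>p \<in> M\<close> and \<open>v\<close>, \<open>w\<close> tangent to \<open>M\<close> at \<open>p\<close> are meaningful.
\<close>

definition partial :: "'d \<Rightarrow> (real ^ 'd \<Rightarrow> 'b::real_normed_vector) \<Rightarrow> real ^ 'd \<Rightarrow> 'b" where
  "partial i f u = frechet_derivative f (at u) (axis i 1)"

text \<open>Only used for open \<open>U\<close>; the order of differentiability on \<open>U\<close> is defined via partial derivatives.\<close>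

primrec C_on :: "nat \<Rightarrow> (real ^ 'd) set \<Rightarrow> (real ^ 'd \<Rightarrow> 'b::real_normed_vector) \<Rightarrow> bool" where
  "C_on 0 U f \<longleftrightarrow> continuous_on U f"
| "C_on (Suc k) U f \<longleftrightarrow> f differentiable_on U \<and> (\<forall>i. C_on k U (partial i f))"

definition smooth_on :: "(real ^ 'd) set \<Rightarrow> (real ^ 'd \<Rightarrow> 'b::real_normed_vector) \<Rightarrow> bool" where
  "smooth_on U f \<longleftrightarrow> (\<forall>k. C_on k U f)"

definition local_param :: "'a::euclidean_space set \<Rightarrow> (real ^ 'd) set \<Rightarrow> (real ^ 'd \<Rightarrow> 'a) \<Rightarrow> bool" where
  "local_param M U \<phi> \<longleftrightarrow>
     open U \<and> smooth_on U \<phi> \<and> (\<forall>u\<in>U. inj (frechet_derivative \<phi> (at u))) \<and>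
     openin (top_of_set M) (\<phi> ` U) \<and> (\<exists>\<psi>. homeomorphism U (\<phi> ` U) \<phi> \<psi>)"

definition submanifold :: "'d::finite itself \<Rightarrow> 'a::euclidean_space set \<Rightarrow> bool" where
  "submanifold _ M \<longleftrightarrow> (\<forall>p\<in>M. \<exists>U (\<phi> :: real ^ 'd \<Rightarrow> 'a). local_param M U \<phi> \<and> p \<in> \<phi> ` U)"

text \<open>
  For an embedded submanifold, velocities of curves that are merely differentiable at \<open>0\<close> give the
  same space as those of smooth curves.
\<close>

definition tangent_space :: "'a::euclidean_space set \<Rightarrow> 'a \<Rightarrow> 'a set" where
  "tangent_space M p =
     {v. \<exists>\<gamma>. (\<forall>t. \<gamma> t \<in> M) \<and> \<gamma> 0 = p \<and> (\<gamma> has_vector_derivative v) (at 0)}"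

definition scalar_product_on :: "'a::real_vector set \<Rightarrow> ('a \<Rightarrow> 'a \<Rightarrow> real) \<Rightarrow> bool" where
  "scalar_product_on V b \<longleftrightarrow>
     subspace V \<and>
     (\<forall>x\<in>V. \<forall>y\<in>V. b x y = b y x) \<and>
     (\<forall>x\<in>V. \<forall>y\<in>V. \<forall>z\<in>V. b (x + y) z = b x z + b y z) \<and>
     (\<forall>c. \<forall>x\<in>V. \<forall>z\<in>V. b (c *\<^sub>R x) z = c * b x z) \<and>
     (\<forall>x\<in>V. x \<noteq> 0 \<longrightarrow> b x x > 0)"

definition coord_metric ::
    "(real ^ 'd \<Rightarrow> 'a::real_normed_vector) \<Rightarrow> ('a \<Rightarrow> 'a \<Rightarrow> 'a \<Rightarrow> real) \<Rightarrow> real ^ 'd \<Rightarrow> real ^ 'd ^ 'd" where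
  "coord_metric \<phi> g u = (\<chi> i j. g (\<phi> u) (partial i \<phi> u) (partial j \<phi> u))"

definition riemannian_metric ::
    "'d::finite itself \<Rightarrow> 'a::euclidean_space set \<Rightarrow> ('a \<Rightarrow> 'a \<Rightarrow> 'a \<Rightarrow> real) \<Rightarrow> bool" where
  "riemannian_metric d M g \<longleftrightarrow>
     submanifold d M \<and>
     (\<forall>p\<in>M. scalar_product_on (tangent_space M p) (g p)) \<and>
     (\<forall>U (\<phi> :: real ^ 'd \<Rightarrow> 'a). local_param M U \<phi> \<longrightarrow>
        (\<forall>i j. smooth_on U (\<lambda>u. coord_metric \<phi> g u $ i $ j)))"

text \<open>
  \<open>christoffel G k i j\<close> is \<open>\<Gamma>\<^sup>k\<^sub>i\<^sub>j\<close>, and \<open>ricci G i j\<close> is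
  \<open>R\<^sub>i\<^sub>j = \<partial>\<^sub>k \<Gamma>\<^sup>k\<^sub>i\<^sub>j - \<partial>\<^sub>j \<Gamma>\<^sup>k\<^sub>i\<^sub>k + \<Gamma>\<^sup>k\<^sub>k\<^sub>l \<Gamma>\<^sup>l\<^sub>i\<^sub>j - \<Gamma>\<^sup>k\<^sub>j\<^sub>l \<Gamma>\<^sup>l\<^sub>i\<^sub>k\<close>
  (summation convention), for the Levi-Civita connection of the metric with coefficients \<open>G\<close>.
  With this sign round spheres have positive Ricci curvature.
\<close>

definition christoffel :: "(real ^ 'd \<Rightarrow> real ^ 'd ^ 'd) \<Rightarrow> 'd \<Rightarrow> 'd \<Rightarrow> 'd \<Rightarrow> real ^ 'd \<Rightarrow> real" where
  "christoffel G k i j u =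
     (1 / 2) * (\<Sum>l\<in>UNIV. matrix_inv (G u) $ k $ l *
       (partial i (\<lambda>w. G w $ j $ l) u + partial j (\<lambda>w. G w $ i $ l) u - partial l (\<lambda>w. G w $ i $ j) u))"

definition ricci :: "(real ^ 'd \<Rightarrow> real ^ 'd ^ 'd) \<Rightarrow> 'd \<Rightarrow> 'd \<Rightarrow> real ^ 'd \<Rightarrow> real" where
  "ricci G i j u =
     (\<Sum>k\<in>UNIV. partial k (christoffel G k i j) u - partial j (christoffel G k i k) u) +
     (\<Sum>k\<in>UNIV. \<Sum>l\<in>UNIV. christoffel G k k l u * christoffel G l i j u
                          - christoffel G k j l u * christoffel G l i k u)"

definition einstein_metric ::
    "'d::finite itself \<Rightarrow> 'a::euclidean_space set \<Rightarrow> ('a \<Rightarrow> 'a \<Rightarrow> 'a \<Rightarrow> real) \<Rightarrow> bool" where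
  "einstein_metric d M g \<longleftrightarrow>
     riemannian_metric d M g \<and>
     (\<exists>c. \<forall>U (\<phi> :: real ^ 'd \<Rightarrow> 'a). local_param M U \<phi> \<longrightarrow>
        (\<forall>u\<in>U. \<forall>i j. ricci (coord_metric \<phi> g) i j u = c * coord_metric \<phi> g u $ i $ j))"

definition equal_up_to_scaling ::
    "'a::euclidean_space set \<Rightarrow> ('a \<Rightarrow> 'a \<Rightarrow> 'a \<Rightarrow> real) \<Rightarrow> ('a \<Rightarrow> 'a \<Rightarrow> 'a \<Rightarrow> real) \<Rightarrow> bool" where
  "equal_up_to_scaling M g g' \<longleftrightarrow>
     (\<exists>c>0. \<forall>p\<in>M. \<forall>v\<in>tangent_space M p. \<forall>w\<in>tangent_space M p. g p v w = c * g' p v w)"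


section \<open>The Stiefel manifold and its invariant metrics\<close>

text \<open>
  The coordinates of \<open>\<real>\<^sup>n\<close> are indexed by the sum type \<open>4 + 'm\<close>, so \<open>n = 4 + CARD('m)\<close>; the four
  elements of the numeral type \<open>4\<close> are \<open>1, 2, 3, 4\<close> (with \<open>4 = 0\<close>). A point of the Stiefel manifold
  is an \<open>n \<times> 4\<close> matrix with orthonormal columns. Its dimension is
  \<open>4 n - 10 = 6 + 4 (n - 4) = CARD(6 + 4 \<times> 'm)\<close>.
\<close>

type_synonym 'm sqmat = "real ^ (4 + 'm) ^ (4 + 'm)"
type_synonym 'm frame = "real ^ 4 ^ (4 + 'm)"

definition stiefel :: "'m::finite frame set" where
  "stiefel = {A. transpose A ** A = mat 1}"

definition base_frame :: "'m::finite frame" where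
  "base_frame = (\<chi> i j. if i = Inl j then 1 else 0)"

definition SO_invariant :: "('m::finite frame \<Rightarrow> 'm frame \<Rightarrow> 'm frame \<Rightarrow> real) \<Rightarrow> bool" where
  "SO_invariant g \<longleftrightarrow>
     (\<forall>Q :: 'm sqmat. rotation_matrix Q \<longrightarrow>
        (\<forall>A\<in>stiefel. \<forall>V\<in>tangent_space stiefel A. \<forall>W\<in>tangent_space stiefel A.
           g (Q ** A) (Q ** V) (Q ** W) = g A V W))"

definition block :: "nat \<Rightarrow> (4 + 'm::finite) set" where
  "block a = (if a = 1 then {Inl 1} else if a = 2 then {Inl 2, Inl 3, Inl 4} else range Inr)"

text \<open>For disjoint or equal blocks \<open>a\<close>, \<open>b\<close>: keep the \<open>(a, b)\<close> and \<open>(b, a)\<close> blocks of a matrix.\<close>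

definition block_part :: "nat \<Rightarrow> nat \<Rightarrow> 'm::finite sqmat \<Rightarrow> 'm sqmat" where
  "block_part a b X =
     (\<chi> i j. if i \<in> block a \<and> j \<in> block b \<or> i \<in> block b \<and> j \<in> block a then X $ i $ j else 0)"

definition so :: "'m::finite sqmat set" where
  "so = {X. transpose X = - X}"

definition so_block :: "nat \<Rightarrow> nat \<Rightarrow> 'm::finite sqmat set" where
  "so_block a b = {X \<in> so. block_part a b X = X}"

abbreviation so_3 :: "'m::finite sqmat set" where "so_3 \<equiv> so_block 2 2"
abbreviation m_12 :: "'m::finite sqmat set" where "m_12 \<equiv> so_block 1 2"
abbreviation m_13 :: "'m::finite sqmat set" where "m_13 \<equiv> so_block 1 3"
abbreviation m_23 :: "'m::finite sqmat set" where "m_23 \<equiv> so_block 2 3"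
abbreviation frak_h :: "'m::finite sqmat set" where "frak_h \<equiv> so_block 3 3"

definition killing :: "'m::finite sqmat \<Rightarrow> 'm sqmat \<Rightarrow> real" where
  "killing X Y = (real CARD(4 + 'm) - 2) * trace (X ** Y)"

definition frak_p :: "'m::finite sqmat set" where
  "frak_p = {X \<in> so. \<forall>Y\<in>frak_h. - killing X Y = 0}"

text \<open>Rotations acting on the coordinates in block \<open>a\<close> and fixing all others.\<close>

definition SO_block :: "nat \<Rightarrow> 'm::finite sqmat set" where
  "SO_block a = {Q. rotation_matrix Q \<and> (\<forall>i. i \<notin> block a \<longrightarrow> Q *v axis i 1 = axis i 1)}"

definition SO3_SOm :: "'m::finite sqmat set" where
  "SO3_SOm = {R ** S | R S. R \<in> SO_block 2 \<and> S \<in> SO_block 3}"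

text \<open>For orthogonal \<open>Q\<close> one has \<open>Ad(Q) X = Q X Q\<^sup>T\<close>.\<close>

definition Ad_invariant_on ::
    "'m::finite sqmat set \<Rightarrow> 'm sqmat set \<Rightarrow> ('m sqmat \<Rightarrow> 'm sqmat \<Rightarrow> real) \<Rightarrow> bool" where
  "Ad_invariant_on K V b \<longleftrightarrow>
     (\<forall>Q\<in>K. \<forall>X\<in>V. \<forall>Y\<in>V.
        Q ** X ** transpose Q \<in> V \<and>
        b (Q ** X ** transpose Q) (Q ** Y ** transpose Q) = b X Y)"

definition diag_form :: "real \<Rightarrow> real \<Rightarrow> real \<Rightarrow> real \<Rightarrow> 'm::finite sqmat \<Rightarrow> 'm sqmat \<Rightarrow> real" where
  "diag_form x2 x12 x13 x23 X Y =
     x2 * - killing (block_part 2 2 X) (block_part 2 2 Y) +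
     x12 * - killing (block_part 1 2 X) (block_part 1 2 Y) +
     x13 * - killing (block_part 1 3 X) (block_part 1 3 Y) +
     x23 * - killing (block_part 2 3 X) (block_part 2 3 Y)"

text \<open>
  \<open>frak_p\<close> is identified with the tangent space at the base point by \<open>X \<mapsto> d/dt exp(tX) base_frame\<close>
  at \<open>t = 0\<close>, that is \<open>X \<mapsto> X ** base_frame\<close>. An \<open>SO(n)\<close>-invariant metric corresponds to the
  scalar product it induces on \<open>frak_p\<close>.
\<close>

definition given_by ::
    "('m::finite frame \<Rightarrow> 'm frame \<Rightarrow> 'm frame \<Rightarrow> real) \<Rightarrow> ('m sqmat \<Rightarrow> 'm sqmat \<Rightarrow> real) \<Rightarrow> bool" where
  "given_by g b \<longleftrightarrow>
     (\<forall>X\<in>frak_p. \<forall>Y\<in>frak_p. g base_frame (X ** base_frame) (Y ** base_frame) = b X Y)"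

definition jensen_parameter :: "real \<Rightarrow> nat \<Rightarrow> real" where
  "jensen_parameter s n = (real n - 2 + s * sqrt ((real n)\<^sup>2 - 6 * real n + 6)) / (real n - 1)"

definition jensen_form :: "real \<Rightarrow> 'm::finite sqmat \<Rightarrow> 'm sqmat \<Rightarrow> real" where
  "jensen_form s = (let x = jensen_parameter s CARD(4 + 'm) in diag_form x x 1 1)"


section \<open>Consistency of the homogeneous space model\<close>

text \<open>
  \<open>SO(n)\<close> acts transitively on \<open>stiefel\<close> and the stabilizer of \<open>base_frame\<close> is \<open>SO(n - 4)\<close>, so that
  \<open>stiefel\<close> is the homogeneous space \<open>SO(n)/SO(n - 4)\<close>.
\<close>

lemma matrix_mul_base_frame: "((X :: real ^ (4 + 'm::finite) ^ 'k::finite) ** base_frame) $ i $ j = X $ i $ Inl j"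
  by (simp add: matrix_matrix_mult_def base_frame_def mult_delta_right)

lemma stabilizer_base_frame:
  "{Q :: 'm::finite sqmat. rotation_matrix Q \<and> Q ** base_frame = base_frame} = SO_block 3"
proof -
  have *: "(Q *v axis k 1) $ i = Q $ i $ k" for Q :: "'m sqmat" and i k
    by (simp add: matrix_vector_mul_component inner_axis)
  have ni: "k \<notin> block 3 \<longleftrightarrow> (\<exists>j. k = Inl j)" for k :: "4 + 'm"
    by (cases k) (auto simp: block_def)
  have "Q ** base_frame = base_frame \<longleftrightarrow> (\<forall>i j. Q $ i $ Inl j = (if i = Inl j then 1 else 0))"
    for Q :: "'m sqmat"
    unfolding vec_eq_iff matrix_mul_base_frame by (simp add: base_frame_def)
  moreover have "Q *v axis (Inl j) 1 = axis (Inl j) 1 \<longleftrightarrow> (\<forall>i. Q $ i $ Inl j = (if i = Inl j then 1 else 0))"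
    for Q :: "'m sqmat" and j
    unfolding vec_eq_iff * by (simp add: axis_def eq_commute)
  ultimately have "Q ** base_frame = base_frame \<longleftrightarrow> (\<forall>j. Q *v axis (Inl j) 1 = axis (Inl j) 1)" for Q :: "'m sqmat"
    by blast
  then show ?thesis
    unfolding SO_block_def using ni by auto
qed

lemma stiefel_orbit:
  "stiefel = {Q ** base_frame | Q :: 'm::finite sqmat. rotation_matrix Q}"
proof (intro set_eqI iffI)
  fix A :: "'m frame"
  assume "A \<in> {Q ** base_frame | Q :: 'm sqmat. rotation_matrix Q}"
  then obtain Q :: "'m sqmat" where Q: "rotation_matrix Q" and A: "A = Q ** base_frame" by auto
  have "transpose A ** A = transpose base_frame ** (transpose Q ** Q) ** base_frame"
    unfolding A by (simp add: matrix_transpose_mul matrix_mul_assoc)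
  also have "\<dots> = transpose base_frame ** (base_frame :: 'm frame)"
    using Q by (simp add: rotation_matrix_def orthogonal_matrix)
  also have "\<dots> = mat 1"
    unfolding vec_eq_iff matrix_mul_base_frame by (simp add: base_frame_def transpose_def mat_def)
  finally show "A \<in> stiefel" by (simp add: stiefel_def)
next
  fix A :: "'m frame"
  assume "A \<in> stiefel"
  then have AA: "transpose A ** A = mat 1" by (simp add: stiefel_def)
  have cols: "column i A \<bullet> column j A = (if i = j then 1 else 0)" for i j
  proof -
    have "(transpose A ** A) $ i $ j = column i A \<bullet> column j A"
      by (simp add: matrix_matrix_mult_def transpose_def column_def inner_vec_def)
    then show ?thesis using AA by (simp add: mat_def)
  qed
  define C where "C = range (\<lambda>j. column j A)"
  have injc: "inj (\<lambda>j. column j A)"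
    by (rule injI) (metis cols zero_neq_one)
  have cardC: "card C = 4" unfolding C_def using card_image[OF injc] by simp
  have poC: "pairwise orthogonal C"
  proof (rule pairwiseI)
    fix x y assume "x \<in> C" "y \<in> C" "x \<noteq> y"
    then obtain i j where "x = column i A" "y = column j A" "i \<noteq> j" unfolding C_def by blast
    then show "orthogonal x y" by (simp add: orthogonal_def cols)
  qed
  have indC: "independent C"
  proof (rule pairwise_orthogonal_independent[OF poC])
    show "0 \<notin> C"
    proof
      assume "0 \<in> C"
      then obtain j where "column j A = 0" unfolding C_def by (metis imageE)
      then show False using cols[of j j] by simp
    qed
  qed
  define W where "W = {y. \<forall>x\<in>span C. orthogonal x y}"
  have "dim W + dim (span C) = dim (UNIV :: (real ^ (4 + 'm)) set)"
    using dim_subspace_orthogonal_to_vectors[of "span C" UNIV] by (simp add: W_def)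
  moreover have "dim (span C) = 4" using indC cardC by (simp add: dim_eq_card_independent)
  moreover have "dim (UNIV :: (real ^ (4 + 'm)) set) = 4 + CARD('m)"
    by (simp add: dim_UNIV card_UNIV_sum)
  ultimately have dimW: "dim W = CARD('m)" by simp
  have subW: "subspace W"
    unfolding W_def by (simp add: subspace_orthogonal_to_vectors)
  obtain B where B: "B \<subseteq> W" "pairwise orthogonal B" "\<And>x. x \<in> B \<Longrightarrow> norm x = 1"
      "independent B" "card B = dim W"
    using orthonormal_basis_subspace[OF subW] by metis
  have finB: "finite B" using B(4) by (rule independent_imp_finite)
  obtain f where f: "bij_betw f (UNIV :: 'm set) B"
    using finite_same_card_bij[OF finite finB] B(5) dimW by auto
  define Q :: "'m sqmat" where
    "Q = (\<chi> i k. case k of Inl j \<Rightarrow> A $ i $ j | Inr k \<Rightarrow> f k $ i)"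
  have cl: "column (Inl j) Q = column j A" and cr: "column (Inr k) Q = f k" for j k
    by (simp_all add: Q_def column_def vec_eq_iff)
  have fW: "f k \<in> W" and fB: "f k \<in> B" for k using f B(1) by (auto simp: bij_betw_def)
  have oc: "orthogonal (column j A) (f k)" for j k
    using fW[of k] span_base[of "column j A" C] unfolding W_def C_def by blast
  have oQ: "orthogonal_matrix Q"
    unfolding orthogonal_matrix_orthonormal_columns
  proof (intro conjI allI impI)
    fix i show "norm (column i Q) = 1"
      by (cases i) (use cols B(3) fB in \<open>auto simp: cl cr norm_eq_1\<close>)
  next
    fix i j :: "4 + 'm" assume "i \<noteq> j"
    moreover have "orthogonal (f k) (f l)" if "k \<noteq> l" for k l
      using that B(2) fB f unfolding pairwise_def bij_betw_def inj_on_def by blast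
    ultimately show "orthogonal (column i Q) (column j Q)"
      using cols oc by (cases i; cases j) (auto simp: cl cr orthogonal_def inner_commute)
  qed
  obtain k0 :: 'm where True by blast
  define D :: "'m sqmat" where
    "D = (\<chi> i j. if i = j then (if i = Inr k0 then det Q else 1) else 0)"
  have dQ: "det Q * det Q = 1" using det_orthogonal_matrix[OF oQ] by auto
  have trD: "transpose D = D"
    by (simp add: vec_eq_iff transpose_def D_def)
  have mD: "(Z ** D) $ i $ j = Z $ i $ j * (if j = Inr k0 then det Q else 1)" for Z :: "'m sqmat" and i j
    by (simp add: matrix_matrix_mult_def D_def mult_delta_right)
  have "transpose D ** D = mat 1"
    unfolding vec_eq_iff trD mD using dQ by (simp add: D_def mat_def)
  then have oD: "orthogonal_matrix D" by (simp add: orthogonal_matrix)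
  have "det D = (\<Prod>i\<in>UNIV. D $ i $ i)" by (rule det_diagonal) (simp add: D_def)
  also have "\<dots> = det Q" by (simp add: D_def prod.delta)
  finally have "det (Q ** D) = 1" using dQ by (simp add: det_mul)
  then have "rotation_matrix (Q ** D)"
    using oQ oD by (simp add: rotation_matrix_def orthogonal_matrix_mul)
  moreover have "A = (Q ** D) ** base_frame"
    unfolding vec_eq_iff matrix_mul_base_frame mD by (simp add: Q_def)
  ultimately show "A \<in> {Q ** base_frame | Q :: 'm sqmat. rotation_matrix Q}" by blast
qed

lemma frak_p_iff:
  "(X :: 'm::finite sqmat) \<in> frak_p \<longleftrightarrow> X \<in> so \<and> (\<forall>a b. X $ Inr a $ Inr b = 0)"
proof -
  have n: "real CARD(4 + 'm) - 2 \<noteq> 0" by (simp add: card_UNIV_sum)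
  have tr: "trace (X ** Y) = (\<Sum>i\<in>UNIV. \<Sum>j\<in>UNIV. X $ i $ j * Y $ j $ i)" for Y :: "'m sqmat"
    by (simp add: trace_def matrix_matrix_mult_def)
  have skew: "X $ i $ j = - X $ j $ i" if "X \<in> so" for i j
    using that unfolding so_def by (metis (mono_tags) mem_Collect_eq transpose_def vec_lambda_beta vector_uminus_component)
  show ?thesis
  proof safe
    assume X: "X \<in> frak_p"
    then show so: "X \<in> so" by (simp add: frak_p_def)
    fix a b
    show "X $ Inr a $ Inr b = 0"
    proof (cases "a = b")
      case True then show ?thesis using skew[OF so, of "Inr a" "Inr a"] by simp
    next
      case False
      define E :: "4 + 'm \<Rightarrow> 4 + 'm \<Rightarrow> 'm sqmat" where
        "E p q = (\<chi> i j. if i = p then if j = q then 1 else 0 else 0)" for p q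
      define Y where "Y = E (Inr b) (Inr a) - E (Inr a) (Inr b)"
      have E: "trace (X ** E p q) = X $ q $ p" for p q
        unfolding tr E_def by (simp add: mult_delta_right)
      have "Y \<in> frak_h"
        by (auto simp: so_block_def so_def block_part_def block_def Y_def E_def vec_eq_iff transpose_def)
      then have "trace (X ** Y) = 0" using X n by (auto simp: frak_p_def killing_def)
      moreover have "trace (X ** Y) = X $ Inr a $ Inr b - X $ Inr b $ Inr a"
        unfolding E[symmetric] by (simp add: tr Y_def algebra_simps sum_subtractf)
      ultimately show ?thesis using skew[OF so, of "Inr a" "Inr b"] by simp
    qed
  next
    assume so: "X \<in> so" and z: "\<forall>a b. X $ Inr a $ Inr b = 0"
    have "killing X Y = 0" if "Y \<in> frak_h" for Y
    proof -
      have "block_part 3 3 Y = Y" using that by (simp add: so_block_def)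
      then have "Y $ i $ j = block_part 3 3 Y $ i $ j" for i j by simp
      then have "Y $ i $ j = (if i \<in> range Inr \<and> j \<in> range Inr then Y $ i $ j else 0)" for i j
        by (simp add: block_part_def block_def)
      then have "X $ i $ j * Y $ j $ i = 0" for i j
        using z by (metis imageE mult_zero_left mult_zero_right)
      then have "trace (X ** Y) = 0" unfolding tr by (intro sum.neutral ballI)
      then show ?thesis by (simp add: killing_def)
    qed
    then show "X \<in> frak_p" using so by (simp add: frak_p_def)
  qed
qed

lemma frak_p_decomposition:
  "(frak_p :: 'm::finite sqmat set) =
     {X2 + X12 + X13 + X23 | X2 X12 X13 X23. X2 \<in> so_3 \<and> X12 \<in> m_12 \<and> X13 \<in> m_13 \<and> X23 \<in> m_23}"
proof (intro set_eqI iffI)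
  fix X :: "'m sqmat"
  assume "X \<in> frak_p"
  then have so: "X \<in> so" and z: "\<And>a b. X $ Inr a $ Inr b = 0" by (auto simp: frak_p_iff)
  have skew: "X $ i $ j = - X $ j $ i" for i j
    using so unfolding so_def by (metis (mono_tags) mem_Collect_eq transpose_def vec_lambda_beta vector_uminus_component)
  have part: "block_part a b X \<in> so_block a b" for a b
  proof -
    have "block_part a b X $ j $ i = - block_part a b X $ i $ j" for i j
      using skew[of j i] by (simp add: block_part_def disj_commute conj_commute)
    then have "transpose (block_part a b X) = - block_part a b X"
      unfolding vec_eq_iff transpose_def vec_lambda_beta vector_uminus_component by blast
    moreover have "block_part a b (block_part a b X) = block_part a b X"
      by (simp add: block_part_def vec_eq_iff)
    ultimately show ?thesis by (simp add: so_block_def so_def)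
  qed
  have d: "X $ i $ i = 0" for i using skew[of i i] by simp
  have "X = block_part 2 2 X + block_part 1 2 X + block_part 1 3 X + block_part 2 3 X"
  proof -
    have "X $ i $ j = (block_part 2 2 X + block_part 1 2 X + block_part 1 3 X + block_part 2 3 X) $ i $ j" for i j
    proof -
      have "i = Inl 1 \<or> i = Inl 2 \<or> i = Inl 3 \<or> i = Inl 4 \<or> (\<exists>a. i = Inr a)"
           "j = Inl 1 \<or> j = Inl 2 \<or> j = Inl 3 \<or> j = Inl 4 \<or> (\<exists>a. j = Inr a)"
        by (metis exhaust_4 sum.exhaust)+
      then show ?thesis using d z by (auto simp: block_part_def block_def)
    qed
    then show ?thesis by (simp add: vec_eq_iff)
  qed
  with part show "X \<in> {X2 + X12 + X13 + X23 | X2 X12 X13 X23. X2 \<in> so_3 \<and> X12 \<in> m_12 \<and> X13 \<in> m_13 \<and> X23 \<in> m_23}"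
    by blast
next
  fix X :: "'m sqmat"
  assume "X \<in> {X2 + X12 + X13 + X23 | X2 X12 X13 X23. X2 \<in> so_3 \<and> X12 \<in> m_12 \<and> X13 \<in> m_13 \<and> X23 \<in> m_23}"
  then obtain X2 X12 X13 X23 where X: "X = X2 + X12 + X13 + X23"
    and m: "X2 \<in> so_3" "X12 \<in> m_12" "X13 \<in> m_13" "X23 \<in> m_23" by blast
  have "Y $ Inr p $ Inr q = 0" if "Y \<in> so_block a b" "a = 1 \<or> a = 2" for Y :: "'m sqmat" and a b p q
  proof -
    have "Y $ Inr p $ Inr q = block_part a b Y $ Inr p $ Inr q" using that by (simp add: so_block_def)
    then show ?thesis using that(2) by (auto simp: block_part_def block_def)
  qed
  with m have "X $ Inr p $ Inr q = 0" for p q unfolding X by simp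
  moreover have "X \<in> so"
  proof -
    have add: "transpose (Y + Z) = transpose Y + transpose Z" for Y Z :: "'m sqmat"
      by (simp add: vec_eq_iff transpose_def)
    show ?thesis using m unfolding X so_block_def so_def by (simp add: add)
  qed
  ultimately show "X \<in> frak_p" by (simp add: frak_p_iff)
qed

end

theory Submission
  imports Defs
begin

text \<open>
  An \<open>SO(n)\<close>-invariant metric is determined by a scalar product on \<open>\<p>\<close>. The generators \<open>e\<^sub>a\<^sub>b\<close> of the
  rotations in the coordinate planes form an orthogonal basis for all the scalar products considered here,
  so a metric is a table of weights \<open>x\<^sub>a\<^sub>b\<close>, and \<open>[e\<^sub>a\<^sub>b, e\<^sub>b\<^sub>c] = e\<^sub>a\<^sub>c\<close> makes the Ricci tensor diagonal in the
  same basis. The Einstein condition then is a system of four algebraic equations for the four weights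
  \<open>x\<^sub>2, x\<^sub>1\<^sub>2, x\<^sub>1\<^sub>3, x\<^sub>2\<^sub>3\<close> and the Einstein constant.

  Ricci curvature is defined by Christoffel symbols in an arbitrary parametrization. The bridge to the Lie
  algebra is a moving frame: near each point a parametrization \<open>\<phi>\<close> lifts to a smooth map \<open>Q\<close> into the
  orthogonal group (\<open>moving_frame\<close>), and \<open>\<omega>\<^sub>i = Q\<^sup>T \<partial>\<^sub>iQ\<close> satisfies the Maurer-Cartan equation
  (\<open>maurer_cartan\<close>). In terms of \<open>\<omega>\<close> the metric has constant coefficients. An algebraic connection that is
  metric and torsion free must therefore reproduce the Christoffel symbols, and its algebraic curvature
  reproduces the Ricci tensor as a trace over \<open>\<p>\<close> (\<open>ricci_of_frame\<close>). Since this works in every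
  parametrization, no change of coordinates is ever needed. The connection is Nomizu's formula for a diagonal
  metric, written with entrywise multiplication by the weights (\<open>conn\<close>); its Ricci trace is evaluated in
  \<open>ricci_trace\<close>.

  Normalize \<open>x\<^sub>2\<^sub>3 = 1\<close> and put \<open>x = x\<^sub>2\<close>, \<open>y = x\<^sub>1\<^sub>2\<close>, \<open>p = x\<^sub>1\<^sub>3\<close>. For \<open>p = 1\<close> and \<open>x = y\<close> the system is the
  quadratic equation whose roots are the two Jensen parameters. Away from \<open>p = 1\<close> the unknowns \<open>x\<close> and the
  Einstein constant can be eliminated and a factor \<open>p - 1\<close> split off, which leaves two polynomial equations
  \<open>G1 = 0\<close> and \<open>G2 = 0\<close> in \<open>y\<close> and \<open>w = p - 1\<close> (\<open>einstein_eqs_of_zero\<close>). On two explicit boxes, one with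
  \<open>w > 0\<close> and one with \<open>w < 0\<close>, \<open>G1\<close> changes sign between one pair of opposite sides and \<open>G2\<close> between the
  other, so each box contains a common zero by the two-dimensional intermediate value theorem
  (\<open>first_family\<close>, \<open>second_family_2\<close>, \<open>second_family_ge3\<close>). The values of \<open>x\<close> and \<open>p\<close>
  distinguish the four metrics up to scaling.
\<close>

section \<open>Smooth functions of several real variables\<close>

lemma partial_eq:
  assumes "(f has_derivative f') (at u)"
  shows "partial i f u = f' (axis i 1)"
  unfolding partial_def using frechet_derivative_at[OF assms] by simp

lemma partial_cong_open:
  assumes "f differentiable at u" "open U" "u \<in> U" "\<And>v. v \<in> U \<Longrightarrow> f v = g v"
  shows "partial i f u = partial i g u"
  unfolding partial_def using frechet_derivative_transform_within_open[OF assms] by simp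

lemma C_on_differentiable:
  assumes "open U" "C_on (Suc k) U f" "u \<in> U"
  shows "f differentiable at u"
  using assms by (simp add: differentiable_on_eq_differentiable_at)

lemma C_on_cong:
  assumes "open U" "C_on k U f" "\<And>u. u \<in> U \<Longrightarrow> f u = g u"
  shows "C_on k U g"
  using assms(2,3)
proof (induction k arbitrary: f g)
  case 0
  then show ?case using continuous_on_cong[of U U f g] by simp
next
  case (Suc k)
  have d: "f differentiable at u" if "u \<in> U" for u
    using C_on_differentiable[OF assms(1) Suc.prems(1) that] .
  have "g differentiable at u" if "u \<in> U" for u
    using d[OF that] Suc.prems(2) assms(1) that
    by (meson differentiable_def has_derivative_transform_within_open)
  moreover have "C_on k U (partial i g)" for i
  proof (rule Suc.IH)
    show "C_on k U (partial i f)" using Suc.prems(1) by simp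
    show "partial i f u = partial i g u" if "u \<in> U" for u
      using partial_cong_open[OF d[OF that] assms(1) that Suc.prems(2)] by simp
  qed
  ultimately show ?case
    using assms(1) by (simp add: differentiable_on_eq_differentiable_at)
qed

lemma C_on_lower:
  assumes "C_on (Suc k) U f"
  shows "C_on k U f"
  using assms
proof (induction k arbitrary: f)
  case 0
  then show ?case using differentiable_imp_continuous_on by auto
next
  case (Suc k)
  then show ?case by simp
qed

lemma C_on_subset:
  assumes "C_on k U f" "V \<subseteq> U"
  shows "C_on k V f"
  using assms(1)
proof (induction k arbitrary: f)
  case 0
  then show ?case using assms(2) continuous_on_subset by auto
next
  case (Suc k)
  then show ?case using assms(2) differentiable_on_subset by auto
qed

lemma C_on_const: "C_on k U (\<lambda>u. c)"
proof (induction k arbitrary: c)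
  case 0
  show ?case by simp
next
  case (Suc k)
  have "partial i (\<lambda>u. c) = (\<lambda>u. 0)" for i :: 'a
    by (rule ext) (simp add: partial_def)
  then show ?case using Suc by simp
qed

lemma C_on_bounded_linear:
  fixes f :: "real ^ 'd::finite \<Rightarrow> 'a::real_normed_vector"
    and L :: "'a \<Rightarrow> 'b::real_normed_vector"
  assumes "open U" "bounded_linear L" "C_on k U f"
  shows "C_on k U (\<lambda>u. L (f u))"
  using assms(3)
proof (induction k arbitrary: f)
  case 0
  then show ?case using bounded_linear.continuous_on[OF assms(2)] by simp
next
  case (Suc k)
  have d: "((\<lambda>u. L (f u)) has_derivative (\<lambda>h. L (frechet_derivative f (at u) h))) (at u)" if "u \<in> U" for u
    using C_on_differentiable[OF assms(1) Suc.prems that] bounded_linear.has_derivative[OF assms(2)]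
      frechet_derivative_works by blast
  have eq: "partial i (\<lambda>u. L (f u)) u = L (partial i f u)" if "u \<in> U" for i u
    using partial_eq[OF d[OF that]] by (simp add: partial_def)
  have co: "C_on k U (\<lambda>u. L (partial i f u))" for i
    using Suc by simp
  have "C_on k U (partial i (\<lambda>u. L (f u)))" for i
    by (rule C_on_cong[OF assms(1) co[of i]]) (simp add: eq)
  then show ?case
    using d assms(1) by (auto simp: differentiable_on_eq_differentiable_at differentiable_def)
qed

lemma C_on_add:
  fixes f g :: "real ^ 'd::finite \<Rightarrow> 'a::real_normed_vector"
  assumes "open U" "C_on k U f" "C_on k U g"
  shows "C_on k U (\<lambda>u. f u + g u)"
  using assms(2,3)
proof (induction k arbitrary: f g)
  case 0
  then show ?case by (simp add: continuous_on_add)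
next
  case (Suc k)
  have d: "((\<lambda>u. f u + g u) has_derivative
      (\<lambda>h. frechet_derivative f (at u) h + frechet_derivative g (at u) h)) (at u)" if "u \<in> U" for u
    using C_on_differentiable[OF assms(1) Suc.prems(1) that] C_on_differentiable[OF assms(1) Suc.prems(2) that]
    by (intro has_derivative_add) (simp_all add: frechet_derivative_works)
  have eq: "partial i (\<lambda>u. f u + g u) u = partial i f u + partial i g u" if "u \<in> U" for i u
    using partial_eq[OF d[OF that]] by (simp add: partial_def)
  have co: "C_on k U (\<lambda>u. partial i f u + partial i g u)" for i
    using Suc by simp
  have "C_on k U (partial i (\<lambda>u. f u + g u))" for i
    by (rule C_on_cong[OF assms(1) co[of i]]) (simp add: eq)
  then show ?case
    using d assms(1) by (auto simp: differentiable_on_eq_differentiable_at differentiable_def)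
qed

lemma C_on_bounded_bilinear:
  fixes f :: "real ^ 'd::finite \<Rightarrow> 'a::real_normed_vector"
    and g :: "real ^ 'd \<Rightarrow> 'b::real_normed_vector"
    and B :: "'a \<Rightarrow> 'b \<Rightarrow> 'c::real_normed_vector"
  assumes "open U" "bounded_bilinear B" "C_on k U f" "C_on k U g"
  shows "C_on k U (\<lambda>u. B (f u) (g u))"
  using assms(3,4)
proof (induction k arbitrary: f g)
  case 0
  then show ?case using bounded_bilinear.continuous_on[OF assms(2)] by simp
next
  case (Suc k)
  have d: "((\<lambda>u. B (f u) (g u)) has_derivative
      (\<lambda>h. B (f u) (frechet_derivative g (at u) h) + B (frechet_derivative f (at u) h) (g u))) (at u)"
    if "u \<in> U" for u
    using C_on_differentiable[OF assms(1) Suc.prems(1) that] C_on_differentiable[OF assms(1) Suc.prems(2) that]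
    by (intro bounded_bilinear.FDERIV[OF assms(2)]) (simp_all add: frechet_derivative_works)
  have eq: "partial i (\<lambda>u. B (f u) (g u)) u = B (f u) (partial i g u) + B (partial i f u) (g u)"
    if "u \<in> U" for i u
    using partial_eq[OF d[OF that]] by (simp add: partial_def)
  have co: "C_on k U (\<lambda>u. B (f u) (partial i g u) + B (partial i f u) (g u))" for i
    using Suc.prems C_on_lower[of k U f] C_on_lower[of k U g]
    by (intro C_on_add[OF assms(1)] Suc.IH) auto
  have "C_on k U (partial i (\<lambda>u. B (f u) (g u)))" for i
    by (rule C_on_cong[OF assms(1) co[of i]]) (simp add: eq)
  then show ?case
    using d assms(1) by (auto simp: differentiable_on_eq_differentiable_at differentiable_def)
qed

lemma C_on_sum:
  fixes f :: "'i \<Rightarrow> real ^ 'd::finite \<Rightarrow> 'a::real_normed_vector"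
  assumes "open U" "\<And>i. i \<in> I \<Longrightarrow> C_on k U (f i)"
  shows "C_on k U (\<lambda>u. \<Sum>i\<in>I. f i u)"
  using assms(2)
  by (induction I rule: infinite_finite_induct) (simp_all add: C_on_const C_on_add[OF assms(1)])

lemma C_on_prod:
  fixes f :: "'i \<Rightarrow> real ^ 'd::finite \<Rightarrow> real"
  assumes "open U" "\<And>i. i \<in> I \<Longrightarrow> C_on k U (f i)"
  shows "C_on k U (\<lambda>u. \<Prod>i\<in>I. f i u)"
  using assms(2)
  by (induction I rule: infinite_finite_induct)
    (simp_all add: C_on_const C_on_bounded_bilinear[OF assms(1) bounded_bilinear_mult])

lemma C_on_inverse:
  fixes f :: "real ^ 'd::finite \<Rightarrow> real"
  assumes "open U" "C_on k U f" "\<And>u. u \<in> U \<Longrightarrow> f u \<noteq> 0"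
  shows "C_on k U (\<lambda>u. inverse (f u))"
  using assms(2)
proof (induction k)
  case 0
  then show ?case using assms(3) by (simp add: continuous_on_inverse)
next
  case (Suc k)
  have d: "((\<lambda>u. inverse (f u)) has_derivative
      (\<lambda>h. - (inverse (f u) * frechet_derivative f (at u) h * inverse (f u)))) (at u)"
    if "u \<in> U" for u
    using C_on_differentiable[OF assms(1) Suc.prems(1) that]
    by (intro Deriv.has_derivative_inverse assms(3) that) (simp_all add: frechet_derivative_works)
  have eq: "partial i (\<lambda>u. inverse (f u)) u = - (inverse (f u) * partial i f u * inverse (f u))"
    if "u \<in> U" for i u
    using partial_eq[OF d[OF that]] by (simp add: partial_def)
  have co: "C_on k U (\<lambda>u. - (inverse (f u) * partial i f u * inverse (f u)))" for i
    using Suc.prems Suc.IH C_on_lower[of k U f]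
    by (intro C_on_bounded_linear[OF assms(1) bounded_linear_minus[OF bounded_linear_ident]]
          C_on_bounded_bilinear[OF assms(1) bounded_bilinear_mult]) auto
  have "C_on k U (partial i (\<lambda>u. inverse (f u)))" for i
    by (rule C_on_cong[OF assms(1) co[of i]]) (simp add: eq)
  then show ?case
    using d assms(1) by (auto simp: differentiable_on_eq_differentiable_at differentiable_def)
qed

lemma smooth_on_partial: "smooth_on U f \<Longrightarrow> smooth_on U (partial i f)"
  unfolding smooth_on_def by (metis C_on.simps(2))

lemma smooth_on_subset: "smooth_on U f \<Longrightarrow> V \<subseteq> U \<Longrightarrow> smooth_on V f"
  unfolding smooth_on_def using C_on_subset by blast

lemma smooth_on_cong:
  "open U \<Longrightarrow> smooth_on U f \<Longrightarrow> (\<And>u. u \<in> U \<Longrightarrow> f u = g u) \<Longrightarrow> smooth_on U g"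
  unfolding smooth_on_def using C_on_cong by blast

lemma smooth_on_differentiable:
  "open U \<Longrightarrow> smooth_on U f \<Longrightarrow> u \<in> U \<Longrightarrow> f differentiable at u"
  unfolding smooth_on_def using C_on_differentiable by blast

lemma smooth_on_const: "smooth_on U (\<lambda>u. c)"
  unfolding smooth_on_def using C_on_const by blast

lemma smooth_on_linear:
  fixes f :: "real ^ 'd::finite \<Rightarrow> 'a::euclidean_space" and L :: "'a \<Rightarrow> 'b::real_normed_vector"
  shows "open U \<Longrightarrow> linear L \<Longrightarrow> smooth_on U f \<Longrightarrow> smooth_on U (\<lambda>u. L (f u))"
  unfolding smooth_on_def using C_on_bounded_linear linear_conv_bounded_linear by blast

lemma smooth_on_add:
  fixes f g :: "real ^ 'd::finite \<Rightarrow> 'a::real_normed_vector"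
  shows "open U \<Longrightarrow> smooth_on U f \<Longrightarrow> smooth_on U g \<Longrightarrow> smooth_on U (\<lambda>u. f u + g u)"
  unfolding smooth_on_def using C_on_add by blast

lemma smooth_on_bilinear:
  fixes f :: "real ^ 'd::finite \<Rightarrow> 'a::euclidean_space" and g :: "real ^ 'd \<Rightarrow> 'b::euclidean_space"
    and B :: "'a \<Rightarrow> 'b \<Rightarrow> 'c::real_normed_vector"
  shows "open U \<Longrightarrow> bilinear B \<Longrightarrow> smooth_on U f \<Longrightarrow> smooth_on U g \<Longrightarrow> smooth_on U (\<lambda>u. B (f u) (g u))"
  unfolding smooth_on_def using C_on_bounded_bilinear bilinear_conv_bounded_bilinear by blast

lemma smooth_on_sum:
  fixes f :: "'i \<Rightarrow> real ^ 'd::finite \<Rightarrow> 'a::real_normed_vector"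
  shows "open U \<Longrightarrow> (\<And>i. i \<in> I \<Longrightarrow> smooth_on U (f i)) \<Longrightarrow> smooth_on U (\<lambda>u. \<Sum>i\<in>I. f i u)"
  unfolding smooth_on_def by (metis C_on_sum)

lemma smooth_on_prod:
  fixes f :: "'i \<Rightarrow> real ^ 'd::finite \<Rightarrow> real"
  shows "open U \<Longrightarrow> (\<And>i. i \<in> I \<Longrightarrow> smooth_on U (f i)) \<Longrightarrow> smooth_on U (\<lambda>u. \<Prod>i\<in>I. f i u)"
  unfolding smooth_on_def by (metis C_on_prod)

lemma smooth_on_mult:
  fixes f g :: "real ^ 'd::finite \<Rightarrow> real"
  shows "open U \<Longrightarrow> smooth_on U f \<Longrightarrow> smooth_on U g \<Longrightarrow> smooth_on U (\<lambda>u. f u * g u)"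
  unfolding smooth_on_def using C_on_bounded_bilinear[OF _ bounded_bilinear_mult] by blast

lemma smooth_on_inverse:
  fixes f :: "real ^ 'd::finite \<Rightarrow> real"
  shows "open U \<Longrightarrow> smooth_on U f \<Longrightarrow> (\<And>u. u \<in> U \<Longrightarrow> f u \<noteq> 0) \<Longrightarrow> smooth_on U (\<lambda>u. inverse (f u))"
  unfolding smooth_on_def using C_on_inverse by blast

lemma linear_entry: "linear (\<lambda>M :: real ^ 'b::finite ^ 'a::finite. M $ i $ j)"
  by (rule linearI) simp_all

lemma smooth_on_entry:
  fixes M :: "real ^ 'd::finite \<Rightarrow> real ^ 'b::finite ^ 'a::finite"
  shows "open U \<Longrightarrow> smooth_on U M \<Longrightarrow> smooth_on U (\<lambda>u. M u $ i $ j)"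
  by (rule smooth_on_linear[OF _ linear_entry])

lemma smooth_on_matrix:
  fixes M :: "real ^ 'd::finite \<Rightarrow> real ^ 'b::finite ^ 'a::finite"
  assumes U: "open U" and e: "\<And>i j. smooth_on U (\<lambda>u. M u $ i $ j)"
  shows "smooth_on U M"
proof -
  define E :: "'a \<Rightarrow> 'b \<Rightarrow> real ^ 'b ^ 'a" where "E i j = (\<chi> k l. if k = i then if l = j then 1 else 0 else 0)" for i j
  have "linear (\<lambda>c. c *\<^sub>R E i j)" for i j
    by (rule linearI) (simp_all add: scaleR_add_left)
  then have "smooth_on U (\<lambda>u. \<Sum>i\<in>UNIV. \<Sum>j\<in>UNIV. M u $ i $ j *\<^sub>R E i j)"
    using U e by (intro smooth_on_sum smooth_on_linear[of U "\<lambda>c. c *\<^sub>R E _ _"]) auto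
  moreover have "(\<Sum>i\<in>UNIV. \<Sum>j\<in>UNIV. M u $ i $ j *\<^sub>R E i j) = M u" for u
  proof -
    have "(\<Sum>i\<in>UNIV. \<Sum>j\<in>UNIV. M u $ i $ j * E i j $ k $ l) =
        (\<Sum>i\<in>UNIV. if k = i then \<Sum>j\<in>UNIV. if l = j then M u $ i $ j else 0 else 0)" for k l
      unfolding E_def by (intro sum.cong) (auto simp: mult_delta_right)
    then show ?thesis by (simp add: vec_eq_iff mult_delta_right)
  qed
  ultimately show ?thesis by simp
qed

lemma bilinear_matrix_mult:
  "bilinear ((**) :: real ^ 'b::finite ^ 'a::finite \<Rightarrow> real ^ 'c::finite ^ 'b \<Rightarrow> real ^ 'c ^ 'a)"
  unfolding bilinear_def
  by (auto intro!: linearI simp: vec_eq_iff matrix_matrix_mult_def algebra_simps sum.distrib sum_distrib_left)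

lemma linear_transpose: "linear (transpose :: real ^ 'b::finite ^ 'a::finite \<Rightarrow> real ^ 'a ^ 'b)"
  by (rule linearI) (simp_all add: vec_eq_iff transpose_def)

lemma smooth_on_matrix_mult:
  fixes M :: "real ^ 'd::finite \<Rightarrow> real ^ 'b::finite ^ 'a::finite" and N :: "real ^ 'd \<Rightarrow> real ^ 'c::finite ^ 'b"
  shows "open U \<Longrightarrow> smooth_on U M \<Longrightarrow> smooth_on U N \<Longrightarrow> smooth_on U (\<lambda>u. M u ** N u)"
  by (rule smooth_on_bilinear[OF _ bilinear_matrix_mult])

text \<open>
  The constant \<open>matrix_inv\<close> is a choice among two-sided inverses; a nonzero determinant provides one.
\<close>

lemma matrix_inv_det:
  fixes A :: "real ^ 'n::finite ^ 'n"
  assumes "det A \<noteq> 0"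
  shows "A ** matrix_inv A = mat 1" and "matrix_inv A ** A = mat 1"
proof -
  have "\<exists>B. A ** B = mat 1 \<and> B ** A = mat 1"
    using assms invertible_det_nz invertible_def by blast
  from someI_ex[OF this] show "A ** matrix_inv A = mat 1" and "matrix_inv A ** A = mat 1"
    unfolding matrix_inv_def by blast+
qed

lemma matrix_inv_entry:
  fixes A :: "real ^ 'n::finite ^ 'n"
  assumes "det A \<noteq> 0"
  shows "matrix_inv A $ k $ l = det (\<chi> i j. if j = k then (if i = l then 1 else 0) else A $ i $ j) * inverse (det A)"
proof -
  have "column l (A ** matrix_inv A) = axis l 1"
    by (simp add: matrix_inv_det(1)[OF assms] vec_eq_iff column_def mat_def axis_def eq_commute)
  then have "A *v column l (matrix_inv A) = axis l 1"
    by (simp add: matrix_inv_det(1)[OF assms] vec_eq_iff column_def matrix_matrix_mult_def matrix_vector_mult_def)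
  then have "column l (matrix_inv A) = (\<chi> k. det (\<chi> i j. if j = k then axis l 1 $ i else A $ i $ j) / det A)"
    using cramer[OF assms] by blast
  then have "column l (matrix_inv A) $ k = det (\<chi> i j. if j = k then axis l 1 $ i else A $ i $ j) / det A"
    by simp
  then show ?thesis by (simp add: column_def axis_def divide_inverse cong: if_cong)
qed

lemma smooth_on_det:
  fixes M :: "real ^ 'd::finite \<Rightarrow> real ^ 'n::finite ^ 'n"
  assumes "open U" "\<And>i j. smooth_on U (\<lambda>u. M u $ i $ j)"
  shows "smooth_on U (\<lambda>u. det (M u))"
  unfolding det_def
  by (intro smooth_on_sum smooth_on_mult smooth_on_prod smooth_on_const assms)

text \<open>By Cramer's rule the entries of the inverse are rational functions of those of the matrix.\<close>

lemma smooth_on_matrix_inv: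
  fixes M :: "real ^ 'd::finite \<Rightarrow> real ^ 'n::finite ^ 'n"
  assumes U: "open U" and M: "smooth_on U M" and d: "\<And>u. u \<in> U \<Longrightarrow> det (M u) \<noteq> 0"
  shows "smooth_on U (\<lambda>u. matrix_inv (M u))"
proof (rule smooth_on_matrix[OF U])
  fix k l
  have "smooth_on U (\<lambda>u. (\<chi> i j. if j = k then (if i = l then 1 else 0) else M u $ i $ j) $ i $ j)" for i j
    using smooth_on_const smooth_on_entry[OF U M] by (cases "j = k"; cases "i = l") simp_all
  then have "smooth_on U (\<lambda>u. det (\<chi> i j. if j = k then (if i = l then 1 else 0) else M u $ i $ j) * inverse (det (M u)))"
    by (intro smooth_on_mult smooth_on_inverse smooth_on_det U smooth_on_entry[OF U M] d)
  then show "smooth_on U (\<lambda>u. matrix_inv (M u) $ k $ l)"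
    by (rule smooth_on_cong[OF U]) (simp only: matrix_inv_entry[OF d])
qed

lemma partial_linear:
  fixes f :: "real ^ 'd::finite \<Rightarrow> 'a::euclidean_space" and L :: "'a \<Rightarrow> 'b::real_normed_vector"
  assumes "linear L" "f differentiable at u"
  shows "partial i (\<lambda>u. L (f u)) u = L (partial i f u)"
proof -
  have "((\<lambda>u. L (f u)) has_derivative (\<lambda>h. L (frechet_derivative f (at u) h))) (at u)"
    using assms bounded_linear.has_derivative linear_conv_bounded_linear frechet_derivative_works by blast
  from partial_eq[OF this] show ?thesis by (simp add: partial_def)
qed

lemma partial_bilinear:
  fixes f :: "real ^ 'd::finite \<Rightarrow> 'a::euclidean_space" and g :: "real ^ 'd \<Rightarrow> 'b::euclidean_space"
    and B :: "'a \<Rightarrow> 'b \<Rightarrow> 'c::real_normed_vector"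
  assumes "bilinear B" "f differentiable at u" "g differentiable at u"
  shows "partial i (\<lambda>u. B (f u) (g u)) u = B (f u) (partial i g u) + B (partial i f u) (g u)"
proof -
  have "((\<lambda>u. B (f u) (g u)) has_derivative
      (\<lambda>h. B (f u) (frechet_derivative g (at u) h) + B (frechet_derivative f (at u) h) (g u))) (at u)"
    using assms by (intro bounded_bilinear.FDERIV)
      (simp_all add: frechet_derivative_works bilinear_conv_bounded_bilinear)
  from partial_eq[OF this] show ?thesis by (simp add: partial_def)
qed

lemma partial_sum:
  fixes f :: "'i \<Rightarrow> real ^ 'd::finite \<Rightarrow> 'a::real_normed_vector"
  assumes "\<And>i. i \<in> I \<Longrightarrow> f i differentiable at u"
  shows "partial j (\<lambda>u. \<Sum>i\<in>I. f i u) u = (\<Sum>i\<in>I. partial j (f i) u)"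
proof -
  have "((\<lambda>u. \<Sum>i\<in>I. f i u) has_derivative (\<lambda>h. \<Sum>i\<in>I. frechet_derivative (f i) (at u) h)) (at u)"
    using assms by (intro has_derivative_sum) (simp add: frechet_derivative_works)
  from partial_eq[OF this] show ?thesis by (simp add: partial_def)
qed

lemma partial_add:
  fixes f g :: "real ^ 'd::finite \<Rightarrow> 'a::real_normed_vector"
  assumes "f differentiable at u" "g differentiable at u"
  shows "partial j (\<lambda>u. f u + g u) u = partial j f u + partial j g u"
proof -
  have "((\<lambda>u. f u + g u) has_derivative (\<lambda>h. frechet_derivative f (at u) h + frechet_derivative g (at u) h)) (at u)"
    using assms by (intro has_derivative_add) (simp_all add: frechet_derivative_works)
  from partial_eq[OF this] show ?thesis by (simp add: partial_def)
qed

lemma frechet_derivative_partials: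
  fixes f :: "real ^ 'd::finite \<Rightarrow> 'a::real_normed_vector"
  assumes "f differentiable at u"
  shows "frechet_derivative f (at u) c = (\<Sum>i\<in>UNIV. c $ i *\<^sub>R partial i f u)"
proof -
  have lin: "linear (frechet_derivative f (at u))"
    using assms frechet_derivative_works has_derivative_linear by blast
  have "c = (\<Sum>i\<in>UNIV. c $ i *\<^sub>R axis i 1)"
    by (simp add: vec_eq_iff axis_def mult_delta_right)
  then have "frechet_derivative f (at u) c = frechet_derivative f (at u) (\<Sum>i\<in>UNIV. c $ i *\<^sub>R axis i 1)"
    by simp
  also have "\<dots> = (\<Sum>i\<in>UNIV. c $ i *\<^sub>R partial i f u)"
    by (simp add: linear_sum[OF lin] linear_cmul[OF lin] partial_def)
  finally show ?thesis .
qed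

lemma partial_line_derivative:
  fixes f :: "real ^ 'd::finite \<Rightarrow> real"
  assumes "f differentiable at (v + t *\<^sub>R axis i 1)"
  shows "((\<lambda>t. f (v + t *\<^sub>R axis i 1)) has_real_derivative partial i f (v + t *\<^sub>R axis i 1)) (at t)"
proof -
  let ?D = "frechet_derivative f (at (v + t *\<^sub>R axis i 1))"
  have D: "(f has_derivative ?D) (at (v + t *\<^sub>R axis i 1))"
    using assms frechet_derivative_works by blast
  have "((\<lambda>t. v + t *\<^sub>R axis i 1) has_derivative (\<lambda>s. s *\<^sub>R axis i 1)) (at t)"
    by (auto intro!: derivative_eq_intros)
  from has_derivative_compose[OF this D]
  have "((\<lambda>t. f (v + t *\<^sub>R axis i 1)) has_derivative (\<lambda>s. ?D (s *\<^sub>R axis i 1))) (at t)" .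
  moreover have "(\<lambda>s. ?D (s *\<^sub>R axis i 1)) = (*) (partial i f (v + t *\<^sub>R axis i 1))"
    using linear_cmul[OF has_derivative_linear[OF D]] by (auto simp: partial_def mult.commute)
  ultimately show ?thesis by (simp add: has_field_derivative_def)
qed

text \<open>
  The mean value theorem is applied first in direction \<open>i\<close> and then in direction \<open>j\<close>. The second difference
  on the left is symmetric in \<open>i\<close> and \<open>j\<close>, so letting \<open>h\<close> tend to \<open>0\<close> shows that mixed partials commute.
\<close>

lemma second_difference_mean_value:
  fixes f :: "real ^ 'd::finite \<Rightarrow> real"
  assumes U: "open U" and f: "smooth_on U f" and h: "h > 0" and b: "cball u (2 * h) \<subseteq> U"
  shows "\<exists>\<xi>\<in>cball u (2 * h).
    f (u + h *\<^sub>R axis i 1 + h *\<^sub>R axis j 1) - f (u + h *\<^sub>R axis i 1) - f (u + h *\<^sub>R axis j 1) + f u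
      = h\<^sup>2 * partial j (partial i f) \<xi>"
proof -
  let ?a = "axis i 1 :: real ^ 'd" and ?b = "axis j 1 :: real ^ 'd"
  have near: "u + s *\<^sub>R ?a + t *\<^sub>R ?b \<in> cball u (2 * h)" if "0 \<le> s" "s \<le> h" "0 \<le> t" "t \<le> h" for s t
  proof -
    have "norm (s *\<^sub>R ?a + t *\<^sub>R ?b) \<le> norm (s *\<^sub>R ?a) + norm (t *\<^sub>R ?b)" by (rule norm_triangle_ineq)
    also have "\<dots> \<le> 2 * h" using that by simp
    finally have "norm (s *\<^sub>R ?a + t *\<^sub>R ?b) \<le> 2 * h" .
    moreover have "dist u (u + s *\<^sub>R ?a + t *\<^sub>R ?b) = norm (s *\<^sub>R ?a + t *\<^sub>R ?b)"
      by (metis add.assoc add_diff_cancel_left' dist_commute dist_norm)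
    ultimately show ?thesis by simp
  qed
  have df: "f differentiable at v" "partial i f differentiable at v" if "v \<in> cball u (2 * h)" for v
    using that b smooth_on_differentiable[OF U f] smooth_on_differentiable[OF U smooth_on_partial[OF f]] by blast+
  define g where "g s = f (u + h *\<^sub>R ?b + s *\<^sub>R ?a) - f (u + s *\<^sub>R ?a)" for s
  have g': "(g has_real_derivative partial i f (u + h *\<^sub>R ?b + s *\<^sub>R ?a) - partial i f (u + s *\<^sub>R ?a)) (at s)"
    if "0 \<le> s" "s \<le> h" for s
    unfolding g_def using that near[of s h] near[of s 0] h
    by (intro DERIV_diff partial_line_derivative df) (simp_all add: add_ac)
  obtain s where s: "0 < s" "s < h"
    and gs: "g h - g 0 = (h - 0) * (partial i f (u + h *\<^sub>R ?b + s *\<^sub>R ?a) - partial i f (u + s *\<^sub>R ?a))"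
    using MVT2[OF h g'] by blast
  define k where "k t = partial i f (u + s *\<^sub>R ?a + t *\<^sub>R ?b)" for t
  have k': "(k has_real_derivative partial j (partial i f) (u + s *\<^sub>R ?a + t *\<^sub>R ?b)) (at t)"
    if "0 \<le> t" "t \<le> h" for t
    unfolding k_def using that near[of s t] s by (intro partial_line_derivative df) simp_all
  obtain t where t: "0 < t" "t < h"
    and kt: "k h - k 0 = (h - 0) * partial j (partial i f) (u + s *\<^sub>R ?a + t *\<^sub>R ?b)"
    using MVT2[OF h k'] by blast
  have "g h - g 0 = h * (k h - k 0)"
    using gs by (simp add: k_def add_ac)
  then have "g h - g 0 = h\<^sup>2 * partial j (partial i f) (u + s *\<^sub>R ?a + t *\<^sub>R ?b)"
    using kt by (simp add: power2_eq_square)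
  moreover have "g h - g 0 = f (u + h *\<^sub>R ?a + h *\<^sub>R ?b) - f (u + h *\<^sub>R ?a) - f (u + h *\<^sub>R ?b) + f u"
    by (simp add: g_def add_ac)
  ultimately show ?thesis using near[of s t] s t by (intro bexI) auto
qed

lemma mixed_partials_real:
  fixes f :: "real ^ 'd::finite \<Rightarrow> real"
  assumes U: "open U" and f: "smooth_on U f" and u: "u \<in> U"
  shows "partial i (partial j f) u = partial j (partial i f) u"
proof (rule ccontr)
  let ?p = "partial i (partial j f)" and ?q = "partial j (partial i f)"
  assume ne: "?p u \<noteq> ?q u"
  define e where "e = \<bar>?p u - ?q u\<bar> / 2"
  have e: "e > 0" using ne by (simp add: e_def)
  have "continuous_on U ?p" "continuous_on U ?q"
    using smooth_on_partial[OF smooth_on_partial[OF f]] unfolding smooth_on_def by (metis C_on.simps(1))+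
  then have c: "isCont ?p u" "isCont ?q u"
    using U u continuous_on_eq_continuous_at by blast+
  obtain d1 where d1: "d1 > 0" "\<And>v. dist v u < d1 \<Longrightarrow> dist (?p v) (?p u) < e"
    using c(1) e unfolding continuous_at_eps_delta by blast
  obtain d2 where d2: "d2 > 0" "\<And>v. dist v u < d2 \<Longrightarrow> dist (?q v) (?q u) < e"
    using c(2) e unfolding continuous_at_eps_delta by blast
  obtain r where r: "r > 0" "cball u r \<subseteq> U" using U u open_contains_cball by blast
  define h where "h = min r (min d1 d2) / 3"
  have h: "h > 0" "2 * h < d1" "2 * h < d2" "2 * h \<le> r" using d1(1) d2(1) r(1) by (auto simp: h_def)
  then have b: "cball u (2 * h) \<subseteq> U" using r(2) by (meson subset_cball subset_trans)
  obtain v where v: "v \<in> cball u (2 * h)"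
    "f (u + h *\<^sub>R axis i 1 + h *\<^sub>R axis j 1) - f (u + h *\<^sub>R axis i 1) - f (u + h *\<^sub>R axis j 1) + f u = h\<^sup>2 * ?q v"
    using second_difference_mean_value[OF U f h(1) b] by blast
  obtain w where w: "w \<in> cball u (2 * h)"
    "f (u + h *\<^sub>R axis j 1 + h *\<^sub>R axis i 1) - f (u + h *\<^sub>R axis j 1) - f (u + h *\<^sub>R axis i 1) + f u = h\<^sup>2 * ?p w"
    using second_difference_mean_value[OF U f h(1) b] by blast
  have swap: "u + h *\<^sub>R axis j 1 + h *\<^sub>R axis i 1 = u + h *\<^sub>R axis i 1 + h *\<^sub>R axis j 1" by (simp add: add_ac)
  have "h\<^sup>2 * ?q v = h\<^sup>2 * ?p w" using v(2) w(2) unfolding swap by linarith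
  then have "?q v = ?p w" using h(1) by simp
  moreover have "dist (?p w) (?p u) < e" "dist (?q v) (?q u) < e"
    using v(1) w(1) h by (intro d1(2) d2(2); simp add: dist_commute)+
  ultimately show False unfolding e_def dist_real_def by (smt (verit) field_sum_of_halves)
qed

lemma mixed_partials:
  fixes f :: "real ^ 'd::finite \<Rightarrow> 'a::euclidean_space"
  assumes U: "open U" and f: "smooth_on U f" and u: "u \<in> U"
  shows "partial i (partial j f) u = partial j (partial i f) u"
proof (rule euclidean_eqI)
  fix b :: 'a
  have lin: "linear (\<lambda>x :: 'a. x \<bullet> b)" by (rule linearI) (simp_all add: inner_add_left)
  have s: "smooth_on U (\<lambda>u. f u \<bullet> b)" by (rule smooth_on_linear[OF U lin f])
  have 1: "partial k (\<lambda>u. f u \<bullet> b) v = partial k f v \<bullet> b" if "v \<in> U" for k v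
    using partial_linear[OF lin smooth_on_differentiable[OF U f that]] .
  have 2: "partial l (partial k (\<lambda>u. f u \<bullet> b)) u = partial l (partial k f) u \<bullet> b" for k l
  proof -
    have "partial l (partial k (\<lambda>u. f u \<bullet> b)) u = partial l (\<lambda>v. partial k f v \<bullet> b) u"
      by (rule partial_cong_open[OF smooth_on_differentiable[OF U smooth_on_partial[OF s] u] U u 1])
    also have "\<dots> = partial l (partial k f) u \<bullet> b"
      by (rule partial_linear[OF lin smooth_on_differentiable[OF U smooth_on_partial[OF f] u]])
    finally show ?thesis .
  qed
  show "partial i (partial j f) u \<bullet> b = partial j (partial i f) u \<bullet> b"
    using mixed_partials_real[OF U s u] unfolding 2 .
qed


section \<open>Curvature from a moving frame\<close>

text \<open>
  An algebraic model of the Levi-Civita connection of an invariant metric: \<open>\<g>\<close> is the Lie algebra with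
  bracket \<open>br\<close>, \<open>pr\<close> is the projection to \<open>\<p>\<close> along the isotropy subalgebra, and \<open>A X\<close> is the connection form
  evaluated on \<open>X\<close>, acting on \<open>\<p>\<close>. The last assumption says that the curvature vanishes in isotropy
  directions; this is what the equivariance of the connection under the isotropy subalgebra amounts to.
\<close>

locale frame_connection =
  fixes \<g> \<p> :: "'v::euclidean_space set" and pr :: "'v \<Rightarrow> 'v"
    and br A :: "'v \<Rightarrow> 'v \<Rightarrow> 'v" and b :: "'v \<Rightarrow> 'v \<Rightarrow> real"
  assumes bil: "bilinear br" "bilinear A" "bilinear b" and lin_pr: "linear pr"
    and sub_g: "subspace \<g>" and sub_p: "subspace \<p>" and p_g: "\<p> \<subseteq> \<g>"
    and pr_p: "X \<in> \<g> \<Longrightarrow> pr X \<in> \<p>" and pr_id: "X \<in> \<p> \<Longrightarrow> pr X = X"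
    and br_anti: "br X Y = - br Y X"
    and A_p: "X \<in> \<g> \<Longrightarrow> Y \<in> \<p> \<Longrightarrow> A X Y \<in> \<p>"
    and b_sym: "b X Y = b Y X" and b_pos: "X \<in> \<p> \<Longrightarrow> X \<noteq> 0 \<Longrightarrow> b X X > 0"
    and torsion: "X \<in> \<g> \<Longrightarrow> Y \<in> \<g> \<Longrightarrow> A X (pr Y) - A Y (pr X) = pr (br X Y)"
    and metric: "X \<in> \<g> \<Longrightarrow> Y \<in> \<p> \<Longrightarrow> Z \<in> \<p> \<Longrightarrow> b (A X Y) Z + b Y (A X Z) = 0"
    and isotropy_flat: "X \<in> \<g> \<Longrightarrow> pr X = 0 \<Longrightarrow> Y \<in> \<g> \<Longrightarrow> Z \<in> \<p> \<Longrightarrow>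
      A X (A Y Z) - A Y (A X Z) - A (br X Y) Z = 0"
begin

definition curv :: "'v \<Rightarrow> 'v \<Rightarrow> 'v \<Rightarrow> 'v" where
  "curv X Y Z = A X (A Y Z) - A Y (A X Z) - A (br X Y) Z"

lemmas bl_simps =
  bilinear_ladd[OF bil(1)] bilinear_radd[OF bil(1)] bilinear_lsub[OF bil(1)] bilinear_rsub[OF bil(1)]
  bilinear_ladd[OF bil(2)] bilinear_radd[OF bil(2)] bilinear_lsub[OF bil(2)] bilinear_rsub[OF bil(2)]
  bilinear_ladd[OF bil(3)] bilinear_radd[OF bil(3)] bilinear_lsub[OF bil(3)] bilinear_rsub[OF bil(3)]
  bilinear_lmul[OF bil(1)] bilinear_rmul[OF bil(1)]
  bilinear_lmul[OF bil(2)] bilinear_rmul[OF bil(2)]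
  bilinear_lneg[OF bil(2)]

lemma linear_A: "linear (A X)" "linear (\<lambda>X. A X Y)" and linear_b: "linear (b X)" "linear (\<lambda>X. b X Y)"
  using bil(2,3) unfolding bilinear_def by auto

lemma linear_curv: "linear (\<lambda>X. curv X Y Z)"
  by (rule linearI) (simp_all add: curv_def bl_simps algebra_simps)

lemma curv_anti: "curv X Y Z = - curv Y X Z"
  using br_anti[of X Y] by (simp add: curv_def bl_simps algebra_simps)

lemma curv_in: "X \<in> \<p> \<Longrightarrow> Y \<in> \<p> \<Longrightarrow> Z \<in> \<p> \<Longrightarrow> br X Y \<in> \<g> \<Longrightarrow> curv X Y Z \<in> \<p>"
  unfolding curv_def using p_g A_p by (intro subspace_diff[OF sub_p]) blast+

text \<open>
  The algebraic curvature only sees the tangential parts, so it descends from the group to the quotient.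
\<close>

lemma curv_pr: "X \<in> \<g> \<Longrightarrow> Y \<in> \<g> \<Longrightarrow> Z \<in> \<p> \<Longrightarrow> curv X Y Z = curv (pr X) (pr Y) Z"
proof -
  have 1: "curv X Y Z = curv (pr X) Y Z" if "X \<in> \<g>" "Y \<in> \<g>" "Z \<in> \<p>" for X Y
  proof -
    have pg: "pr X \<in> \<g>" using that(1) pr_p p_g by blast
    have "pr (X - pr X) = 0"
      using pr_id[OF pr_p[OF that(1)]] by (simp add: linear_diff[OF lin_pr])
    then have "curv (X - pr X) Y Z = 0"
      unfolding curv_def using isotropy_flat subspace_diff[OF sub_g that(1) pg] that by blast
    then show ?thesis by (simp add: linear_diff[OF linear_curv])
  qed
  assume *: "X \<in> \<g>" "Y \<in> \<g>" "Z \<in> \<p>"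
  then have "pr X \<in> \<g>" using pr_p p_g by blast
  with * 1 show ?thesis by (metis curv_anti)
qed

end

text \<open>The trace of a linear map is the same for the coefficients of every basis.\<close>

lemma trace_change_of_basis:
  fixes \<theta> :: "'d::finite \<Rightarrow> 'v::real_vector" and e :: "'i \<Rightarrow> 'v" and \<epsilon> :: "'i \<Rightarrow> 'v \<Rightarrow> real" and L :: "'v \<Rightarrow> 'v"
  assumes I: "finite I" and p: "subspace \<p>" and L: "linear L" and e: "\<And>a. a \<in> I \<Longrightarrow> e a \<in> \<p>" and Lp: "\<And>X. X \<in> \<p> \<Longrightarrow> L X \<in> \<p>"
    and \<epsilon>: "\<And>a. a \<in> I \<Longrightarrow> linear (\<epsilon> a)" and ex: "\<And>X. X \<in> \<p> \<Longrightarrow> X = (\<Sum>a\<in>I. \<epsilon> a X *\<^sub>R e a)"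
    and \<theta>: "\<And>k. \<theta> k \<in> \<p>" and ind: "\<And>c :: real ^ 'd. (\<Sum>k\<in>UNIV. c $ k *\<^sub>R \<theta> k) = 0 \<Longrightarrow> c = 0"
    and spn: "\<And>X. X \<in> \<p> \<Longrightarrow> \<exists>c :: real ^ 'd. X = (\<Sum>k\<in>UNIV. c $ k *\<^sub>R \<theta> k)"
    and M: "\<And>k. L (\<theta> k) = (\<Sum>l\<in>UNIV. M k l *\<^sub>R \<theta> l)"
  shows "(\<Sum>k\<in>UNIV. M k k) = (\<Sum>a\<in>I. \<epsilon> a (L (e a)))"
proof -
  have uniq: "\<And>k. c k = c' k" if "(\<Sum>k\<in>UNIV. c k *\<^sub>R \<theta> k) = (\<Sum>k\<in>UNIV. c' k *\<^sub>R \<theta> k)" for c c' :: "'d \<Rightarrow> real"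
  proof -
    have "(\<Sum>k\<in>UNIV. (\<chi> k. c k - c' k) $ k *\<^sub>R \<theta> k) = 0"
      using that by (simp add: scaleR_diff_left sum_subtractf)
    from ind[OF this] show "c k = c' k" for k by (simp add: vec_eq_iff)
  qed
  have "\<forall>a\<in>I. \<exists>c :: real ^ 'd. L (e a) = (\<Sum>k\<in>UNIV. c $ k *\<^sub>R \<theta> k)"
    using spn Lp e by blast
  then obtain N :: "'i \<Rightarrow> real ^ 'd" where N: "\<And>a. a \<in> I \<Longrightarrow> L (e a) = (\<Sum>k\<in>UNIV. N a $ k *\<^sub>R \<theta> k)"
    using bchoice[of I "\<lambda>a c. L (e a) = (\<Sum>k\<in>UNIV. c $ k *\<^sub>R \<theta> k)"] by blast
  have "M k l = (\<Sum>a\<in>I. \<epsilon> a (\<theta> k) * N a $ l)" for k l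
  proof (rule uniq)
    have "(\<Sum>l\<in>UNIV. M k l *\<^sub>R \<theta> l) = L (\<Sum>a\<in>I. \<epsilon> a (\<theta> k) *\<^sub>R e a)"
      using M ex[OF \<theta>] by metis
    also have "\<dots> = (\<Sum>a\<in>I. \<epsilon> a (\<theta> k) *\<^sub>R (\<Sum>l\<in>UNIV. N a $ l *\<^sub>R \<theta> l))"
      by (simp add: linear_sum[OF L] linear_cmul[OF L] N)
    also have "\<dots> = (\<Sum>l\<in>UNIV. (\<Sum>a\<in>I. \<epsilon> a (\<theta> k) * N a $ l) *\<^sub>R \<theta> l)"
      unfolding scaleR_sum_left scaleR_sum_right by (subst sum.swap) simp
    finally show "(\<Sum>l\<in>UNIV. M k l *\<^sub>R \<theta> l) = (\<Sum>l\<in>UNIV. (\<Sum>a\<in>I. \<epsilon> a (\<theta> k) * N a $ l) *\<^sub>R \<theta> l)" .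
  qed
  then have "(\<Sum>k\<in>UNIV. M k k) = (\<Sum>a\<in>I. \<Sum>k\<in>UNIV. \<epsilon> a (\<theta> k) * N a $ k)"
    by (simp add: sum.swap[of _ UNIV])
  also have "\<dots> = (\<Sum>a\<in>I. \<epsilon> a (L (e a)))"
    by (intro sum.cong refl) (simp add: N linear_sum[OF \<epsilon>] linear_cmul[OF \<epsilon>] mult.commute)
  finally show ?thesis .
qed

text \<open>
  Cartan's structure equations. With \<open>\<theta>\<^sub>i = pr \<omega>\<^sub>i\<close> the covariant derivative is
  \<open>\<nabla>\<^sub>i\<theta>\<^sub>j = \<partial>\<^sub>i\<theta>\<^sub>j + A \<omega>\<^sub>i \<theta>\<^sub>j\<close>. It is symmetric in \<open>i, j\<close> by the Maurer-Cartan equation and compatible with \<open>G\<close>,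
  so Koszul's formula identifies it with \<open>\<Sigma>\<^sub>k \<Gamma>\<^sup>k\<^sub>i\<^sub>j \<theta>\<^sub>k\<close>. Differentiating this identity once more and
  antisymmetrizing expresses the coefficients of the Riemann tensor in the basis \<open>\<theta>\<close> by the algebraic
  curvature, and \<open>ricci\<close> is their trace.
\<close>

lemma (in frame_connection) ricci_of_frame:
  fixes U :: "(real ^ 'd::finite) set" and \<omega> :: "'d \<Rightarrow> real ^ 'd \<Rightarrow> 'v" and G :: "real ^ 'd \<Rightarrow> real ^ 'd ^ 'd"
  assumes U: "open U" and sm: "\<And>i. smooth_on U (\<omega> i)"
    and \<omega>: "\<And>i u. u \<in> U \<Longrightarrow> \<omega> i u \<in> \<g>" and d\<omega>: "\<And>i j u. u \<in> U \<Longrightarrow> partial i (\<omega> j) u \<in> \<g>"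
    and MC: "\<And>i j u. u \<in> U \<Longrightarrow> partial i (\<omega> j) u - partial j (\<omega> i) u = - br (\<omega> i u) (\<omega> j u)"
    and ind: "\<And>u c. u \<in> U \<Longrightarrow> (\<Sum>k\<in>UNIV. c $ k *\<^sub>R pr (\<omega> k u)) = 0 \<Longrightarrow> c = (0 :: real ^ 'd)"
    and spn: "\<And>u X. u \<in> U \<Longrightarrow> X \<in> \<p> \<Longrightarrow> \<exists>c :: real ^ 'd. X = (\<Sum>k\<in>UNIV. c $ k *\<^sub>R pr (\<omega> k u))"
    and G: "\<And>u i j. u \<in> U \<Longrightarrow> G u $ i $ j = b (pr (\<omega> i u)) (pr (\<omega> j u))"
    and u: "u \<in> U"
    and I: "finite I" and e: "\<And>a. a \<in> I \<Longrightarrow> e a \<in> \<p>" and \<epsilon>: "\<And>a. a \<in> I \<Longrightarrow> linear (\<epsilon> a)"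
    and ex: "\<And>X. X \<in> \<p> \<Longrightarrow> X = (\<Sum>a\<in>I. \<epsilon> a X *\<^sub>R e a)"
    and brg: "\<And>X Y. X \<in> \<g> \<Longrightarrow> Y \<in> \<g> \<Longrightarrow> br X Y \<in> \<g>"
  shows "ricci G i j u = (\<Sum>a\<in>I. \<epsilon> a (curv (e a) (pr (\<omega> j u)) (pr (\<omega> i u))))"
proof -
  define \<theta> where "\<theta> i = (\<lambda>u. pr (\<omega> i u))" for i
  have s\<theta>: "smooth_on U (\<theta> i)" for i unfolding \<theta>_def by (rule smooth_on_linear[OF U lin_pr sm])
  have \<theta>: "\<theta> i u \<in> \<p>" if "u \<in> U" for i u using \<omega>[OF that] pr_p by (simp add: \<theta>_def)
  have d\<theta>: "partial i (\<theta> j) u = pr (partial i (\<omega> j) u)" if "u \<in> U" for i j u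
    unfolding \<theta>_def by (rule partial_linear[OF lin_pr smooth_on_differentiable[OF U sm that]])
  have diff\<theta>: "\<theta> i differentiable at u" "\<omega> i differentiable at u" if "u \<in> U" for i u
    using smooth_on_differentiable[OF U s\<theta> that] smooth_on_differentiable[OF U sm that] .
  \<comment> \<open>\<open>T i j\<close> is the covariant derivative \<open>\<nabla>\<^sub>i\<theta>\<^sub>j\<close>.\<close>
  define T where "T i j u = partial i (\<theta> j) u + A (\<omega> i u) (\<theta> j u)" for i j u
  have T_p: "T i j u \<in> \<p>" if "u \<in> U" for i j u
    unfolding T_def d\<theta>[OF that] using that \<omega> d\<omega> \<theta> pr_p A_p by (intro subspace_add[OF sub_p]) auto
  have T_sym: "T i j u = T j i u" if "u \<in> U" for i j u
  proof -
    have "T i j u - T j i u = pr (partial i (\<omega> j) u - partial j (\<omega> i) u)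
        + (A (\<omega> i u) (pr (\<omega> j u)) - A (\<omega> j u) (pr (\<omega> i u)))"
      unfolding T_def d\<theta>[OF that] by (simp add: \<theta>_def linear_diff[OF lin_pr])
    also have "\<dots> = 0"
      using that \<omega> by (simp add: MC torsion linear_neg[OF lin_pr])
    finally show ?thesis by simp
  qed
  have G_eq: "G u $ i $ j = b (\<theta> i u) (\<theta> j u)" if "u \<in> U" for u i j
    using G[OF that] by (simp add: \<theta>_def)
  have sG: "smooth_on U (\<lambda>u. G u $ i $ j)" for i j
    by (rule smooth_on_cong[OF U smooth_on_bilinear[OF U bil(3) s\<theta> s\<theta>]]) (simp add: G_eq)
  have dG: "partial l (\<lambda>w. G w $ i $ j) u = b (T l i u) (\<theta> j u) + b (\<theta> i u) (T l j u)" if "u \<in> U" for i j l u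
  proof -
    have "partial l (\<lambda>w. G w $ i $ j) u = partial l (\<lambda>w. b (\<theta> i w) (\<theta> j w)) u"
      by (rule partial_cong_open[OF smooth_on_differentiable[OF U sG that] U that]) (simp add: G_eq)
    also have "\<dots> = b (\<theta> i u) (partial l (\<theta> j) u) + b (partial l (\<theta> i) u) (\<theta> j u)"
      by (rule partial_bilinear[OF bil(3) diff\<theta>(1)[OF that] diff\<theta>(1)[OF that]])
    also have "\<dots> = b (T l i u) (\<theta> j u) + b (\<theta> i u) (T l j u)"
      using metric[OF \<omega>[OF that] \<theta>[OF that] \<theta>[OF that], of l i j] by (simp add: T_def bl_simps)
    finally show ?thesis .
  qed
  have detG: "det (G u) \<noteq> 0" if "u \<in> U" for u
  proof
    assume "det (G u) = 0"
    then have "\<not> (\<exists>B. B ** G u = mat 1)"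
      using invertible_det_nz[of "G u"] invertible_left_inverse[of "G u"] by simp
    then obtain c where c: "c \<noteq> 0" "G u *v c = 0"
      unfolding matrix_left_invertible_ker by blast
    let ?v = "\<Sum>k\<in>UNIV. c $ k *\<^sub>R \<theta> k u"
    have "b (\<theta> i u) ?v = (G u *v c) $ i" for i
      by (simp add: linear_sum[OF linear_b(1)] linear_cmul[OF linear_b(1)] G_eq[OF that] matrix_vector_mult_def mult.commute)
    then have "b (\<theta> i u) ?v = 0" for i using c(2) by simp
    then have "b ?v ?v = 0"
      by (simp add: linear_sum[OF linear_b(2)] linear_cmul[OF linear_b(2)])
    moreover have "?v \<in> \<p>" using \<theta>[OF that] sub_p by (intro subspace_sum subspace_scale)
    ultimately have "?v = 0" using b_pos by force
    then show False using ind[OF that, of c] c(1) by (simp add: \<theta>_def)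
  qed
  have \<Gamma>: "(\<Sum>k\<in>UNIV. christoffel G k i j u *\<^sub>R \<theta> k u) = T j i u" if "u \<in> U" for i j u
  proof -
    have "\<exists>c :: real ^ 'd. T j i u = (\<Sum>k\<in>UNIV. c $ k *\<^sub>R \<theta> k u)"
      unfolding \<theta>_def by (rule spn[OF that T_p[OF that]])
    then obtain c :: "real ^ 'd" where c: "T j i u = (\<Sum>k\<in>UNIV. c $ k *\<^sub>R \<theta> k u)" by blast
    let ?K = "\<chi> l. (1/2) * (partial i (\<lambda>w. G w $ j $ l) u + partial j (\<lambda>w. G w $ i $ l) u - partial l (\<lambda>w. G w $ i $ j) u)"
    have "?K $ l = b (\<theta> l u) (T j i u)" for l
      using T_sym[OF that, of i j] T_sym[OF that, of l i] T_sym[OF that, of l j]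
      by (simp add: dG[OF that] b_sym)
    then have "?K = G u *v c"
      by (simp add: vec_eq_iff c linear_sum[OF linear_b(1)] linear_cmul[OF linear_b(1)] G_eq[OF that] matrix_vector_mult_def mult.commute)
    then have "matrix_inv (G u) *v ?K = c"
      by (simp add: matrix_vector_mul_assoc matrix_inv_det(2)[OF detG[OF that]])
    moreover have "(matrix_inv (G u) *v ?K) $ k = christoffel G k i j u" for k
      by (simp add: matrix_vector_mult_def christoffel_def sum_distrib_left mult.left_commute)
    ultimately show ?thesis unfolding c by (intro sum.cong) auto
  qed
  have sGm: "smooth_on U G" by (rule smooth_on_matrix[OF U sG])
  have s\<Gamma>: "smooth_on U (christoffel G k i j)" for k i j
  proof -
    have "christoffel G k i j = (\<lambda>u. \<Sum>l\<in>UNIV. (1/2) * (matrix_inv (G u) $ k $ l *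
       (partial i (\<lambda>w. G w $ j $ l) u + (partial j (\<lambda>w. G w $ i $ l) u + (- 1) * partial l (\<lambda>w. G w $ i $ j) u))))"
      by (rule ext) (simp add: christoffel_def sum_distrib_left add_diff_eq)
    moreover have "smooth_on U \<dots>"
      by (intro smooth_on_sum smooth_on_mult smooth_on_add smooth_on_const smooth_on_partial sG U
          smooth_on_entry[OF U smooth_on_matrix_inv[OF U sGm detG]])
    ultimately show ?thesis by simp
  qed
  have diff\<Gamma>: "christoffel G k i j differentiable at u" for k i j
    by (rule smooth_on_differentiable[OF U s\<Gamma> u])
  \<comment> \<open>Antisymmetrized in \<open>l\<close> and \<open>j\<close>, these are the components of the Riemann tensor.\<close>
  define R where "R l i j k = partial l (christoffel G k i j) u + (\<Sum>m\<in>UNIV. christoffel G k l m u * christoffel G m i j u)" for l i j k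
  have R: "(\<Sum>k\<in>UNIV. R l i j k *\<^sub>R \<theta> k u) = partial l (partial j (\<theta> i)) u
      + A (partial l (\<omega> j) u) (\<theta> i u) + A (\<omega> j u) (partial l (\<theta> i) u) + A (\<omega> l u) (T j i u)" for l i j
  proof -
    have bs: "bilinear (\<lambda>(c::real) (x::'v). c *\<^sub>R x)"
      by (auto simp: bilinear_def algebra_simps intro!: linearI)
    have sum_s: "smooth_on U (\<lambda>u. \<Sum>k\<in>UNIV. christoffel G k i j u *\<^sub>R \<theta> k u)"
      by (intro smooth_on_sum U smooth_on_bilinear[OF U bs s\<Gamma> s\<theta>])
    have "partial l (\<lambda>u. \<Sum>k\<in>UNIV. christoffel G k i j u *\<^sub>R \<theta> k u) u = partial l (\<lambda>u. partial j (\<theta> i) u + A (\<omega> j u) (\<theta> i u)) u"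
      by (rule partial_cong_open[OF smooth_on_differentiable[OF U sum_s u] U u]) (simp add: \<Gamma> T_def)
    also have "\<dots> = partial l (partial j (\<theta> i)) u + (A (\<omega> j u) (partial l (\<theta> i) u) + A (partial l (\<omega> j) u) (\<theta> i u))"
      using partial_bilinear[OF bil(2) diff\<theta>(2)[OF u] diff\<theta>(1)[OF u]]
      by (subst partial_add) (auto intro: smooth_on_differentiable[OF U _ u] smooth_on_partial s\<theta> smooth_on_bilinear[OF U bil(2) sm s\<theta>])
    finally have D1: "partial l (\<lambda>u. \<Sum>k\<in>UNIV. christoffel G k i j u *\<^sub>R \<theta> k u) u = \<dots>" .
    have "partial l (\<lambda>u. \<Sum>k\<in>UNIV. christoffel G k i j u *\<^sub>R \<theta> k u) u
        = (\<Sum>k\<in>UNIV. partial l (\<lambda>u. christoffel G k i j u *\<^sub>R \<theta> k u) u)"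
      by (rule partial_sum) (intro smooth_on_differentiable[OF U _ u] smooth_on_bilinear[OF U bs s\<Gamma> s\<theta>])
    also have "\<dots> = (\<Sum>k\<in>UNIV. christoffel G k i j u *\<^sub>R partial l (\<theta> k) u + partial l (christoffel G k i j) u *\<^sub>R \<theta> k u)"
      using partial_bilinear[OF bs diff\<Gamma> diff\<theta>(1)[OF u]] by simp
    finally have D2: "partial l (\<lambda>u. \<Sum>k\<in>UNIV. christoffel G k i j u *\<^sub>R \<theta> k u) u = \<dots>" .
    have d: "partial l (\<theta> m) u = (\<Sum>k\<in>UNIV. christoffel G k l m u *\<^sub>R \<theta> k u) - A (\<omega> l u) (\<theta> m u)" for m
      unfolding \<Gamma>[OF u] T_sym[OF u, of m l] by (simp add: T_def)
    have "(\<Sum>m\<in>UNIV. christoffel G m i j u *\<^sub>R partial l (\<theta> m) u)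
        = (\<Sum>m\<in>UNIV. \<Sum>k\<in>UNIV. (christoffel G k l m u * christoffel G m i j u) *\<^sub>R \<theta> k u)
          - A (\<omega> l u) (\<Sum>m\<in>UNIV. christoffel G m i j u *\<^sub>R \<theta> m u)"
      by (simp add: d scaleR_diff_right sum_subtractf scaleR_sum_right linear_sum[OF linear_A(1)] linear_cmul[OF linear_A(1)] mult.commute)
    also have "(\<Sum>m\<in>UNIV. \<Sum>k\<in>UNIV. (christoffel G k l m u * christoffel G m i j u) *\<^sub>R \<theta> k u)
        = (\<Sum>k\<in>UNIV. (\<Sum>m\<in>UNIV. christoffel G k l m u * christoffel G m i j u) *\<^sub>R \<theta> k u)"
      unfolding scaleR_sum_left by (rule sum.swap)
    finally have "(\<Sum>k\<in>UNIV. R l i j k *\<^sub>R \<theta> k u) = partial l (\<lambda>u. \<Sum>k\<in>UNIV. christoffel G k i j u *\<^sub>R \<theta> k u) u + A (\<omega> l u) (T j i u)"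
      unfolding D2 by (simp add: R_def scaleR_add_left sum.distrib \<Gamma>[OF u])
    then show ?thesis unfolding D1 by (simp add: add_ac)
  qed
  have curvR: "(\<Sum>m\<in>UNIV. (R k i j m - R j i k m) *\<^sub>R \<theta> m u) = curv (\<theta> k u) (\<theta> j u) (\<theta> i u)" for k i j
  proof -
    have "(\<Sum>m\<in>UNIV. (R k i j m - R j i k m) *\<^sub>R \<theta> m u)
        = A (partial k (\<omega> j) u - partial j (\<omega> k) u) (\<theta> i u) + A (\<omega> k u) (A (\<omega> j u) (\<theta> i u)) - A (\<omega> j u) (A (\<omega> k u) (\<theta> i u))"
      by (simp add: scaleR_diff_left sum_subtractf R mixed_partials[OF U s\<theta> u, of k j] T_def bl_simps)
    also have "\<dots> = curv (\<omega> k u) (\<omega> j u) (\<theta> i u)"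
      unfolding MC[OF u] by (simp add: curv_def bl_simps)
    also have "\<dots> = curv (\<theta> k u) (\<theta> j u) (\<theta> i u)"
      using curv_pr[OF \<omega>[OF u] \<omega>[OF u] \<theta>[OF u]] by (simp add: \<theta>_def)
    finally show ?thesis .
  qed
  have "ricci G i j u = (\<Sum>k\<in>UNIV. R k i j k - R j i k k)"
    unfolding ricci_def R_def by (simp add: sum.distrib sum_subtractf algebra_simps)
  also have "\<dots> = (\<Sum>a\<in>I. \<epsilon> a (curv (e a) (\<theta> j u) (\<theta> i u)))"
  proof (rule trace_change_of_basis[where M = "\<lambda>k l. R k i j l - R j i k l" and \<theta> = "\<lambda>k. \<theta> k u", OF I sub_p linear_curv e])
    show "curv X (\<theta> j u) (\<theta> i u) \<in> \<p>" if "X \<in> \<p>" for X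
      using that \<theta>[OF u] p_g by (intro curv_in brg) auto
    show "c = 0" if "(\<Sum>k\<in>UNIV. c $ k *\<^sub>R \<theta> k u) = 0" for c :: "real ^ 'd"
      using that unfolding \<theta>_def by (rule ind[OF u])
    show "\<exists>c :: real ^ 'd. X = (\<Sum>k\<in>UNIV. c $ k *\<^sub>R \<theta> k u)" if "X \<in> \<p>" for X
      using that unfolding \<theta>_def by (rule spn[OF u])
    show "curv (\<theta> k u) (\<theta> j u) (\<theta> i u) = (\<Sum>l\<in>UNIV. (R k i j l - R j i k l) *\<^sub>R \<theta> l u)" for k
      by (rule curvR[symmetric])
  qed (use \<epsilon> ex \<theta>[OF u] in auto)
  finally show ?thesis by (simp add: \<theta>_def)
qed

section \<open>Diagonal metrics on quotients of the rotation group\<close>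

definition hadamard :: "('i \<Rightarrow> 'i \<Rightarrow> real) \<Rightarrow> real ^ 'i ^ 'i \<Rightarrow> real ^ 'i ^ 'i" where
  "hadamard x X = (\<chi> a b. x a b * X $ a $ b)"

definition comm :: "real ^ 'i::finite ^ 'i \<Rightarrow> real ^ 'i ^ 'i \<Rightarrow> real ^ 'i ^ 'i" where
  "comm X Y = X ** Y - Y ** X"

definition skew :: "(real ^ 'i ^ 'i) set" where
  "skew = {X. transpose X = - X}"

text \<open>
  Koszul's formula for the metric \<open>\<langle>x \<cdot> X, Y\<rangle>\<close>, where \<open>\<langle> , \<rangle>\<close> is the Frobenius product and \<open>x \<cdot> X\<close> is entrywise
  multiplication: \<open>\<langle>x \<cdot> \<nabla>\<^sub>X Y, Z\<rangle>\<close> is half of \<open>\<langle>x \<cdot> [X, Y], Z\<rangle> + \<langle>[X, x \<cdot> Y], Z\<rangle> - \<langle>[x \<cdot> X, Y], Z\<rangle>\<close>. Since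
  \<open>inverse 0 = 0\<close>, dividing by the weights also projects away the entries of weight zero.
\<close>

definition conn :: "('i::finite \<Rightarrow> 'i \<Rightarrow> real) \<Rightarrow> real ^ 'i ^ 'i \<Rightarrow> real ^ 'i ^ 'i \<Rightarrow> real ^ 'i ^ 'i" where
  "conn x X Y = hadamard (\<lambda>a b. inverse (x a b))
     ((1 / 2) *\<^sub>R (hadamard x (comm X Y) + comm X (hadamard x Y) - comm (hadamard x X) Y))"

lemma hadamard_nth [simp]: "hadamard x X $ a $ b = x a b * X $ a $ b"
  by (simp add: hadamard_def)

lemma linear_hadamard: "linear (hadamard x :: real ^ 'i::finite ^ 'i \<Rightarrow> _)"
  by (rule linearI) (simp_all add: vec_eq_iff algebra_simps)

lemma bilinear_comm: "bilinear comm"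
proof -
  note m = bilinear_ladd[OF bilinear_matrix_mult] bilinear_radd[OF bilinear_matrix_mult]
    bilinear_lmul[OF bilinear_matrix_mult] bilinear_rmul[OF bilinear_matrix_mult]
  show ?thesis
    unfolding bilinear_def comm_def by (auto intro!: linearI simp: m algebra_simps)
qed

lemmas comm_simps =
  bilinear_ladd[OF bilinear_comm] bilinear_radd[OF bilinear_comm]
  bilinear_lsub[OF bilinear_comm] bilinear_rsub[OF bilinear_comm]
  bilinear_lmul[OF bilinear_comm] bilinear_rmul[OF bilinear_comm]
  bilinear_lneg[OF bilinear_comm] bilinear_rneg[OF bilinear_comm]
  bilinear_lzero[OF bilinear_comm] bilinear_rzero[OF bilinear_comm]

lemmas hadamard_simps =
  linear_add[OF linear_hadamard] linear_diff[OF linear_hadamard]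
  linear_cmul[OF linear_hadamard] linear_neg[OF linear_hadamard] linear_0[OF linear_hadamard]

lemma comm_anti: "comm X Y = - comm Y X"
  by (simp add: comm_def)

lemma jacobi: "comm X (comm Y Z) = comm (comm X Y) Z + comm Y (comm X Z)"
proof -
  note m = bilinear_lsub[OF bilinear_matrix_mult] bilinear_rsub[OF bilinear_matrix_mult]
  show ?thesis by (simp add: comm_def m matrix_mul_assoc)
qed

lemma skew_iff: "X \<in> skew \<longleftrightarrow> (\<forall>a b. X $ b $ a = - X $ a $ b)"
  unfolding skew_def mem_Collect_eq vec_eq_iff transpose_def vec_lambda_beta vector_uminus_component by blast

lemma skew_nth: "X \<in> skew \<Longrightarrow> X $ b $ a = - X $ a $ b"
  unfolding skew_iff by blast

lemma skewI: "(\<And>a b. X $ b $ a = - X $ a $ b) \<Longrightarrow> X \<in> skew"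
  unfolding skew_iff by blast

lemma skew_diag: "X \<in> skew \<Longrightarrow> X $ a $ a = (0 :: real)"
  using skew_nth[of X a a] by linarith

lemma subspace_skew: "subspace (skew :: (real ^ 'i::finite ^ 'i) set)"
proof -
  have lin: "linear (\<lambda>X :: real ^ 'i ^ 'i. transpose X + X)"
    by (rule linear_compose_add[OF linear_transpose linear_ident])
  have eq: "(skew :: (real ^ 'i ^ 'i) set) = {X. transpose X + X = 0}"
    by (simp add: skew_def eq_neg_iff_add_eq_0)
  show ?thesis unfolding eq by (rule linear_subspace_kernel[OF lin])
qed

lemma comm_skew:
  fixes X Y :: "real ^ 'i::finite ^ 'i"
  assumes "X \<in> skew" "Y \<in> skew"
  shows "comm X Y \<in> skew"
proof -
  have t: "transpose (A - B) = transpose A - transpose B" for A B :: "real ^ 'i ^ 'i"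
    by (simp add: vec_eq_iff transpose_def)
  have "(- X) ** (- Y) = X ** Y" "(- Y) ** (- X) = Y ** X"
    by (simp_all add: vec_eq_iff matrix_matrix_mult_def)
  then show ?thesis
    using assms by (simp add: skew_def comm_def t matrix_transpose_mul)
qed

lemma matrix_inner: "X \<bullet> Y = (\<Sum>a\<in>UNIV. \<Sum>b\<in>UNIV. X $ a $ b * Y $ a $ b)"
  for X Y :: "real ^ 'b::finite ^ 'a::finite"
  by (simp add: inner_vec_def)

lemma sum_swap3:
  "(\<Sum>a\<in>A. \<Sum>b\<in>B. \<Sum>c\<in>C. f a b c) = (\<Sum>c\<in>C. \<Sum>b\<in>B. \<Sum>a\<in>A. f a b c)"
proof -
  have "(\<Sum>a\<in>A. \<Sum>b\<in>B. \<Sum>c\<in>C. f a b c) = (\<Sum>b\<in>B. \<Sum>a\<in>A. \<Sum>c\<in>C. f a b c)"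
    by (rule sum.swap)
  also have "\<dots> = (\<Sum>b\<in>B. \<Sum>c\<in>C. \<Sum>a\<in>A. f a b c)"
    by (rule sum.cong[OF refl], rule sum.swap)
  also have "\<dots> = (\<Sum>c\<in>C. \<Sum>b\<in>B. \<Sum>a\<in>A. f a b c)"
    by (rule sum.swap)
  finally show ?thesis .
qed

lemma inner_matrix_mult:
  "(X ** Y) \<bullet> Z = Y \<bullet> (transpose X ** Z)" "(X ** Y) \<bullet> Z = X \<bullet> (Z ** transpose Y)"
  for X :: "real ^ 'b::finite ^ 'a::finite" and Y :: "real ^ 'c::finite ^ 'b"
proof -
  have *: "(X ** Y) \<bullet> Z = (\<Sum>a\<in>UNIV. \<Sum>b\<in>UNIV. \<Sum>c\<in>UNIV. X $ a $ c * Y $ c $ b * Z $ a $ b)"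
    by (simp add: matrix_inner matrix_matrix_mult_def sum_distrib_right)
  show "(X ** Y) \<bullet> Z = Y \<bullet> (transpose X ** Z)"
    unfolding *
    by (subst sum_swap3) (simp add: matrix_inner matrix_matrix_mult_def transpose_def sum_distrib_left mult_ac)
  have "(\<Sum>b\<in>UNIV. \<Sum>c\<in>UNIV. X $ a $ c * Y $ c $ b * Z $ a $ b)
      = (\<Sum>c\<in>UNIV. \<Sum>b\<in>UNIV. X $ a $ c * Y $ c $ b * Z $ a $ b)" for a
    by (rule sum.swap)
  then show "(X ** Y) \<bullet> Z = X \<bullet> (Z ** transpose Y)"
    unfolding * by (simp add: matrix_inner matrix_matrix_mult_def transpose_def sum_distrib_left mult_ac)
qed

text \<open>
  Invariance of the Frobenius product under the adjoint action.
\<close>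

lemma inner_comm:
  fixes X Y Z :: "real ^ 'i::finite ^ 'i"
  assumes "X \<in> skew"
  shows "comm X Y \<bullet> Z = - (Y \<bullet> comm X Z)"
proof -
  have X: "transpose X = - X" using assms by (simp add: skew_def)
  have "(- X) ** Z = - (X ** Z)" "Z ** (- X) = - (Z ** X)"
    using bilinear_lneg[OF bilinear_matrix_mult] bilinear_rneg[OF bilinear_matrix_mult] by blast+
  then show ?thesis
    unfolding comm_def inner_diff_left inner_diff_right
    using inner_matrix_mult(1)[of X Y Z] inner_matrix_mult(2)[of Y X Z] by (simp add: X)
qed

lemma inner_hadamard: "hadamard x X \<bullet> Y = X \<bullet> hadamard x Y"
  for X :: "real ^ 'i::finite ^ 'i"
  by (simp add: matrix_inner mult_ac)

text \<open>
  The weight of the pair \<open>{a, b}\<close> is the scale of the metric on the line spanned by the rotation generator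
  in the plane of \<open>a\<close> and \<open>b\<close>. Weight zero marks the pairs inside the isotropy subalgebra; invariance under
  the isotropy group says that such indices are interchangeable.
\<close>

locale weights =
  fixes x :: "'i::finite \<Rightarrow> 'i \<Rightarrow> real"
  assumes sym: "x a b = x b a" and nonneg: "x a b \<ge> 0"
    and isotropy: "x a b = 0 \<Longrightarrow> x a c = x b c"
begin

definition tangent :: "(real ^ 'i ^ 'i) set" where
  "tangent = {X \<in> skew. \<forall>a b. x a b = 0 \<longrightarrow> X $ a $ b = 0}"

definition proj :: "real ^ 'i ^ 'i \<Rightarrow> real ^ 'i ^ 'i" where
  "proj = hadamard (\<lambda>a b. if x a b = 0 then 0 else 1)"

definition form :: "real ^ 'i ^ 'i \<Rightarrow> real ^ 'i ^ 'i \<Rightarrow> real" where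
  "form X Y = hadamard x X \<bullet> Y"

abbreviation "inv_x \<equiv> \<lambda>a b. inverse (x a b)"

lemma hadamard_inverse: "hadamard inv_x (hadamard x X) = proj X" "hadamard x (hadamard inv_x X) = proj X"
  by (simp_all add: vec_eq_iff proj_def)

lemma hadamard_proj: "hadamard x (proj X) = hadamard x X" "hadamard inv_x (proj X) = hadamard inv_x X"
  "proj (hadamard x X) = hadamard x X" "proj (hadamard inv_x X) = hadamard inv_x X"
  by (simp_all add: vec_eq_iff proj_def)

lemma proj_tangent: "X \<in> tangent \<Longrightarrow> proj X = X"
  by (auto simp: vec_eq_iff proj_def tangent_def)

lemma inner_proj: "Z \<in> tangent \<Longrightarrow> proj X \<bullet> Z = X \<bullet> Z"
  unfolding proj_def inner_hadamard using proj_tangent by (simp add: proj_def)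

lemma hadamard_skew:
  assumes "X \<in> skew" "\<And>a b. y a b = y b a"
  shows "hadamard y X \<in> skew"
proof (rule skewI)
  fix a b show "hadamard y X $ b $ a = - hadamard y X $ a $ b"
    using skew_nth[OF assms(1), of b a] assms(2)[of a b] by simp
qed

lemma conn_skew:
  assumes "X \<in> skew" "Y \<in> skew"
  shows "conn x X Y \<in> skew"
  unfolding conn_def using assms sym
  by (intro hadamard_skew subspace_scale[OF subspace_skew] subspace_diff[OF subspace_skew]
      subspace_add[OF subspace_skew] comm_skew) (simp_all add: sym)

text \<open>
  An isotropy element only mixes indices with equal weights, so bracketing with it commutes with any entrywise
  multiplication by a function of the weights.
\<close>

lemma comm_isotropy:
  assumes X: "proj X = 0" and y: "\<And>a b c. x a b = 0 \<Longrightarrow> y a c = y b c" and ysym: "\<And>a b. y a b = y b a"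
  shows "hadamard y (comm X Y) = comm X (hadamard y Y)"
proof -
  have "proj X $ a $ b = 0" for a b using X by simp
  then have z: "X $ a $ b = 0 \<or> x a b = 0" for a b
    unfolding proj_def hadamard_nth zero_index mult_eq_0_iff by (metis zero_neq_one)
  have s1: "y a c * (X $ a $ b * Y $ b $ c) = X $ a $ b * (y b c * Y $ b $ c)" for a b c
    using z[of a b] y[of a b c] by auto
  have s2: "y a c * (Y $ a $ b * X $ b $ c) = y a b * Y $ a $ b * X $ b $ c" for a b c
    using z[of b c] y[of b c a] ysym[of a b] ysym[of a c] by auto
  show ?thesis
    by (simp only: vec_eq_iff comm_def vector_minus_component matrix_matrix_mult_def vec_lambda_beta
        hadamard_nth right_diff_distrib sum_distrib_left s1 s2) simp
qed

lemma linear_conn: "linear (conn x X)" "linear (\<lambda>X. conn x X Y)"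
  by (auto intro!: linearI simp: conn_def comm_simps hadamard_simps algebra_simps)

text \<open>
  In isotropy directions the weights cancel from the connection and the bracket remains.
\<close>

lemma conn_isotropy:
  assumes "proj X = 0" "Z \<in> tangent"
  shows "conn x X Z = comm X Z"
proof -
  have "hadamard x (comm X Z) = comm X (hadamard x Z)"
    using assms by (intro comm_isotropy isotropy sym)
  moreover have "hadamard x X = 0"
    using assms(1) hadamard_proj(1)[of X] by (simp add: hadamard_simps)
  ultimately have "conn x X Z = proj (comm X Z)"
    by (simp add: conn_def comm_simps hadamard_inverse[symmetric])
  also have "\<dots> = comm X (proj Z)"
    unfolding proj_def using assms isotropy sym by (intro comm_isotropy) (auto simp: proj_def[symmetric])
  finally show ?thesis by (simp add: proj_tangent[OF assms(2)])
qed

text \<open>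
  The connection is built from brackets and entrywise multiplications. An isotropy element acts as a derivation
  on the former by the Jacobi identity and commutes with the latter.
\<close>

lemma conn_equivariant:
  assumes X: "proj X = 0"
  shows "comm X (conn x Y Z) = conn x (comm X Y) Z + conn x Y (comm X Z)"
proof -
  have x: "comm X (hadamard x W) = hadamard x (comm X W)" for W
    by (rule comm_isotropy[OF X isotropy sym, symmetric])
  have ix: "comm X (hadamard inv_x W) = hadamard inv_x (comm X W)" for W
    using isotropy sym by (intro comm_isotropy[OF X, symmetric]) metis+
  show ?thesis
    unfolding conn_def ix
    by (simp add: jacobi[of X] x comm_simps hadamard_simps algebra_simps)
qed

lemma conn_torsion:
  assumes "X \<in> skew" "Y \<in> skew"
  shows "conn x X (proj Y) - conn x Y (proj X) = proj (comm X Y)"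
proof -
  define X' Y' where "X' = X - proj X" and "Y' = Y - proj Y"
  have lp: "linear proj" unfolding proj_def by (rule linear_hadamard)
  have pp: "proj (proj W) = proj W" for W by (simp add: proj_def vec_eq_iff)
  have 0: "proj X' = 0" "proj Y' = 0" by (simp_all add: X'_def Y'_def linear_diff[OF lp] pp)
  have "hadamard x (comm X' Y) = comm X' (hadamard x Y)"
    by (rule comm_isotropy[OF 0(1) isotropy sym])
  then have e1: "comm X (hadamard x Y) = hadamard x (comm X Y) - hadamard x (comm (proj X) Y) + comm (proj X) (hadamard x Y)"
    by (simp add: X'_def comm_simps hadamard_simps algebra_simps)
  have "hadamard x (comm Y' X) = comm Y' (hadamard x X)"
    by (rule comm_isotropy[OF 0(2) isotropy sym])
  then have e2: "comm Y (hadamard x X) = hadamard x (comm Y X) - hadamard x (comm (proj Y) X) + comm (proj Y) (hadamard x X)"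
    by (simp add: Y'_def comm_simps hadamard_simps algebra_simps)
  have "hadamard x (comm X (proj Y)) + comm X (hadamard x Y) - comm (hadamard x X) (proj Y)
      - (hadamard x (comm Y (proj X)) + comm Y (hadamard x X) - comm (hadamard x Y) (proj X)) = 2 *\<^sub>R hadamard x (comm X Y)"
    unfolding e1 e2 comm_anti[of Y X] comm_anti[of "proj Y" X] comm_anti[of "proj X" Y]
      comm_anti[of "hadamard x Y"] comm_anti[of "hadamard x X"]
    by (simp add: hadamard_simps scaleR_2)
  then have "conn x X (proj Y) - conn x Y (proj X) = hadamard inv_x ((1/2) *\<^sub>R (2 *\<^sub>R hadamard x (comm X Y)))"
    unfolding conn_def hadamard_proj by (simp only: flip: linear_diff[OF linear_hadamard] scaleR_diff_right)
  then show ?thesis by (simp add: hadamard_inverse)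
qed

lemma conn_metric:
  assumes X: "X \<in> skew" and Y: "Y \<in> tangent" and Z: "Z \<in> tangent"
  shows "form (conn x X Y) Z + form Y (conn x X Z) = 0"
proof -
  let ?D = "hadamard x"
  have D: "?D X \<in> skew" by (rule hadamard_skew[OF X sym])
  have f: "form (conn x X Y) Z = (1/2) * (comm X Y \<bullet> ?D Z + comm X (?D Y) \<bullet> Z - comm (?D X) Y \<bullet> Z)"
    if "Z \<in> tangent" for Y Z
    using that unfolding form_def conn_def hadamard_inverse
    by (simp add: inner_proj inner_diff_left inner_add_left inner_hadamard)
  have "form Y (conn x X Z) = form (conn x X Z) Y"
    unfolding form_def by (metis inner_hadamard inner_commute)
  moreover have "comm X Y \<bullet> ?D Z = - (comm X (?D Z) \<bullet> Y)" "comm X Z \<bullet> ?D Y = - (comm X (?D Y) \<bullet> Z)"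
    "comm (?D X) Y \<bullet> Z = - (comm (?D X) Z \<bullet> Y)"
    using inner_comm[OF X] inner_comm[OF D] by (metis inner_commute)+
  ultimately show ?thesis
    using f[OF Z, of Y] f[OF Y, of Z] by argo
qed

lemma subspace_tangent: "subspace tangent"
proof -
  have "tangent = skew \<inter> (\<Inter>(a, b)\<in>{(a, b). x a b = 0}. {X. X $ a $ b = 0})"
    by (auto simp: tangent_def)
  moreover have "subspace {X :: real ^ 'i ^ 'i. X $ a $ b = 0}" for a b
    by (rule linear_subspace_kernel[OF linear_entry])
  ultimately show ?thesis
    by (auto intro!: subspace_inter subspace_skew subspace_Inter)
qed

lemma proj_in_tangent: "X \<in> skew \<Longrightarrow> proj X \<in> tangent"
  using hadamard_skew[of X "\<lambda>a b. if x a b = 0 then 0 else 1"] sym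
  by (auto simp: tangent_def proj_def)

lemma form_pos:
  assumes "X \<in> tangent" "X \<noteq> 0"
  shows "form X X > 0"
proof -
  have nn: "x a b * X $ a $ b * X $ a $ b \<ge> 0" for a b
    using nonneg[of a b] by (simp add: mult.assoc)
  obtain a b where ab: "X $ a $ b \<noteq> 0" using assms(2) by (auto simp: vec_eq_iff)
  then have "x a b > 0" using assms(1) nonneg[of a b] by (auto simp: tangent_def less_le)
  then have "x a b * X $ a $ b * X $ a $ b > 0"
    using ab by (metis mult.assoc mult_pos_pos not_real_square_gt_zero)
  then have "0 < (\<Sum>b\<in>UNIV. x a b * X $ a $ b * X $ a $ b)"
    by (rule sum_pos2[OF finite UNIV_I]) (auto intro!: nn)
  then have "0 < (\<Sum>a\<in>UNIV. \<Sum>b\<in>UNIV. x a b * X $ a $ b * X $ a $ b)"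
    by (rule sum_pos2[OF finite UNIV_I]) (auto intro!: sum_nonneg nn)
  then show ?thesis by (simp add: form_def matrix_inner)
qed

sublocale frame_connection skew tangent proj comm "conn x" form
proof (rule frame_connection.intro)
  show "bilinear (comm :: real ^ 'i ^ 'i \<Rightarrow> _)" by (rule bilinear_comm)
  show "bilinear (conn x)" using linear_conn by (simp add: bilinear_def)
  show "bilinear form"
    by (auto simp: bilinear_def form_def hadamard_simps inner_add_left inner_add_right intro!: linearI)
  show "linear proj" unfolding proj_def by (rule linear_hadamard)
  fix X Y :: "real ^ 'i ^ 'i"
  show "form X Y = form Y X"
    unfolding form_def by (metis inner_hadamard inner_commute)
  show "conn x X Y \<in> tangent" if "X \<in> skew" "Y \<in> tangent" for X Y
  proof -
    have "conn x X Y \<in> skew" using that conn_skew by (simp add: tangent_def)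
    then show ?thesis by (simp add: tangent_def conn_def)
  qed
  show "conn x X (conn x Y Z) - conn x Y (conn x X Z) - conn x (comm X Y) Z = 0"
    if "X \<in> skew" "proj X = 0" "Y \<in> skew" "Z \<in> tangent" for X Y Z
  proof -
    have "conn x Y Z \<in> tangent"
      using conn_skew[OF that(3), of Z] that(4) by (auto simp: tangent_def conn_def)
    then show ?thesis
      using that by (simp add: conn_isotropy conn_equivariant)
  qed
qed (use subspace_skew subspace_tangent proj_in_tangent proj_tangent comm_anti form_pos conn_torsion conn_metric
    in \<open>auto simp: tangent_def\<close>)

text \<open>
  For distinct indices the covariant derivative of \<open>e\<^sub>c\<^sub>b\<close> along \<open>e\<^sub>a\<^sub>c\<close> is \<open>coef a c b\<close> times \<open>e\<^sub>a\<^sub>b\<close>. The default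
  \<open>z / 0 = 0\<close> makes it vanish when \<open>e\<^sub>a\<^sub>b\<close> lies in the isotropy subalgebra.
\<close>

definition coef :: "'i \<Rightarrow> 'i \<Rightarrow> 'i \<Rightarrow> real" where
  "coef a c b = (x a b + x c b - x a c) / (2 * x a b)"

lemma conn_nth:
  "conn x X Y $ a $ b = (\<Sum>c\<in>UNIV. coef a c b * X $ a $ c * Y $ c $ b - coef b c a * Y $ a $ c * X $ c $ b)"
proof -
  have "coef a c b * X $ a $ c * Y $ c $ b - coef b c a * Y $ a $ c * X $ c $ b =
      inverse (x a b) * (1 / 2) * (x a b * (X $ a $ c * Y $ c $ b - Y $ a $ c * X $ c $ b) +
        (X $ a $ c * (x c b * Y $ c $ b) - (x a c * Y $ a $ c) * X $ c $ b) -
        ((x a c * X $ a $ c) * Y $ c $ b - Y $ a $ c * (x c b * X $ c $ b)))" for c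
    unfolding coef_def sym[of b a] sym[of c a] sym[of b c]
    by (cases "x a b = 0") (simp_all add: field_simps)
  then show ?thesis
    by (simp add: conn_def comm_def matrix_matrix_mult_def sum_distrib_left sum.distrib sum_subtractf right_diff_distrib distrib_left)
qed

definition gen :: "'i \<Rightarrow> 'i \<Rightarrow> real ^ 'i ^ 'i" where
  "gen a b = (\<chi> c d. (if c = a \<and> d = b then 1 else 0) - (if c = b \<and> d = a then 1 else 0))"

lemma gen_nth: "gen a b $ c $ d = (if c = a \<and> d = b then 1 else 0) - (if c = b \<and> d = a then 1 else 0)"
  by (simp add: gen_def)

lemma gen_skew: "gen a b \<in> skew"
  by (rule skewI) (simp add: gen_nth conj_commute)

text \<open>
  The diagonal entries of the Ricci trace. Only products \<open>Y\<^sub>b\<^sub>c Z\<^sub>b\<^sub>c\<close> and \<open>Y\<^sub>a\<^sub>c Z\<^sub>a\<^sub>c\<close> survive, because two generators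
  bracket to a third one only if they share exactly one index; this is why the Ricci tensor is diagonal.
\<close>

lemma curv_gen:
  assumes ab: "a \<noteq> b" and Y: "Y \<in> skew" and Z: "Z \<in> skew"
  shows "curv (gen a b) Y Z $ a $ b =
    (\<Sum>c\<in>- {a, b}. (coef a c b - coef b c a * coef a b c) * (Y $ b $ c * Z $ b $ c)
                  + (coef b c a - coef a c b * coef b a c) * (Y $ a $ c * Z $ a $ c))"
proof -
  let ?e = "gen a b"
  note d0 = skew_diag
  have row: "?e $ a $ c = (if c = b then 1 else 0)" "?e $ c $ b = (if c = a then 1 else 0)" for c
    using ab by (auto simp: gen_nth)
  have col: "?e $ c $ d = (if d = b then (if c = a then 1 else 0) else 0)" if "c \<noteq> b" for c d
    using that by (auto simp: gen_nth)
  have row': "?e $ d $ c = (if d = b then - (if c = a then 1 else 0) else 0)" if "c \<noteq> b" for c d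
    using that by (auto simp: gen_nth)
  have col': "?e $ d $ c = (if d = a then (if c = b then 1 else 0) else 0)" if "c \<noteq> a" for c d
    using that by (auto simp: gen_nth)
  have W1: "conn x ?e Z $ c $ b = - coef b a c * Z $ c $ a" if "c \<noteq> b" for c
    unfolding conn_nth using that ab
    by (simp add: col[OF that] row(2) sum_subtractf sum_negf mult_delta_left mult_delta_right d0[OF Z] cong: if_cong)
  have W2: "conn x ?e Z $ a $ c = coef a b c * Z $ b $ c" if "c \<noteq> a" for c
    unfolding conn_nth using that ab
    by (simp add: col'[OF that] row(1) sum_subtractf sum_negf mult_delta_left mult_delta_right d0[OF Z] cong: if_cong)
  have V1: "comm ?e Y $ a $ c = Y $ b $ c" if "c \<noteq> a" for c
    using that ab
    by (simp add: comm_def matrix_matrix_mult_def col'[OF that] row(1) sum_subtractf sum_negf mult_delta_left mult_delta_right d0[OF Y] cong: if_cong)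
  have V2: "comm ?e Y $ c $ b = - Y $ c $ a" if "c \<noteq> b" for c
    using that ab
    by (simp add: comm_def matrix_matrix_mult_def col[OF that] row(2) sum_subtractf sum_negf mult_delta_left mult_delta_right d0[OF Y] cong: if_cong)
  have sk: "conn x ?e Z \<in> skew" "comm ?e Y \<in> skew" "conn x Y Z \<in> skew"
    using gen_skew Y Z by (auto intro: conn_skew comm_skew)
  have rest: "(\<Sum>c\<in>UNIV. f c) = (\<Sum>c\<in>- {a, b}. f c)" if "f a = 0" "f b = 0" for f :: "'i \<Rightarrow> real"
    using that by (intro sum.mono_neutral_right) auto
  have T1: "conn x ?e (conn x Y Z) $ a $ b = 0"
    unfolding conn_nth[of ?e] row
    by (simp add: sum_subtractf sum_negf mult_delta_left mult_delta_right d0[OF sk(3)] cong: if_cong)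
  have T2: "conn x Y (conn x ?e Z) $ a $ b = (\<Sum>c\<in>- {a, b}.
      coef b c a * coef a b c * (Y $ b $ c * Z $ b $ c) + coef a c b * coef b a c * (Y $ a $ c * Z $ a $ c))"
    unfolding conn_nth[of Y]
  proof (subst rest, goal_cases)
    case 3
    show ?case
    proof (intro sum.cong refl)
      fix c assume "c \<in> - {a, b}"
      then show "coef a c b * Y $ a $ c * conn x ?e Z $ c $ b - coef b c a * conn x ?e Z $ a $ c * Y $ c $ b =
          coef b c a * coef a b c * (Y $ b $ c * Z $ b $ c) + coef a c b * coef b a c * (Y $ a $ c * Z $ a $ c)"
        using skew_nth[OF Y, of c b] skew_nth[OF Z, of c a] by (simp add: W1 W2)
    qed
  qed (simp_all add: d0[OF sk(1)] d0[OF Y])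
  have T3: "conn x (comm ?e Y) Z $ a $ b = (\<Sum>c\<in>- {a, b}.
      - coef a c b * (Y $ b $ c * Z $ b $ c) - coef b c a * (Y $ a $ c * Z $ a $ c))"
    unfolding conn_nth[of "comm _ _"]
  proof (subst rest, goal_cases)
    case 3
    show ?case
    proof (intro sum.cong refl)
      fix c assume "c \<in> - {a, b}"
      then show "coef a c b * comm ?e Y $ a $ c * Z $ c $ b - coef b c a * Z $ a $ c * comm ?e Y $ c $ b =
          - coef a c b * (Y $ b $ c * Z $ b $ c) - coef b c a * (Y $ a $ c * Z $ a $ c)"
        using skew_nth[OF Y, of c a] skew_nth[OF Z, of c b] by (simp add: V1 V2)
    qed
  qed (simp_all add: d0[OF sk(2)] d0[OF Z])
  show ?thesis
    unfolding curv_def by (simp add: T1 T2 T3 sum_negf[symmetric] sum_subtractf[symmetric] algebra_simps flip: sum.distrib)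
qed

text \<open>
  The Ricci tensor on the generator \<open>e\<^sub>b\<^sub>c\<close>: every third index \<open>a\<close> contributes through the triple
  \<open>e\<^sub>a\<^sub>b, e\<^sub>b\<^sub>c, e\<^sub>a\<^sub>c\<close>. The two summands come from the two orders of the pair, since \<open>Y\<^sub>b\<^sub>c Z\<^sub>b\<^sub>c\<close> is symmetric in
  \<open>b\<close> and \<open>c\<close>.
\<close>

definition ricci_weight :: "'i \<Rightarrow> 'i \<Rightarrow> real" where
  "ricci_weight b c = (\<Sum>a\<in>- {b, c}.
     (coef a c b - coef b c a * coef a b c) + (coef a b c - coef c b a * coef a c b))"

text \<open>
  The trace runs over ordered pairs, so every generator is counted twice; hence the factor \<open>1 / 2\<close>.
\<close>

lemma ricci_trace:
  assumes Y: "Y \<in> tangent" and Z: "Z \<in> tangent"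
  shows "(\<Sum>(a, b) | x a b \<noteq> 0. (1 / 2) * curv (gen a b) Y Z $ a $ b)
    = (1 / 2) * (\<Sum>b\<in>UNIV. \<Sum>c\<in>UNIV. ricci_weight b c * (Y $ b $ c * Z $ b $ c))"
proof -
  have Ys: "Y \<in> skew" and Zs: "Z \<in> skew" using Y Z by (auto simp: tangent_def)
  define s where "s a b c = coef a c b - coef b c a * coef a b c" for a b c
  define t where "t a b c = (if a \<noteq> b \<and> a \<noteq> c \<and> b \<noteq> c then s a b c * (Y $ b $ c * Z $ b $ c) else 0)" for a b c
  have s0: "s a b c = 0" if "x a b = 0" for a b c
    using that by (simp add: s_def coef_def sym[of b a])
  have t0: "t a b c = 0" "t b a c = 0" if "x a b = 0" for a b c
    using s0[OF that] s0[of b a] that sym[of b a] by (simp_all add: t_def)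
  have g0: "gen a a = 0" for a by (simp add: vec_eq_iff gen_nth)
  have cg: "curv (gen a b) Y Z $ a $ b = (\<Sum>c\<in>UNIV. t a b c + t b a c)" if "x a b \<noteq> 0" for a b
  proof (cases "a = b")
    case True
    then show ?thesis using linear_0[OF linear_curv] by (simp add: g0 t_def)
  next
    case False
    have "curv (gen a b) Y Z $ a $ b = (\<Sum>c\<in>- {a, b}. t a b c + t b a c)"
      unfolding curv_gen[OF False Ys Zs] using False by (intro sum.cong) (auto simp: t_def s_def)
    also have "\<dots> = (\<Sum>c\<in>UNIV. t a b c + t b a c)"
      by (intro sum.mono_neutral_left) (auto simp: t_def)
    finally show ?thesis .
  qed
  have "(\<Sum>(a, b) | x a b \<noteq> 0. (1 / 2) * curv (gen a b) Y Z $ a $ b)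
      = (\<Sum>(a, b) | x a b \<noteq> 0. (1 / 2) * (\<Sum>c\<in>UNIV. t a b c + t b a c))"
    by (intro sum.cong) (auto simp: cg)
  also have "\<dots> = (\<Sum>(a, b)\<in>UNIV. (1 / 2) * (\<Sum>c\<in>UNIV. t a b c + t b a c))"
    by (intro sum.mono_neutral_left) (auto simp: t0)
  also have "\<dots> = (1 / 2) * ((\<Sum>a\<in>UNIV. \<Sum>b\<in>UNIV. \<Sum>c\<in>UNIV. t a b c) + (\<Sum>a\<in>UNIV. \<Sum>b\<in>UNIV. \<Sum>c\<in>UNIV. t b a c))"
    unfolding UNIV_Times_UNIV[symmetric] sum.cartesian_product[symmetric]
    by (simp only: sum_distrib_left[symmetric] sum.distrib)
  also have "(\<Sum>a\<in>UNIV. \<Sum>b\<in>UNIV. \<Sum>c\<in>UNIV. t b a c) = (\<Sum>a\<in>UNIV. \<Sum>b\<in>UNIV. \<Sum>c\<in>UNIV. t a b c)"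
    by (rule sum.swap)
  also have "(1 / 2) * (\<dots> + \<dots>) = (\<Sum>b\<in>UNIV. \<Sum>c\<in>UNIV. \<Sum>a\<in>UNIV. t a b c)"
    using sum.swap[of "\<lambda>a b. \<Sum>c\<in>UNIV. t a b c" UNIV UNIV] sum.swap[of "\<lambda>a c. t a _ c" UNIV UNIV] by simp
  also have "\<dots> = (1 / 2) * ((\<Sum>b\<in>UNIV. \<Sum>c\<in>UNIV. \<Sum>a\<in>UNIV. t a b c) + (\<Sum>b\<in>UNIV. \<Sum>c\<in>UNIV. \<Sum>a\<in>UNIV. t a c b))"
    using sum.swap[of "\<lambda>b c. \<Sum>a\<in>UNIV. t a b c" UNIV UNIV] by simp
  also have "\<dots> = (1 / 2) * (\<Sum>b\<in>UNIV. \<Sum>c\<in>UNIV. \<Sum>a\<in>UNIV. t a b c + t a c b)"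
    by (simp add: sum.distrib)
  finally have *: "(\<Sum>(a, b) | x a b \<noteq> 0. (1 / 2) * curv (gen a b) Y Z $ a $ b) = \<dots>" .
  have "(\<Sum>a\<in>UNIV. t a b c + t a c b) = ricci_weight b c * (Y $ b $ c * Z $ b $ c)" for b c
  proof (cases "b = c")
    case True
    then show ?thesis by (simp add: t_def skew_diag[OF Ys])
  next
    case False
    have "(\<Sum>a\<in>UNIV. t a b c + t a c b) = (\<Sum>a\<in>- {b, c}. t a b c + t a c b)"
      by (intro sum.mono_neutral_right) (auto simp: t_def)
    also have "\<dots> = (\<Sum>a\<in>- {b, c}. (s a b c + s a c b) * (Y $ b $ c * Z $ b $ c))"
      using skew_nth[OF Ys, of c b] skew_nth[OF Zs, of c b] False
      by (intro sum.cong) (auto simp: t_def algebra_simps)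
    finally show ?thesis by (simp add: ricci_weight_def s_def sum_distrib_right)
  qed
  then show ?thesis unfolding * by simp
qed

lemma expand_in_generators:
  assumes "X \<in> tangent"
  shows "X = (\<Sum>(a, b) | x a b \<noteq> 0. ((1 / 2) * X $ a $ b) *\<^sub>R gen a b)"
proof -
  have "(\<Sum>(a, b) | x a b \<noteq> 0. ((1 / 2) * X $ a $ b) *\<^sub>R gen a b) = (\<Sum>(a, b)\<in>UNIV. ((1 / 2) * X $ a $ b) *\<^sub>R gen a b)"
    using assms by (intro sum.mono_neutral_left) (auto simp: tangent_def)
  also have "\<dots> = (\<Sum>a\<in>UNIV. \<Sum>b\<in>UNIV. ((1 / 2) * X $ a $ b) *\<^sub>R gen a b)"
    unfolding UNIV_Times_UNIV[symmetric] sum.cartesian_product[symmetric] ..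
  also have "\<dots> = X"
  proof -
    have "(\<Sum>a\<in>UNIV. \<Sum>b\<in>UNIV. ((1 / 2) * X $ a $ b) * gen a b $ c $ d) = X $ c $ d" for c d
    proof -
      have e: "((1 / 2) * X $ a $ b) * gen a b $ c $ d =
          (if a = c then if b = d then (1 / 2) * X $ a $ b else 0 else 0) -
          (if a = d then if b = c then (1 / 2) * X $ a $ b else 0 else 0)" for a b
        unfolding gen_nth by simp
      have p: "(\<Sum>b\<in>UNIV. if P then f b else 0) = (if P then \<Sum>b\<in>UNIV. f b else 0)" for P and f :: "'i \<Rightarrow> real"
        by simp
      have "(\<Sum>a\<in>UNIV. \<Sum>b\<in>UNIV. ((1 / 2) * X $ a $ b) * gen a b $ c $ d) = (1 / 2) * X $ c $ d - (1 / 2) * X $ d $ c"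
        by (simp only: e p sum_subtractf) simp
      then show ?thesis using skew_nth[of X d c] assms by (simp add: tangent_def)
    qed
    then show ?thesis by (simp add: vec_eq_iff)
  qed
  finally show ?thesis by simp
qed

lemma einstein_trace:
  assumes "\<And>b c. b \<noteq> c \<Longrightarrow> x b c \<noteq> 0 \<Longrightarrow> ricci_weight b c = 2 * k * x b c"
    and Y: "Y \<in> tangent" and Z: "Z \<in> tangent"
  shows "(\<Sum>(a, b) | x a b \<noteq> 0. (1 / 2) * curv (gen a b) Y Z $ a $ b) = k * form Y Z"
proof -
  have eq: "ricci_weight b c * (Y $ b $ c * Z $ b $ c) = 2 * k * (x b c * Y $ b $ c * Z $ b $ c)" for b c
    using assms(1)[of b c] Y skew_diag[of Y b] by (cases "b = c"; cases "x b c = 0") (auto simp: tangent_def)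
  then show ?thesis
    unfolding ricci_trace[OF Y Z] eq by (simp add: form_def matrix_inner sum_distrib_left mult_ac)
qed

end

section \<open>The Cayley chart and moving frames of the Stiefel manifold\<close>

lemmas mat_simps =
  bilinear_ladd[OF bilinear_matrix_mult] bilinear_radd[OF bilinear_matrix_mult]
  bilinear_lsub[OF bilinear_matrix_mult] bilinear_rsub[OF bilinear_matrix_mult]
  bilinear_lmul[OF bilinear_matrix_mult] bilinear_rmul[OF bilinear_matrix_mult]
  bilinear_lneg[OF bilinear_matrix_mult] bilinear_rneg[OF bilinear_matrix_mult]
  bilinear_lzero[OF bilinear_matrix_mult] bilinear_rzero[OF bilinear_matrix_mult]

lemmas transpose_simps =
  linear_add[OF linear_transpose] linear_diff[OF linear_transpose] linear_neg[OF linear_transpose]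
  linear_cmul[OF linear_transpose] linear_0[OF linear_transpose] matrix_transpose_mul transpose_transpose transpose_mat

lemma matrix_inv_unique:
  fixes A :: "real ^ 'n::finite ^ 'n"
  assumes "B ** A = mat 1"
  shows "det A \<noteq> 0" "matrix_inv A = B"
proof -
  show d: "det A \<noteq> 0" using assms invertible_det_nz invertible_left_inverse by blast
  have "B ** (A ** matrix_inv A) = matrix_inv A" by (simp add: matrix_mul_assoc assms)
  then show "matrix_inv A = B" by (simp add: matrix_inv_det(1)[OF d])
qed

lemma orthogonal_both:
  fixes Q :: "real ^ 'n::finite ^ 'n"
  assumes "transpose Q ** Q = mat 1"
  shows "Q ** transpose Q = mat 1"
  using assms matrix_left_right_inverse by blast

text \<open>
  Continuity of the inverse chart is needed on sets of frames, where the coordinate calculus does not apply.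
\<close>

lemma continuous_on_matrix_entries:
  fixes M :: "'a::topological_space \<Rightarrow> real ^ 'b::finite ^ 'c::finite"
  assumes "\<And>i j. continuous_on S (\<lambda>u. M u $ i $ j)"
  shows "continuous_on S M"
proof -
  have "continuous_on S (\<lambda>u. \<chi> i j. M u $ i $ j)"
    by (intro continuous_on_vec_lambda assms)
  then show ?thesis by simp
qed

lemma inner_matrix_vector:
  fixes A :: "real ^ 'b::finite ^ 'a::finite"
  shows "(A *v y) \<bullet> z = y \<bullet> (transpose A *v z)"
  by (metis dot_lmul_matrix inner_commute transpose_matrix_vector)

lemma continuous_on_matrix_inv:
  fixes M :: "'a::topological_space \<Rightarrow> real ^ 'n::finite ^ 'n"
  assumes c: "continuous_on S M" and d: "\<And>u. u \<in> S \<Longrightarrow> det (M u) \<noteq> 0"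
  shows "continuous_on S (\<lambda>u. matrix_inv (M u))"
proof (rule continuous_on_matrix_entries)
  fix k l
  have e: "continuous_on S (\<lambda>u. M u $ i $ j)" for i j
    using c by (intro continuous_intros)
  have d': "continuous_on S (\<lambda>u. det (N u))" if "\<And>i j. continuous_on S (\<lambda>u. N u $ i $ j)"
    for N :: "'a \<Rightarrow> real ^ 'n ^ 'n"
    unfolding det_def by (intro continuous_intros that)
  have "continuous_on S (\<lambda>u. (\<chi> i j. if j = k then (if i = l then 1 else 0) else M u $ i $ j) $ i $ j)" for i j
    using e by (cases "j = k"; cases "i = l") simp_all
  then have "continuous_on S (\<lambda>u. det (\<chi> i j. if j = k then (if i = l then 1 else 0) else M u $ i $ j) * inverse (det (M u)))"
    using d by (intro continuous_on_mult continuous_on_inverse d' e) auto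
  then show "continuous_on S (\<lambda>u. matrix_inv (M u) $ k $ l)"
    by (simp add: matrix_inv_entry[OF d] cong: continuous_on_cong_simp)
qed

lemma linear_matrix_mult: "linear (\<lambda>X :: real ^ 'c::finite ^ 'b::finite. (M :: real ^ 'b ^ 'a::finite) ** X)"
  and linear_matrix_mult_right: "linear (\<lambda>M :: real ^ 'b ^ 'a::finite. M ** (X :: real ^ 'c ^ 'b))"
  using bilinear_matrix_mult unfolding bilinear_def by auto

subsection \<open>Coordinates of the tangent space at the base point\<close>

lemma base_frame_orthonormal: "transpose base_frame ** (base_frame :: 'm::finite frame) = mat 1"
  unfolding vec_eq_iff matrix_mul_base_frame by (simp add: base_frame_def transpose_def mat_def)

lemma transpose_base_frame_mult: "(transpose base_frame ** (V :: real ^ 'k::finite ^ (4 + 'm::finite))) $ i $ j = V $ Inl i $ j"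
  by (simp add: matrix_matrix_mult_def base_frame_def transpose_def mult_delta_left)

definition pairs :: "(4 \<times> 4) set" where
  "pairs = {(1, 2), (1, 3), (1, 4), (2, 3), (2, 4), (3, 4)}"

text \<open>
  Any numbering of the six entries above the diagonal serves as coordinates on skew \<open>4 \<times> 4\<close> matrices.
\<close>

definition pair_index :: "4 \<times> 4 \<Rightarrow> 6" where
  "pair_index = (SOME f. bij_betw f pairs UNIV)"

lemma bij_pair_index: "bij_betw pair_index pairs UNIV"
proof -
  have "card pairs = CARD(6)" "finite pairs" by (simp_all add: pairs_def)
  then have "\<exists>f :: 4 \<times> 4 \<Rightarrow> 6. bij_betw f pairs UNIV" by (intro finite_same_card_bij) simp_all
  then show ?thesis unfolding pair_index_def by (rule someI_ex)
qed

lemma pairs_total: "i = j \<or> (i, j) \<in> pairs \<or> (j, i) \<in> pairs"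
proof -
  have "\<forall>i j :: 4. i = j \<or> (i, j) \<in> pairs \<or> (j, i) \<in> pairs"
    unfolding forall_4 by (simp add: pairs_def)
  then show ?thesis by blast
qed

lemma pairs_asym: "(i, j) \<in> pairs \<Longrightarrow> (j, i) \<notin> pairs" and pairs_irrefl: "(i, i) \<notin> pairs"
proof -
  have *: "\<forall>i j :: 4. (i, j) \<in> pairs \<longrightarrow> (j, i) \<notin> pairs"
    unfolding forall_4 by (simp add: pairs_def)
  then show "(i, j) \<in> pairs \<Longrightarrow> (j, i) \<notin> pairs" "(i, i) \<notin> pairs" by blast+
qed

definition to_tangent :: "real ^ (6 + 4 \<times> 'm::finite) \<Rightarrow> 'm frame" where
  "to_tangent u = (\<chi> a j. case a of
      Inl i \<Rightarrow> (if (i, j) \<in> pairs then u $ Inl (pair_index (i, j)) else 0)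
             - (if (j, i) \<in> pairs then u $ Inl (pair_index (j, i)) else 0)
    | Inr r \<Rightarrow> u $ Inr (j, r))"

definition of_tangent :: "'m::finite frame \<Rightarrow> real ^ (6 + 4 \<times> 'm)" where
  "of_tangent V = (\<chi> k. case k of
      Inl s \<Rightarrow> (let (i, j) = inv_into pairs pair_index s in V $ Inl i $ j)
    | Inr (j, r) \<Rightarrow> V $ Inr r $ j)"

definition base_tangent :: "'m::finite frame set" where
  "base_tangent = {V. transpose base_frame ** V \<in> skew}"

lemma linear_to_tangent: "linear to_tangent"
  by (rule linearI) (auto simp: to_tangent_def vec_eq_iff algebra_simps split: sum.split)

lemma linear_of_tangent: "linear of_tangent"
  by (rule linearI) (auto simp: of_tangent_def vec_eq_iff algebra_simps Let_def split: sum.split prod.split)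

lemma to_tangent_in: "to_tangent u \<in> base_tangent"
  unfolding base_tangent_def mem_Collect_eq
  by (rule skewI) (simp add: transpose_base_frame_mult to_tangent_def)

lemma of_to_tangent: "of_tangent (to_tangent u) = u"
proof -
  have "of_tangent (to_tangent u) $ k = u $ k" for k
  proof (cases k)
    case (Inl s)
    define p where "p = inv_into pairs pair_index s"
    have p: "p \<in> pairs" "pair_index p = s"
      using bij_pair_index unfolding p_def bij_betw_def by (metis UNIV_I inv_into_into, metis UNIV_I f_inv_into_f)
    then show ?thesis using Inl pairs_asym[of "fst p" "snd p"]
      by (cases p) (simp add: of_tangent_def to_tangent_def p_def[symmetric])
  next
    case (Inr q)
    then show ?thesis by (cases q) (simp add: of_tangent_def to_tangent_def)
  qed
  then show ?thesis by (simp add: vec_eq_iff)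
qed

lemma to_of_tangent:
  assumes "V \<in> base_tangent"
  shows "to_tangent (of_tangent V) = V"
proof -
  have sk: "V $ Inl j $ i = - V $ Inl i $ j" for i j
    using assms skew_nth[of "transpose base_frame ** V" j i]
    by (simp add: base_tangent_def transpose_base_frame_mult)
  have p: "inv_into pairs pair_index (pair_index q) = q" if "q \<in> pairs" for q
    using bij_pair_index that by (simp add: bij_betw_def)
  have "to_tangent (of_tangent V) $ a $ j = V $ a $ j" for a j
  proof (cases a)
    case (Inl i)
    consider "i = j" | "(i, j) \<in> pairs" | "(j, i) \<in> pairs" using pairs_total by blast
    then show ?thesis
    proof cases
      case 1 then show ?thesis using sk[of i i] Inl by (simp add: to_tangent_def pairs_irrefl)
    next
      case 2 then show ?thesis using Inl pairs_asym[OF 2] by (simp add: to_tangent_def of_tangent_def p)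
    next
      case 3 then show ?thesis using Inl pairs_asym[OF 3] sk[of i j] by (simp add: to_tangent_def of_tangent_def p)
    qed
  qed (simp add: to_tangent_def of_tangent_def)
  then show ?thesis by (simp add: vec_eq_iff)
qed

subsection \<open>The Cayley chart\<close>

text \<open>
  The Cayley transform \<open>(1 - X)\<^sup>-\<^sup>1 (1 + X)\<close> maps skew matrices to rotations. For \<open>X \<in> \<p>\<close> with
  \<open>X base_frame = V\<close> its first four columns depend only on the skew block \<open>S\<close> and the lower block \<open>B\<close> of \<open>V\<close>.
  They are \<open>2 C T\<^sup>-\<^sup>1 - base_frame\<close>, where \<open>C\<close> has the blocks \<open>1\<close> and \<open>B\<close>, and \<open>T = C\<^sup>T C - S\<close>, so only a
  \<open>4 \<times> 4\<close> matrix has to be inverted. The map is a chart defined on the whole tangent space.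
\<close>

definition cay_C :: "'m::finite frame \<Rightarrow> 'm frame" where
  "cay_C V = base_frame + V - base_frame ** (transpose base_frame ** V)"

definition cay_T :: "'m::finite frame \<Rightarrow> real ^ 4 ^ 4" where
  "cay_T V = transpose (cay_C V) ** cay_C V - transpose base_frame ** V"

definition cayley :: "'m::finite frame \<Rightarrow> 'm frame" where
  "cayley V = 2 *\<^sub>R (cay_C V ** matrix_inv (cay_T V)) - base_frame"

definition cayley_inv :: "'m::finite frame \<Rightarrow> 'm frame" where
  "cayley_inv A = (let N = matrix_inv (mat 1 + transpose base_frame ** A); C = (A + base_frame) ** N
     in C - base_frame + base_frame ** (transpose C ** C - 2 *\<^sub>R N))"

lemma base_cay_C: "transpose base_frame ** cay_C V = mat 1"
  by (simp add: cay_C_def mat_simps matrix_mul_assoc base_frame_orthonormal)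

text \<open>
  If \<open>T y = 0\<close> then \<open>0 = y \<bullet> T y = |C y|\<^sup>2\<close>, since \<open>S\<close> is skew; the upper block of \<open>C\<close> being \<open>1\<close>, \<open>y\<close> vanishes.
\<close>

lemma det_cay_T:
  assumes "V \<in> base_tangent"
  shows "det (cay_T V) \<noteq> 0"
proof
  assume "det (cay_T V) = 0"
  then have "\<not> (\<exists>B. B ** cay_T V = mat 1)"
    using invertible_det_nz[of "cay_T V"] invertible_left_inverse[of "cay_T V"] by simp
  then obtain y where y: "y \<noteq> 0" "cay_T V *v y = 0"
    unfolding matrix_left_invertible_ker by blast
  let ?S = "transpose base_frame ** V"
  have S: "transpose ?S = - ?S" using assms by (simp add: base_tangent_def skew_def)
  have "(- ?S) *v y = - (?S *v y)"
    by (simp add: vec_eq_iff matrix_vector_mult_def sum_negf)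
  then have "(?S *v y) \<bullet> y = 0"
    using inner_matrix_vector[of ?S y y] S by (simp add: inner_commute)
  moreover have "(transpose (cay_C V) ** cay_C V) *v y = ?S *v y"
    using y(2) by (simp add: cay_T_def matrix_vector_mult_diff_rdistrib)
  moreover have "((transpose (cay_C V) ** cay_C V) *v y) \<bullet> y = (cay_C V *v y) \<bullet> (cay_C V *v y)"
    by (simp add: matrix_vector_mul_assoc[symmetric] inner_matrix_vector[of "cay_C V" y] inner_commute)
  ultimately have "cay_C V *v y = 0" by simp
  then have "transpose base_frame *v (cay_C V *v y) = 0" by simp
  then have "y = 0" by (simp add: matrix_vector_mul_assoc base_cay_C)
  then show False using y(1) by simp
qed

lemma base_cay_inverse: "transpose base_frame ** (cay_C V ** N) = N"
  by (simp add: matrix_mul_assoc base_cay_C)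

lemma cayley_base: "transpose base_frame ** cayley V = 2 *\<^sub>R matrix_inv (cay_T V) - mat 1"
  by (simp add: cayley_def mat_simps base_cay_inverse base_frame_orthonormal)

text \<open>
  This rests on \<open>T + T\<^sup>T = 2 C\<^sup>T C\<close>, which turns \<open>4 T\<^sup>-\<^sup>T C\<^sup>T C T\<^sup>-\<^sup>1\<close> into \<open>2 T\<^sup>-\<^sup>1 + 2 T\<^sup>-\<^sup>T\<close>.
\<close>

lemma cayley_stiefel:
  assumes V: "V \<in> base_tangent"
  shows "cayley V \<in> stiefel"
proof -
  define C T N where "C = cay_C V" and "T = cay_T V" and "N = matrix_inv T"
  note TN = matrix_inv_det[OF det_cay_T[OF V], folded T_def, folded N_def]
  let ?S = "transpose base_frame ** V"
  have S: "transpose ?S = - ?S" using V by (simp add: base_tangent_def skew_def)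
  have NT: "transpose N ** transpose T = mat 1"
    using arg_cong[OF TN(1), of transpose] by (simp add: matrix_transpose_mul transpose_mat)
  have bC: "transpose base_frame ** C = mat 1"
    unfolding C_def by (rule base_cay_C)
  have Cb: "transpose C ** base_frame = mat 1"
    using arg_cong[OF bC, of transpose] by (simp add: matrix_transpose_mul transpose_mat)
  have "T + transpose T = 2 *\<^sub>R (transpose C ** C)"
    unfolding T_def cay_T_def C_def by (simp add: transpose_simps(1-6) S[unfolded matrix_transpose_mul transpose_transpose] scaleR_2)
  then have CC: "transpose C ** C = (1/2) *\<^sub>R (T + transpose T)" by simp
  have "transpose (C ** N) ** (C ** N) = transpose N ** (transpose C ** C) ** N"
    by (simp add: matrix_transpose_mul matrix_mul_assoc)
  also have "\<dots> = (1/2) *\<^sub>R (transpose N ** (T ** N) + (transpose N ** transpose T) ** N)"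
    unfolding CC by (simp add: mat_simps matrix_mul_assoc)
  also have "\<dots> = (1/2) *\<^sub>R (transpose N + N)"
    by (simp add: TN NT)
  finally have sq: "transpose (C ** N) ** (C ** N) = (1/2) *\<^sub>R (transpose N + N)" .
  have cr: "transpose base_frame ** (C ** N) = N" "transpose (C ** N) ** base_frame = transpose N"
    by (simp add: matrix_mul_assoc bC) (simp add: matrix_transpose_mul matrix_mul_assoc[symmetric] Cb)
  have "transpose (cayley V) ** cayley V = 4 *\<^sub>R (transpose (C ** N) ** (C ** N)) - 2 *\<^sub>R (transpose (C ** N) ** base_frame)
      - 2 *\<^sub>R (transpose base_frame ** (C ** N)) + mat 1"
    unfolding cayley_def C_def[symmetric] T_def[symmetric] N_def[symmetric]
    by (simp add: linear_diff[OF linear_transpose] linear_cmul[OF linear_transpose] mat_simps base_frame_orthonormal algebra_simps)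
  also have "\<dots> = mat 1"
    unfolding sq cr by (simp add: scaleR_add_right flip: scaleR_add_left)
  finally show ?thesis by (simp add: stiefel_def)
qed

lemma matrix_inv_scale:
  fixes A :: "real ^ 'n::finite ^ 'n"
  assumes "det A \<noteq> 0" "c \<noteq> 0"
  shows "matrix_inv (c *\<^sub>R A) = inverse c *\<^sub>R matrix_inv A"
  using assms by (intro matrix_inv_unique) (simp add: mat_simps matrix_inv_det)

lemma matrix_inv_involution:
  fixes A :: "real ^ 'n::finite ^ 'n"
  assumes "det A \<noteq> 0"
  shows "det (matrix_inv A) \<noteq> 0" "matrix_inv (matrix_inv A) = A"
  using matrix_inv_unique[OF matrix_inv_det(1)[OF assms]] .

lemma cayley_domain: "V \<in> base_tangent \<Longrightarrow> det (mat 1 + transpose base_frame ** cayley V) \<noteq> 0"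
  by (rule matrix_inv_unique(1)[of "(1/2) *\<^sub>R cay_T V"])
    (simp add: cayley_base mat_simps matrix_inv_det[OF det_cay_T])

lemma cayley_inv_cayley:
  assumes V: "V \<in> base_tangent"
  shows "cayley_inv (cayley V) = V"
proof -
  note T = det_cay_T[OF V]
  have N: "matrix_inv (mat 1 + transpose base_frame ** cayley V) = (1/2) *\<^sub>R cay_T V"
    by (simp add: cayley_base matrix_inv_scale matrix_inv_involution[OF T])
  have "(cayley V + base_frame) ** ((1/2) *\<^sub>R cay_T V) = cay_C V"
    by (simp add: cayley_def mat_simps matrix_mul_assoc[symmetric] matrix_inv_det[OF T])
  then have "cayley_inv (cayley V) = cay_C V - base_frame + base_frame ** (transpose (cay_C V) ** cay_C V - cay_T V)"
    by (simp add: cayley_inv_def Let_def N)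
  also have "\<dots> = V" by (simp add: cay_T_def cay_C_def)
  finally show ?thesis .
qed

lemma cayley_cayley_inv:
  assumes A: "A \<in> stiefel" and d: "det (mat 1 + transpose base_frame ** A) \<noteq> 0"
  shows "cayley_inv A \<in> base_tangent" "cayley (cayley_inv A) = A"
proof -
  define P where "P = mat 1 + transpose base_frame ** A"
  define N where "N = matrix_inv P"
  define C where "C = (A + base_frame) ** N"
  define S where "S = transpose C ** C - 2 *\<^sub>R N"
  have dP: "det P \<noteq> 0" using d by (simp add: P_def)
  note PN = matrix_inv_det[OF dP, folded N_def]
  have NP: "transpose N ** transpose P = mat 1"
    using arg_cong[OF PN(1), of transpose] by (simp add: matrix_transpose_mul transpose_mat)
  have AA: "transpose A ** A = mat 1" using A by (simp add: stiefel_def)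
  have bA: "transpose base_frame ** (A + base_frame) = P"
    by (simp add: P_def mat_simps base_frame_orthonormal)
  have bC: "transpose base_frame ** C = mat 1" by (simp add: C_def matrix_mul_assoc bA PN)
  have W: "transpose (A + base_frame) ** (A + base_frame) = P + transpose P"
    by (simp add: P_def mat_simps linear_add[OF linear_transpose] transpose_mat matrix_transpose_mul AA base_frame_orthonormal algebra_simps)
  have "transpose C ** C = transpose N ** (transpose (A + base_frame) ** (A + base_frame)) ** N"
    by (simp add: C_def matrix_transpose_mul matrix_mul_assoc)
  also have "\<dots> = transpose N ** (P ** N) + (transpose N ** transpose P) ** N"
    unfolding W by (simp add: mat_simps matrix_mul_assoc)
  also have "\<dots> = transpose N + N" by (simp add: PN NP)
  finally have CC: "transpose C ** C = transpose N + N" .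
  have S: "S \<in> skew"
    by (simp add: skew_def S_def CC linear_diff[OF linear_transpose] linear_add[OF linear_transpose] linear_cmul[OF linear_transpose] scaleR_2)
  have V: "cayley_inv A = C - base_frame + base_frame ** S"
    by (simp add: cayley_inv_def Let_def P_def[symmetric] N_def[symmetric] C_def[symmetric] S_def)
  have bV: "transpose base_frame ** cayley_inv A = S"
    unfolding V by (simp add: mat_simps bC base_frame_orthonormal matrix_mul_assoc)
  show "cayley_inv A \<in> base_tangent" using S by (simp add: base_tangent_def bV)
  have c: "cay_C (cayley_inv A) = C"
    unfolding cay_C_def bV by (simp add: V)
  have t: "cay_T (cayley_inv A) = 2 *\<^sub>R N"
    unfolding cay_T_def c bV by (simp add: S_def)
  have "matrix_inv (2 *\<^sub>R N) = (1/2) *\<^sub>R P"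
    using matrix_inv_involution[OF dP] by (simp add: N_def matrix_inv_scale)
  then show "cayley (cayley_inv A) = A"
    unfolding cayley_def c t by (simp add: mat_simps C_def matrix_mul_assoc[symmetric] PN)
qed


definition chart :: "'m::finite sqmat \<Rightarrow> real ^ (6 + 4 \<times> 'm) \<Rightarrow> 'm frame" where
  "chart Q u = Q ** cayley (to_tangent u)"

lemma smooth_linear_map: "linear f \<Longrightarrow> smooth_on UNIV f"
  for f :: "real ^ 'd::finite \<Rightarrow> 'b::real_normed_vector"
proof -
  assume f: "linear f"
  have "C_on k UNIV f" for k
  proof (cases k)
    case 0
    then show ?thesis using f by (simp add: linear_continuous_on linear_conv_bounded_linear)
  next
    case (Suc l)
    have "(f has_derivative f) (at u)" for u
      using f by (simp add: bounded_linear_imp_has_derivative linear_conv_bounded_linear)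
    then have "f differentiable_on UNIV" "partial i f = (\<lambda>u. f (axis i 1))" for i
      using partial_eq[of f f] by (auto simp: differentiable_on_def intro!: differentiableI)
    then show ?thesis using Suc by (simp add: C_on_const)
  qed
  then show ?thesis by (simp add: smooth_on_def)
qed

lemma smooth_to_tangent: "smooth_on UNIV to_tangent"
  by (rule smooth_linear_map[OF linear_to_tangent])

lemma cay_C_affine: "cay_C V = base_frame + (V - base_frame ** (transpose base_frame ** V))"
  by (simp add: cay_C_def)

lemma linear_cay_dC: "linear (\<lambda>V. V - base_frame ** (transpose base_frame ** V))"
  by (rule linearI) (simp_all add: mat_simps algebra_simps)

lemma smooth_cay_C: "smooth_on UNIV (\<lambda>u. cay_C (to_tangent u))"
  unfolding cay_C_affine
  by (intro smooth_on_add smooth_on_const smooth_on_linear[OF _ linear_cay_dC smooth_to_tangent]) simp_all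

lemma smooth_cay_T: "smooth_on UNIV (\<lambda>u. cay_T (to_tangent u))"
proof -
  have "smooth_on UNIV (\<lambda>u. transpose (cay_C (to_tangent u)) ** cay_C (to_tangent u)
      + (- (transpose base_frame ** to_tangent u)))"
    by (intro smooth_on_add smooth_on_matrix_mult smooth_on_linear[OF _ linear_transpose smooth_cay_C] smooth_cay_C
        smooth_on_linear[OF _ _ smooth_to_tangent] linear_compose_neg linear_matrix_mult) simp_all
  then show ?thesis by (simp add: cay_T_def)
qed

lemma smooth_chart: "smooth_on UNIV (chart Q)"
proof -
  have "linear (\<lambda>A. Q ** (2 *\<^sub>R A))"
    by (rule linearI) (simp_all add: mat_simps algebra_simps)
  then have "smooth_on UNIV (\<lambda>u. Q ** (2 *\<^sub>R (cay_C (to_tangent u) ** matrix_inv (cay_T (to_tangent u)))) + (- (Q ** base_frame)))"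
    by (intro smooth_on_add smooth_on_const smooth_on_linear[of _ "\<lambda>A. Q ** (2 *\<^sub>R A)"] smooth_on_matrix_mult smooth_cay_C
        smooth_on_matrix_inv smooth_cay_T det_cay_T to_tangent_in) simp_all
  then show ?thesis by (simp add: chart_def[abs_def] cayley_def mat_simps)
qed

definition cay_dC :: "'m::finite frame \<Rightarrow> 'm frame" where
  "cay_dC V = V - base_frame ** (transpose base_frame ** V)"

definition cay_dT :: "'m::finite frame \<Rightarrow> 'm frame \<Rightarrow> real ^ 4 ^ 4" where
  "cay_dT V W = transpose (cay_dC W) ** cay_C V + transpose (cay_C V) ** cay_dC W - transpose base_frame ** W"

text \<open>
  The derivative is obtained implicitly, by differentiating \<open>(Q\<^sup>T \<phi> + base_frame) T = 2 C\<close>, where \<open>C\<close> is affine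
  and \<open>T\<close> quadratic in the coordinates. This avoids differentiating the inverse of \<open>T\<close>.
\<close>

lemma chart_derivative:
  fixes Q :: "'m::finite sqmat" and u c :: "real ^ (6 + 4 \<times> 'm)"
  assumes Q: "transpose Q ** Q = mat 1"
  shows "transpose Q ** frechet_derivative (chart Q) (at u) c ** cay_T (to_tangent u)
      + (2 *\<^sub>R (cay_C (to_tangent u) ** matrix_inv (cay_T (to_tangent u)))) ** cay_dT (to_tangent u) (to_tangent c)
      = 2 *\<^sub>R cay_dC (to_tangent c)"
proof -
  let ?L = "\<lambda>V :: 'm frame. V - base_frame ** (transpose base_frame ** V)"
  let ?dC = "\<lambda>c. ?L (to_tangent c)"
  let ?C = "\<lambda>u. cay_C (to_tangent u)" and ?T = "\<lambda>u. cay_T (to_tangent u)"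
  let ?dT = "\<lambda>c. transpose (?dC c) ** ?C u + transpose (?C u) ** ?dC c - transpose base_frame ** to_tangent c"
  have bl: "bounded_linear f" if "linear f" for f :: "real ^ (6 + 4 \<times> 'm) \<Rightarrow> 'z::real_normed_vector"
    using that by (simp add: linear_conv_bounded_linear)
  have lin: "linear ?dC" using linear_compose[OF linear_to_tangent linear_cay_dC] by (simp add: o_def)
  have dC: "(?C has_derivative ?dC) (at u)"
    unfolding cay_C_affine using bounded_linear_imp_has_derivative[OF bl[OF lin], of "at u"]
    by (intro has_derivative_add[of _ "\<lambda>_. 0", simplified]) auto
  have dCt: "((\<lambda>u. transpose (?C u)) has_derivative (\<lambda>c. transpose (?dC c))) (at u)"
    using bounded_linear.has_derivative[OF _ dC] linear_transpose linear_conv_bounded_linear by blast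
  have bm: "bounded_bilinear ((**) :: real ^ 'y::finite ^ 'x::finite \<Rightarrow> real ^ 'z::finite ^ 'y \<Rightarrow> _)"
    using bilinear_matrix_mult bilinear_conv_bounded_bilinear by blast
  have lS: "linear (\<lambda>c. transpose base_frame ** to_tangent c :: real ^ 4 ^ 4)"
    using linear_compose[OF linear_to_tangent linear_matrix_mult] by (simp add: o_def)
  have dT: "(?T has_derivative ?dT) (at u)"
    unfolding cay_T_def
    using has_derivative_diff[OF bounded_bilinear.FDERIV[OF bm dCt dC] bounded_linear_imp_has_derivative[OF bl[OF lS]]]
    by (simp add: add.commute)
  have dchart: "(chart Q has_derivative frechet_derivative (chart Q) (at u)) (at u)"
    using smooth_on_differentiable[OF open_UNIV smooth_chart UNIV_I] frechet_derivative_works by blast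
  let ?F = "\<lambda>u. transpose Q ** chart Q u + base_frame"
  have "((\<lambda>u. transpose Q ** chart Q u) has_derivative (\<lambda>c. transpose Q ** frechet_derivative (chart Q) (at u) c)) (at u)"
    using bounded_linear.has_derivative[OF _ dchart] linear_matrix_mult linear_conv_bounded_linear by blast
  then have dF: "(?F has_derivative (\<lambda>c. transpose Q ** frechet_derivative (chart Q) (at u) c)) (at u)"
    by (auto intro: has_derivative_add_const)
  have F: "?F v = 2 *\<^sub>R (?C v ** matrix_inv (?T v))" for v
    by (simp add: chart_def matrix_mul_assoc Q cayley_def)
  have "?F v ** ?T v = 2 *\<^sub>R ?C v" for v
    unfolding F by (simp add: mat_simps matrix_mul_assoc[symmetric] matrix_inv_det[OF det_cay_T[OF to_tangent_in]])
  then have "((\<lambda>v. 2 *\<^sub>R ?C v) has_derivative (\<lambda>c. ?F u ** ?dT c + transpose Q ** frechet_derivative (chart Q) (at u) c ** ?T u)) (at u)"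
    using bounded_bilinear.FDERIV[OF bm dF dT] by simp
  moreover have "((\<lambda>v. 2 *\<^sub>R ?C v) has_derivative (\<lambda>c. 2 *\<^sub>R ?dC c)) (at u)"
    by (intro has_derivative_scaleR_right dC)
  ultimately have "(\<lambda>c. ?F u ** ?dT c + transpose Q ** frechet_derivative (chart Q) (at u) c ** ?T u) = (\<lambda>c. 2 *\<^sub>R ?dC c)"
    by (rule has_derivative_unique)
  then have "?F u ** ?dT c + transpose Q ** frechet_derivative (chart Q) (at u) c ** ?T u = 2 *\<^sub>R ?dC c" for c
    by (rule fun_cong)
  then show ?thesis unfolding F cay_dT_def cay_dC_def by (simp add: add.commute)
qed

lemma chart_inj:
  fixes Q :: "'m::finite sqmat"
  assumes Q: "transpose Q ** Q = mat 1"
  shows "inj (frechet_derivative (chart Q) (at u))"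
proof -
  let ?D = "frechet_derivative (chart Q) (at u)" and ?T = "cay_T (to_tangent u)"
  have lin: "linear ?D"
    using smooth_on_differentiable[OF open_UNIV smooth_chart UNIV_I] by (rule linear_frechet_derivative)
  note d = chart_derivative[OF Q, of u]
  have "c = 0" if "?D c = 0" for c
  proof -
    let ?L = "cay_dC (to_tangent c)" and ?dT = "cay_dT (to_tangent u) (to_tangent c)"
    have 1: "(2 *\<^sub>R (cay_C (to_tangent u) ** matrix_inv ?T)) ** ?dT = 2 *\<^sub>R ?L"
      using d[of c] that by (simp add: mat_simps)
    have "transpose base_frame ** ((2 *\<^sub>R (cay_C (to_tangent u) ** matrix_inv ?T)) ** ?dT) = 2 *\<^sub>R (matrix_inv ?T ** ?dT)"
      by (simp add: mat_simps matrix_mul_assoc base_cay_C)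
    moreover have "transpose base_frame ** (2 *\<^sub>R ?L) = 0"
      by (simp add: cay_dC_def mat_simps matrix_mul_assoc base_frame_orthonormal)
    ultimately have "matrix_inv ?T ** ?dT = 0" unfolding 1 by simp
    then have "?T ** (matrix_inv ?T ** ?dT) = 0" by (simp add: mat_simps)
    then have dT0: "?dT = 0"
      by (simp add: matrix_mul_assoc matrix_inv_det[OF det_cay_T[OF to_tangent_in]])
    then have L: "?L = 0" using 1 by (simp add: mat_simps)
    have "transpose base_frame ** to_tangent c = 0"
      using dT0 unfolding cay_dT_def L by (simp add: mat_simps linear_0[OF linear_transpose])
    then have "to_tangent c = 0" using L by (simp add: cay_dC_def mat_simps)
    then show "c = 0" using of_to_tangent[of c] linear_0[OF linear_of_tangent] by metis
  qed
  then show ?thesis using linear_injective_0[OF lin] by blast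
qed

lemma orthogonal_stiefel:
  assumes "transpose Q ** Q = mat 1"
  shows "A \<in> stiefel \<Longrightarrow> Q ** A \<in> stiefel"
proof -
  assume "A \<in> stiefel"
  have "transpose (Q ** A) ** (Q ** A) = transpose A ** (transpose Q ** Q) ** A"
    by (simp add: matrix_transpose_mul matrix_mul_assoc)
  then show ?thesis using \<open>A \<in> stiefel\<close> assms by (simp add: stiefel_def)
qed

lemma chart_image:
  fixes Q :: "'m::finite sqmat"
  assumes Q: "transpose Q ** Q = mat 1"
  shows "chart Q ` UNIV = {A \<in> stiefel. det (mat 1 + transpose base_frame ** (transpose Q ** A)) \<noteq> 0}"
proof (intro equalityI subsetI)
  fix A assume "A \<in> chart Q ` UNIV"
  then obtain u where A: "A = Q ** cayley (to_tangent u)" by (auto simp: chart_def)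
  then show "A \<in> {A \<in> stiefel. det (mat 1 + transpose base_frame ** (transpose Q ** A)) \<noteq> 0}"
    using orthogonal_stiefel[OF Q cayley_stiefel[OF to_tangent_in]] cayley_domain[OF to_tangent_in, of u]
    by (simp add: matrix_mul_assoc Q) (simp add: matrix_mul_assoc[symmetric] Q)
next
  fix A :: "'m frame"
  assume A: "A \<in> {A \<in> stiefel. det (mat 1 + transpose base_frame ** (transpose Q ** A)) \<noteq> 0}"
  have "transpose (transpose Q) ** transpose Q = mat 1" using orthogonal_both[OF Q] by simp
  from orthogonal_stiefel[OF this] A have "transpose Q ** A \<in> stiefel" by simp
  note c = cayley_cayley_inv[OF this]
  have "A = chart Q (of_tangent (cayley_inv (transpose Q ** A)))"
    using A c by (simp add: chart_def to_of_tangent matrix_mul_assoc orthogonal_both[OF Q])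
  then show "A \<in> chart Q ` UNIV" by blast
qed

lemma local_param_chart:
  fixes Q :: "'m::finite sqmat"
  assumes Q: "transpose Q ** Q = mat 1"
  shows "local_param stiefel UNIV (chart Q)"
proof -
  let ?M = "\<lambda>A :: 'm frame. mat 1 + transpose base_frame ** (transpose Q ** A)"
  have cM: "continuous_on S (\<lambda>A. M ** A)" for S :: "(real ^ 'y::finite ^ 'x::finite) set" and M :: "real ^ 'x ^ 'z::finite"
    by (intro linear_continuous_on linear_conv_bounded_linear[THEN iffD1] linear_matrix_mult)
  have cM': "continuous_on S ?M" for S
    using continuous_on_compose2[OF cM cM[of S "transpose Q"], of UNIV "transpose base_frame"]
    by (intro continuous_on_add continuous_on_const) auto
  have cdet: "continuous_on UNIV (\<lambda>A. det (?M A))"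
    unfolding det_def by (intro continuous_intros cM')
  have "open {A. det (?M A) \<noteq> 0}"
    using continuous_open_preimage[OF cdet open_UNIV, of "- {0}"] by (simp add: vimage_def open_Compl)
  then have op: "openin (top_of_set stiefel) (chart Q ` UNIV)"
    unfolding chart_image[OF Q] by (auto simp: openin_open intro!: exI[of _ "{A. det (?M A) \<noteq> 0}"])
  let ?N = "\<lambda>A. matrix_inv (?M A)"
  let ?C = "\<lambda>A. (transpose Q ** A + base_frame) ** ?N A"
  have cmul: "continuous_on S (\<lambda>A. f A ** g A)" if "continuous_on S f" "continuous_on S g"
    for S :: "'m frame set" and f :: "'m frame \<Rightarrow> real ^ 'y::finite ^ 'x::finite" and g :: "'m frame \<Rightarrow> real ^ 'z::finite ^ 'y"
    using that bounded_bilinear.continuous_on bilinear_matrix_mult bilinear_conv_bounded_bilinear by blast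
  have ctr: "continuous_on S (\<lambda>A. transpose (f A))" if "continuous_on S f"
    for S :: "'m frame set" and f :: "'m frame \<Rightarrow> real ^ 'y::finite ^ 'x::finite"
    using that bounded_linear.continuous_on linear_transpose linear_conv_bounded_linear by blast
  have cN: "continuous_on (chart Q ` UNIV) ?N"
    unfolding chart_image[OF Q] by (intro continuous_on_matrix_inv cM') auto
  have "continuous_on (chart Q ` UNIV) (\<lambda>A. ?C A - base_frame + base_frame ** (transpose (?C A) ** ?C A - 2 *\<^sub>R ?N A))"
    by (intro continuous_on_add continuous_on_diff continuous_on_const continuous_on_scaleR cmul ctr cN cM)
  then have ci: "continuous_on (chart Q ` UNIV) (\<lambda>A. cayley_inv (transpose Q ** A))"
    by (simp add: cayley_inv_def Let_def)
  have cof: "continuous_on S of_tangent" for S :: "'m frame set"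
    by (intro linear_continuous_on linear_conv_bounded_linear[THEN iffD1] linear_of_tangent)
  have "continuous_on (chart Q ` UNIV) (\<lambda>A. of_tangent (cayley_inv (transpose Q ** A)))"
    by (rule continuous_on_compose2[OF cof[of UNIV] ci]) simp
  moreover have "continuous_on UNIV (chart Q)"
    using smooth_chart[of Q] unfolding smooth_on_def by (metis C_on.simps(1))
  moreover have "of_tangent (cayley_inv (transpose Q ** chart Q u)) = u" for u
    by (simp add: chart_def matrix_mul_assoc Q cayley_inv_cayley[OF to_tangent_in] of_to_tangent)
  ultimately have "homeomorphism UNIV (chart Q ` UNIV) (chart Q) (\<lambda>A. of_tangent (cayley_inv (transpose Q ** A)))"
    by (intro homeomorphismI) auto
  then show ?thesis
    unfolding local_param_def using smooth_chart chart_inj[OF Q] op by blast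
qed

lemma stiefel_orthogonal:
  assumes "A \<in> stiefel"
  obtains Q :: "'m::finite sqmat" where "transpose Q ** Q = mat 1" "A = Q ** base_frame"
proof -
  obtain Q :: "'m sqmat" where "rotation_matrix Q" "A = Q ** base_frame"
    using assms unfolding stiefel_orbit by blast
  then show ?thesis using that[of Q] by (simp add: rotation_matrix_def orthogonal_matrix)
qed

lemma to_tangent_0: "to_tangent 0 = 0"
  by (rule linear_0[OF linear_to_tangent])

lemma cay_0: "cay_C 0 = base_frame" "cay_T 0 = mat 1"
  by (simp_all add: cay_C_def cay_T_def mat_simps base_frame_orthonormal)

lemma chart_0: "chart Q 0 = Q ** base_frame"
proof -
  have "matrix_inv (mat 1 :: real ^ 4 ^ 4) = mat 1" by (rule matrix_inv_unique(2)) simp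
  then show ?thesis by (simp add: chart_def to_tangent_0 cayley_def cay_0 scaleR_2)
qed

lemma submanifold_stiefel: "submanifold TYPE(6 + 4 \<times> 'm) (stiefel :: 'm::finite frame set)"
  unfolding submanifold_def
proof
  fix A :: "'m frame" assume "A \<in> stiefel"
  then obtain Q :: "'m sqmat" where Q: "transpose Q ** Q = mat 1" and A: "A = Q ** base_frame"
    by (rule stiefel_orthogonal)
  have "A \<in> chart Q ` UNIV" unfolding A by (metis chart_0 rangeI)
  then show "\<exists>U (\<phi> :: real ^ (6 + 4 \<times> 'm) \<Rightarrow> 'm frame). local_param stiefel U \<phi> \<and> A \<in> \<phi> ` U"
    using local_param_chart[OF Q] by blast
qed

text \<open>
  A skew \<open>A\<^sup>T V\<close> is realized by the curve \<open>chart Q (t c)\<close> through \<open>A = Q base_frame\<close>. At the origin the chart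
  has derivative \<open>c \<mapsto> 2 Q (to_tangent c)\<close>, which explains the factor \<open>1/2\<close> in the choice of \<open>c\<close>.
\<close>

lemma tangent_space_stiefel:
  fixes A :: "'m::finite frame"
  assumes A: "A \<in> stiefel"
  shows "tangent_space stiefel A = {V. transpose A ** V \<in> skew}"
proof (intro equalityI subsetI)
  fix V assume "V \<in> tangent_space stiefel A"
  then obtain \<gamma> where \<gamma>: "\<And>t. \<gamma> t \<in> stiefel" "\<gamma> 0 = A" "(\<gamma> has_vector_derivative V) (at 0)"
    unfolding tangent_space_def by blast
  have bm: "bounded_bilinear ((**) :: real ^ (4 + 'm) ^ 4 \<Rightarrow> real ^ 4 ^ (4 + 'm) \<Rightarrow> _)"
    using bilinear_matrix_mult bilinear_conv_bounded_bilinear by blast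
  have "((\<lambda>t. transpose (\<gamma> t)) has_vector_derivative transpose V) (at 0)"
    using bounded_linear.has_vector_derivative[OF _ \<gamma>(3)] linear_transpose linear_conv_bounded_linear by blast
  from bounded_bilinear.has_vector_derivative[OF bm this \<gamma>(3)]
  have "((\<lambda>t. transpose (\<gamma> t) ** \<gamma> t) has_vector_derivative transpose A ** V + transpose V ** A) (at 0)"
    by (simp add: \<gamma>(2))
  moreover have "(\<lambda>t. transpose (\<gamma> t) ** \<gamma> t) = (\<lambda>t. mat 1)" using \<gamma>(1) by (simp add: stiefel_def)
  ultimately have "((\<lambda>t. mat 1 :: real ^ 4 ^ 4) has_vector_derivative transpose A ** V + transpose V ** A) (at (0 :: real))"
    by simp
  then have "transpose A ** V + transpose V ** A = 0"
    using vector_derivative_unique_at has_vector_derivative_const by blast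
  then show "V \<in> {V. transpose A ** V \<in> skew}"
    by (simp add: skew_def matrix_transpose_mul eq_neg_iff_add_eq_0 add.commute)
next
  fix V assume "V \<in> {V. transpose A ** V \<in> skew}"
  then have V: "transpose A ** V \<in> skew" by simp
  obtain Q :: "'m sqmat" where Q: "transpose Q ** Q = mat 1" and AQ: "A = Q ** base_frame"
    using A by (rule stiefel_orthogonal)
  define c where "c = of_tangent ((1/2) *\<^sub>R (transpose Q ** V))"
  have "transpose base_frame ** ((1/2) *\<^sub>R (transpose Q ** V)) = (1/2) *\<^sub>R (transpose A ** V)"
    by (simp add: mat_simps AQ matrix_transpose_mul matrix_mul_assoc)
  then have "(1/2) *\<^sub>R (transpose Q ** V) \<in> base_tangent"
    using V subspace_scale[OF subspace_skew] by (simp add: base_tangent_def)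
  then have tc: "to_tangent c = (1/2) *\<^sub>R (transpose Q ** V)" by (simp add: c_def to_of_tangent)
  let ?D = "frechet_derivative (chart Q) (at 0)"
  have one: "matrix_inv (mat 1 :: real ^ 4 ^ 4) = mat 1" by (rule matrix_inv_unique(2)) simp
  note d = chart_derivative[OF Q, of 0 c]
  let ?L = "cay_dC (to_tangent c)"
  have bL: "transpose base_frame ** ?L = 0"
    by (simp add: cay_dC_def mat_simps matrix_mul_assoc base_frame_orthonormal)
  have "transpose ?L ** base_frame = 0"
    using arg_cong[OF bL, of transpose] by (simp add: matrix_transpose_mul linear_0[OF linear_transpose])
  then have "cay_dT 0 (to_tangent c) = - (transpose base_frame ** to_tangent c)"
    using bL by (simp add: cay_dT_def cay_0)
  then have "transpose Q ** ?D c = 2 *\<^sub>R to_tangent c"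
    using d by (simp add: to_tangent_0 cay_0 one cay_dC_def mat_simps scaleR_diff_right)
  then have "Q ** (transpose Q ** ?D c) = Q ** (transpose Q ** V)" by (simp add: tc)
  then have Dc: "?D c = V" by (simp add: matrix_mul_assoc orthogonal_both[OF Q])
  have "(chart Q has_derivative ?D) (at 0)"
    using smooth_on_differentiable[OF open_UNIV smooth_chart UNIV_I] frechet_derivative_works by blast
  moreover have "((\<lambda>t. t *\<^sub>R c) has_derivative (\<lambda>t. t *\<^sub>R c)) (at (0::real))"
    by (intro bounded_linear_imp_has_derivative bounded_linear_scaleR_left)
  ultimately have "((\<lambda>t. chart Q (t *\<^sub>R c)) has_derivative (\<lambda>t. ?D (t *\<^sub>R c))) (at (0::real))"
    using has_derivative_compose[of "\<lambda>t. t *\<^sub>R c" "\<lambda>t. t *\<^sub>R c" 0 UNIV "chart Q" ?D] by simp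
  moreover have "?D (t *\<^sub>R c) = t *\<^sub>R V" for t
    using linear_cmul[OF linear_frechet_derivative[OF smooth_on_differentiable[OF open_UNIV smooth_chart UNIV_I]]] Dc by metis
  ultimately have "((\<lambda>t. chart Q (t *\<^sub>R c)) has_vector_derivative V) (at 0)"
    unfolding has_vector_derivative_def by simp
  moreover have "chart Q (t *\<^sub>R c) \<in> stiefel" for t using chart_image[OF Q] by blast
  moreover have "chart Q (0 *\<^sub>R c) = A" by (simp add: chart_0 AQ)
  ultimately show "V \<in> tangent_space stiefel A"
    unfolding tangent_space_def mem_Collect_eq by (intro exI[of _ "\<lambda>t. chart Q (t *\<^sub>R c)"]) simp
qed

section \<open>Invariant metrics on the Stiefel manifold\<close>

text \<open>
  Frames \<open>A\<close> near \<open>A\<^sub>0 = Q\<^sub>0 base_frame\<close> are completed to orthogonal matrices without orthogonalization: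
  \<open>H = (A\<^sub>0 + A) (1 + A\<^sup>T A\<^sub>0)\<^sup>-\<^sup>1 (A\<^sub>0 + A)\<^sup>T - 1\<close> is the block analogue of the half turn that exchanges two
  unit vectors. It is orthogonal, depends rationally on \<open>A\<close>, and maps \<open>A\<^sub>0\<close> to \<open>A\<close>; so \<open>H Q\<^sub>0\<close> is the lift.
\<close>

lemma moving_frame:
  fixes \<phi> :: "real ^ 'd::finite \<Rightarrow> 'm::finite frame"
  assumes U: "open U" and s: "smooth_on U \<phi>" and st: "\<And>u. u \<in> U \<Longrightarrow> \<phi> u \<in> stiefel" and u0: "u0 \<in> U"
  obtains V and Q :: "real ^ 'd \<Rightarrow> 'm sqmat" where "open V" "u0 \<in> V" "V \<subseteq> U" "smooth_on V Q"
    "\<And>u. u \<in> V \<Longrightarrow> transpose (Q u) ** Q u = mat 1" "\<And>u. u \<in> V \<Longrightarrow> \<phi> u = Q u ** base_frame"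
proof -
  obtain Q0 :: "'m sqmat" where Q0: "transpose Q0 ** Q0 = mat 1" and A0: "\<phi> u0 = Q0 ** base_frame"
    using st[OF u0] by (rule stiefel_orthogonal)
  define A where "A = \<phi> u0"
  have AA: "transpose A ** A = mat 1" using st[OF u0] by (simp add: A_def stiefel_def)
  define M where "M u = mat 1 + transpose (\<phi> u) ** A" for u
  define W where "W u = A + \<phi> u" for u
  define H where "H u = W u ** (matrix_inv (M u) ** transpose (W u)) + (- mat 1)" for u
  define V where "V = {u \<in> U. det (M u) \<noteq> 0}"
  have sT: "smooth_on U (\<lambda>u. transpose (\<phi> u))" by (rule smooth_on_linear[OF U linear_transpose s])
  have sM: "smooth_on U M" unfolding M_def[abs_def]
    by (intro smooth_on_add smooth_on_const smooth_on_matrix_mult sT U)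
  have "continuous_on U (\<lambda>u. det (M u))"
    using smooth_on_det[OF U smooth_on_entry[OF U sM]] unfolding smooth_on_def by (metis C_on.simps(1))
  from continuous_open_preimage[OF this U, of "- {0}"]
  have V: "open V" by (simp add: V_def vimage_def open_Compl Int_def)
  have VU: "V \<subseteq> U" by (auto simp: V_def)
  have "(1/2) *\<^sub>R mat 1 ** M u0 = mat 1" 
    by (simp add: M_def AA A_def[symmetric] mat_simps flip: scaleR_2)
  then have uV: "u0 \<in> V" using u0 matrix_inv_unique(1) by (auto simp: V_def)
  have sW: "smooth_on V W" unfolding W_def[abs_def]
    by (intro smooth_on_add smooth_on_const smooth_on_subset[OF s VU] V)
  have sH: "smooth_on V H" unfolding H_def[abs_def]
    by (intro smooth_on_add smooth_on_const smooth_on_matrix_mult smooth_on_linear[OF V linear_transpose sW] sW V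
        smooth_on_matrix_inv smooth_on_subset[OF sM VU]) (auto simp: V_def)
  have "transpose (H u) ** H u = mat 1 \<and> H u ** A = \<phi> u" if u: "u \<in> V" for u
  proof -
    define N where "N = matrix_inv (M u)"
    have d: "det (M u) \<noteq> 0" using u by (simp add: V_def)
    note MN = matrix_inv_det[OF d, folded N_def]
    have pp: "transpose (\<phi> u) ** \<phi> u = mat 1" using st u by (auto simp: V_def stiefel_def)
    have NM: "transpose N ** transpose (M u) = mat 1"
      using arg_cong[OF MN(1), of transpose] by (simp add: matrix_transpose_mul transpose_mat)
    have WW: "transpose (W u) ** W u = M u + transpose (M u)"
      by (simp add: W_def M_def mat_simps linear_add[OF linear_transpose] transpose_mat matrix_transpose_mul AA pp algebra_simps)
    have WA: "transpose (W u) ** A = M u"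
      by (simp add: W_def M_def mat_simps linear_add[OF linear_transpose] AA)
    have "H u ** A = W u ** (N ** (transpose (W u) ** A)) - A"
      by (simp add: H_def N_def[symmetric] mat_simps matrix_mul_assoc)
    also have "\<dots> = \<phi> u" by (simp add: WA MN) (simp add: W_def)
    finally have HA: "H u ** A = \<phi> u" .
    have tH: "transpose (H u) = W u ** (transpose N ** transpose (W u)) + (- mat 1)"
      by (simp add: H_def N_def[symmetric] linear_diff[OF linear_transpose] linear_neg[OF linear_transpose] transpose_mat matrix_transpose_mul matrix_mul_assoc)
    have "(W u ** (transpose N ** transpose (W u))) ** (W u ** (N ** transpose (W u)))
        = W u ** (transpose N ** (transpose (W u) ** W u) ** N) ** transpose (W u)"
      by (simp add: matrix_mul_assoc)
    also have "transpose N ** (transpose (W u) ** W u) ** N = transpose N ** (M u ** N) + (transpose N ** transpose (M u)) ** N"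
      unfolding WW by (simp add: mat_simps matrix_mul_assoc)
    also have "\<dots> = transpose N + N" by (simp add: MN NM)
    finally have sq: "(W u ** (transpose N ** transpose (W u))) ** (W u ** (N ** transpose (W u)))
        = W u ** (transpose N ** transpose (W u)) + W u ** (N ** transpose (W u))"
      by (simp add: mat_simps matrix_mul_assoc)
    have "transpose (H u) ** H u = mat 1"
      unfolding tH unfolding H_def N_def[symmetric]
      by (simp add: mat_simps sq)
    with HA show ?thesis by blast
  qed
  note H = this
  show thesis
  proof (rule that[OF V uV VU])
    show "smooth_on V (\<lambda>u. H u ** Q0)" by (intro smooth_on_matrix_mult sH smooth_on_const V)
    show "transpose (H u ** Q0) ** (H u ** Q0) = mat 1" if "u \<in> V" for u
    proof -
      have "transpose (H u ** Q0) ** (H u ** Q0) = transpose Q0 ** (transpose (H u) ** H u) ** Q0"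
        by (simp add: matrix_transpose_mul matrix_mul_assoc)
      then show ?thesis using H[OF that] Q0 by simp
    qed
    show "\<phi> u = H u ** Q0 ** base_frame" if "u \<in> V" for u
      using H[OF that] by (simp add: A_def A0 matrix_mul_assoc)
  qed
qed

lemma maurer_cartan:
  fixes Q :: "real ^ 'd::finite \<Rightarrow> real ^ 'n::finite ^ 'n"
  assumes V: "open V" and s: "smooth_on V Q" and orth: "\<forall>u\<in>V. transpose (Q u) ** Q u = mat 1"
  defines "\<omega> \<equiv> \<lambda>i u. transpose (Q u) ** partial i Q u"
  shows "smooth_on V (\<omega> i)" and "u \<in> V \<Longrightarrow> \<omega> i u \<in> skew" and "u \<in> V \<Longrightarrow> partial i (\<omega> j) u \<in> skew"
    and "u \<in> V \<Longrightarrow> partial i (\<omega> j) u - partial j (\<omega> i) u = - comm (\<omega> i u) (\<omega> j u)"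
    and "u \<in> V \<Longrightarrow> partial i Q u = Q u ** \<omega> i u"
proof -
  have o: "transpose (Q u) ** Q u = mat 1" if "u \<in> V" for u using orth that by blast
  have sT: "smooth_on V (\<lambda>u. transpose (Q u))" by (rule smooth_on_linear[OF V linear_transpose s])
  have s\<omega>: "smooth_on V (\<omega> i)" for i unfolding \<omega>_def
    by (intro smooth_on_matrix_mult sT smooth_on_partial s V)
  note dQ = smooth_on_differentiable[OF V s] and dT = smooth_on_differentiable[OF V sT]
    and d\<omega> = smooth_on_differentiable[OF V s\<omega>] and ddQ = smooth_on_differentiable[OF V smooth_on_partial[OF s]]
  have pT: "partial i (\<lambda>u. transpose (Q u)) u = transpose (partial i Q u)" if "u \<in> V" for i u
    by (rule partial_linear[OF linear_transpose dQ[OF that]])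
  have sk: "\<omega> i u \<in> skew" if u: "u \<in> V" for i u
  proof -
    have "partial i (\<lambda>u. transpose (Q u) ** Q u) u = transpose (Q u) ** partial i Q u + transpose (partial i Q u) ** Q u"
      unfolding partial_bilinear[OF bilinear_matrix_mult dT[OF u] dQ[OF u]] pT[OF u] ..
    moreover have "partial i (\<lambda>u. transpose (Q u) ** Q u) u = partial i (\<lambda>u. mat 1) u"
      by (rule partial_cong_open[OF smooth_on_differentiable[OF V smooth_on_matrix_mult[OF V sT s] u] V u]) (rule o)
    moreover have "partial i (\<lambda>u. mat 1 :: real ^ 'n ^ 'n) u = 0"
      by (simp add: partial_def)
    ultimately show ?thesis
      by (simp add: \<omega>_def skew_def matrix_transpose_mul eq_neg_iff_add_eq_0 add.commute)
  qed
  have both: "Q u ** transpose (Q u) = mat 1" if "u \<in> V" for u by (rule orthogonal_both[OF o[OF that]])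
  have Q\<omega>: "partial i Q u = Q u ** \<omega> i u" if "u \<in> V" for i u
    by (simp add: \<omega>_def matrix_mul_assoc both[OF that])
  show "smooth_on V (\<omega> i)" by (rule s\<omega>)
  assume u: "u \<in> V"
  show "\<omega> i u \<in> skew" by (rule sk[OF u])
  show "partial i Q u = Q u ** \<omega> i u" by (rule Q\<omega>[OF u])
  show "partial i (\<omega> j) u \<in> skew"
  proof -
    have "transpose (partial i (\<omega> j) u) = partial i (\<lambda>u. transpose (\<omega> j u)) u"
      by (rule partial_linear[OF linear_transpose d\<omega>[OF u], symmetric])
    also have "\<dots> = partial i (\<lambda>u. - \<omega> j u) u"
      by (rule partial_cong_open[OF smooth_on_differentiable[OF V smooth_on_linear[OF V linear_transpose s\<omega>] u] V u])
        (use sk in \<open>simp add: skew_def\<close>)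
    also have "\<dots> = - partial i (\<omega> j) u"
      by (rule partial_linear[OF linear_uminus d\<omega>[OF u]])
    finally show ?thesis by (simp add: skew_def)
  qed
  show "partial i (\<omega> j) u - partial j (\<omega> i) u = - comm (\<omega> i u) (\<omega> j u)"
  proof -
    have "partial i (\<omega> j) u = transpose (Q u) ** partial i (partial j Q) u + transpose (partial i Q u) ** partial j Q u" for i j
      unfolding \<omega>_def partial_bilinear[OF bilinear_matrix_mult dT[OF u] ddQ[OF u]] pT[OF u] ..
    moreover have "transpose (partial i Q u) ** partial j Q u = - (\<omega> i u ** \<omega> j u)" for i j
    proof -
      have "transpose (partial i Q u) ** partial j Q u = transpose (\<omega> i u) ** (transpose (Q u) ** Q u) ** \<omega> j u"
        unfolding Q\<omega>[OF u] by (simp add: matrix_transpose_mul matrix_mul_assoc)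
      then show ?thesis using sk[OF u, of i] o[OF u] by (simp add: skew_def mat_simps)
    qed
    ultimately show ?thesis
      using mixed_partials[OF V s u, of i j] by (simp add: comm_def)
  qed
qed

text \<open>
  Weights \<open>e i j\<close> on the upper left \<open>4 \<times> 4\<close> block and \<open>d j\<close> on the part of column \<open>j\<close> below it; the pairs
  of lower indices span the isotropy subalgebra.
\<close>

locale stiefel_weights =
  fixes e :: "4 \<Rightarrow> 4 \<Rightarrow> real" and d :: "4 \<Rightarrow> real" and m :: "'m::finite itself"
  assumes e_sym: "e i j = e j i" and e_pos: "e i j > 0" and d_pos: "d i > 0"
begin

definition w :: "4 + 'm \<Rightarrow> 4 + 'm \<Rightarrow> real" where
  "w a b = (case a of
      Inl i \<Rightarrow> (case b of Inl j \<Rightarrow> e i j | Inr s \<Rightarrow> d i)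
    | Inr r \<Rightarrow> (case b of Inl j \<Rightarrow> d j | Inr s \<Rightarrow> 0))"

lemma w_simps [simp]: "w (Inl i) (Inl j) = e i j" "w (Inl i) (Inr s) = d i" "w (Inr s) (Inl i) = d i" "w (Inr r) (Inr s) = 0"
  by (simp_all add: w_def)

lemma w_eq_0: "w a b = 0 \<longleftrightarrow> (\<exists>r s. a = Inr r \<and> b = Inr s)"
  using e_pos d_pos by (cases a; cases b) (auto simp: less_le)

sublocale weights w
proof
  show "w a b = w b a" for a b using e_sym by (cases a; cases b) auto
  show "0 \<le> w a b" for a b using e_pos d_pos by (cases a; cases b) (auto intro: less_imp_le)
  show "w a c = w b c" if "w a b = 0" for a b c using that by (cases c) (auto simp: w_eq_0)
qed

text \<open>
  The invariant metric as a polynomial in the frame. For \<open>A = Q base_frame\<close> and \<open>V = Q X base_frame\<close> the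
  matrix \<open>A\<^sup>T V\<close> is the upper block of \<open>X\<close>, and \<open>V\<^sup>T V\<close> collects all entries of the first four columns of \<open>X\<close>.
  The entries below the upper block appear twice in the skew matrix \<open>X\<close>; this is the factor \<open>2\<close> of the last
  sum, and the subtraction of \<open>2 d\<close> removes the contribution of the upper block to that sum.
\<close>

definition g :: "'m frame \<Rightarrow> 'm frame \<Rightarrow> 'm frame \<Rightarrow> real" where
  "g A V W = (\<Sum>i\<in>UNIV. \<Sum>j\<in>UNIV. (e i j - 2 * d j) * (transpose A ** V) $ i $ j * (transpose A ** W) $ i $ j)
     + 2 * (\<Sum>j\<in>UNIV. d j * (transpose V ** W) $ j $ j)"

lemma g_orthogonal:
  assumes "transpose Q ** Q = mat 1"
  shows "g (Q ** A) (Q ** V) (Q ** W) = g A V W"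
proof -
  have "transpose (Q ** X) ** (Q ** Y) = transpose X ** Y" for X Y :: "'m frame"
  proof -
    have "transpose (Q ** X) ** (Q ** Y) = transpose X ** (transpose Q ** Q) ** Y"
      by (simp add: matrix_transpose_mul matrix_mul_assoc)
    then show ?thesis using assms by simp
  qed
  then show ?thesis by (simp add: g_def)
qed

lemma sum_UNIV_sum: "(\<Sum>a\<in>UNIV. f a) = (\<Sum>i\<in>UNIV. f (Inl i)) + (\<Sum>r\<in>UNIV. f (Inr r))"
  for f :: "'a::finite + 'b::finite \<Rightarrow> real"
  using sum.Plus[of "UNIV :: 'a set" "UNIV :: 'b set" f] by (simp add: UNIV_Plus_UNIV o_def)

lemma g_base:
  assumes X: "X \<in> skew" and Y: "Y \<in> skew"
  shows "g base_frame (X ** base_frame) (Y ** base_frame) = form X Y"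
proof -
  have 1: "(transpose (X ** base_frame) ** (Y ** base_frame)) $ j $ j
      = (\<Sum>i\<in>UNIV. X $ Inl i $ Inl j * Y $ Inl i $ Inl j) + (\<Sum>r\<in>UNIV. X $ Inr r $ Inl j * Y $ Inr r $ Inl j)" for j
  proof -
    have "(transpose P ** R) $ j $ j = (\<Sum>a\<in>UNIV. P $ a $ j * R $ a $ j)" for P R :: "'m frame"
      by (simp add: matrix_matrix_mult_def transpose_def)
    then show ?thesis by (simp add: matrix_mul_base_frame sum_UNIV_sum)
  qed
  have "2 * (\<Sum>j\<in>UNIV. d j * (\<Sum>i\<in>UNIV. X $ Inl i $ Inl j * Y $ Inl i $ Inl j))
      = (\<Sum>i\<in>UNIV. \<Sum>j\<in>UNIV. 2 * d j * X $ Inl i $ Inl j * Y $ Inl i $ Inl j)"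
    by (subst sum.swap) (simp add: sum_distrib_left mult_ac)
  moreover have "g base_frame (X ** base_frame) (Y ** base_frame)
      = (\<Sum>i\<in>UNIV. \<Sum>j\<in>UNIV. (e i j - 2 * d j) * X $ Inl i $ Inl j * Y $ Inl i $ Inl j)
        + 2 * (\<Sum>j\<in>UNIV. d j * ((\<Sum>i\<in>UNIV. X $ Inl i $ Inl j * Y $ Inl i $ Inl j)
            + (\<Sum>r\<in>UNIV. X $ Inr r $ Inl j * Y $ Inr r $ Inl j)))"
    unfolding g_def 1 transpose_base_frame_mult matrix_mul_base_frame ..
  moreover have "(\<Sum>i\<in>UNIV. \<Sum>j\<in>UNIV. (e i j - 2 * d j) * X $ Inl i $ Inl j * Y $ Inl i $ Inl j)
      = (\<Sum>i\<in>UNIV. \<Sum>j\<in>UNIV. e i j * X $ Inl i $ Inl j * Y $ Inl i $ Inl j)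
        - (\<Sum>i\<in>UNIV. \<Sum>j\<in>UNIV. 2 * d j * X $ Inl i $ Inl j * Y $ Inl i $ Inl j)"
    by (simp add: left_diff_distrib sum_subtractf)
  moreover have "(\<Sum>j\<in>UNIV. d j * ((\<Sum>i\<in>UNIV. X $ Inl i $ Inl j * Y $ Inl i $ Inl j)
            + (\<Sum>r\<in>UNIV. X $ Inr r $ Inl j * Y $ Inr r $ Inl j)))
      = (\<Sum>j\<in>UNIV. d j * (\<Sum>i\<in>UNIV. X $ Inl i $ Inl j * Y $ Inl i $ Inl j))
        + (\<Sum>j\<in>UNIV. d j * (\<Sum>r\<in>UNIV. X $ Inr r $ Inl j * Y $ Inr r $ Inl j))"
    by (simp add: distrib_left sum.distrib)
  moreover have "(\<Sum>j\<in>UNIV. d j * (\<Sum>r\<in>UNIV. X $ Inr r $ Inl j * Y $ Inr r $ Inl j))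
      = (\<Sum>j\<in>UNIV. \<Sum>r\<in>UNIV. d j * X $ Inr r $ Inl j * Y $ Inr r $ Inl j)"
    by (simp add: sum_distrib_left mult.assoc)
  ultimately have "g base_frame (X ** base_frame) (Y ** base_frame)
      = (\<Sum>i\<in>UNIV. \<Sum>j\<in>UNIV. e i j * X $ Inl i $ Inl j * Y $ Inl i $ Inl j)
        + 2 * (\<Sum>j\<in>UNIV. \<Sum>r\<in>UNIV. d j * X $ Inr r $ Inl j * Y $ Inr r $ Inl j)"
    by (simp only: distrib_left)
  moreover have "form X Y = (\<Sum>i\<in>UNIV. \<Sum>j\<in>UNIV. e i j * X $ Inl i $ Inl j * Y $ Inl i $ Inl j)
       + (\<Sum>i\<in>UNIV. \<Sum>r\<in>UNIV. d i * X $ Inl i $ Inr r * Y $ Inl i $ Inr r)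
       + (\<Sum>r\<in>UNIV. \<Sum>i\<in>UNIV. d i * X $ Inr r $ Inl i * Y $ Inr r $ Inl i)"
    by (simp add: form_def matrix_inner sum_UNIV_sum sum.distrib)
  moreover have "X $ Inl i $ Inr r * Y $ Inl i $ Inr r = X $ Inr r $ Inl i * Y $ Inr r $ Inl i" for i r
    using skew_nth[OF X, of "Inl i" "Inr r"] skew_nth[OF Y, of "Inl i" "Inr r"] by simp
  then have "(\<Sum>i\<in>UNIV. \<Sum>r\<in>UNIV. d i * X $ Inl i $ Inr r * Y $ Inl i $ Inr r)
      = (\<Sum>j\<in>UNIV. \<Sum>r\<in>UNIV. d j * X $ Inr r $ Inl j * Y $ Inr r $ Inl j)"
    by (simp add: mult.assoc)
  moreover have "(\<Sum>r\<in>UNIV. \<Sum>i\<in>UNIV. d i * X $ Inr r $ Inl i * Y $ Inr r $ Inl i)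
      = (\<Sum>j\<in>UNIV. \<Sum>r\<in>UNIV. d j * X $ Inr r $ Inl j * Y $ Inr r $ Inl j)"
    by (rule sum.swap)
  ultimately show ?thesis by simp
qed

lemma tangent_iff: "X \<in> tangent \<longleftrightarrow> X \<in> skew \<and> (\<forall>r s. X $ Inr r $ Inr s = 0)"
  by (auto simp: tangent_def w_eq_0)

lemma gen_tangent:
  assumes "w a b \<noteq> 0"
  shows "gen a b \<in> tangent"
proof -
  have "gen a b $ c $ d = 0" if "w c d = 0" for c d
  proof -
    have ba: "w b a \<noteq> 0" using assms sym[of a b] by argo
    have "\<not> (c = a \<and> d = b)" using assms that by metis
    moreover have "\<not> (c = b \<and> d = a)" using ba that by metis
    ultimately show ?thesis by (simp only: gen_nth if_False diff_self)
  qed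
  then show ?thesis using gen_skew by (simp add: tangent_def)
qed

lemma tangent_base_0:
  assumes "X \<in> tangent" "X ** base_frame = 0"
  shows "X = 0"
proof -
  have l: "X $ a $ Inl j = 0" for a j
    using matrix_mul_base_frame[of X a j] assms(2) by simp
  have "X $ a $ b = 0" for a b
  proof (cases b)
    case (Inr s)
    then show ?thesis using l[of b] assms(1) skew_nth[of X a b]
      by (cases a) (auto simp: tangent_iff l)
  qed (simp add: l)
  then show ?thesis by (simp add: vec_eq_iff)
qed

lemma skew_base: "X \<in> skew \<Longrightarrow> X ** base_frame \<in> base_tangent"
  unfolding base_tangent_def mem_Collect_eq
  by (rule skewI, simp only: transpose_base_frame_mult matrix_mul_base_frame) (rule skew_nth)

lemma proj_base: "proj X ** base_frame = X ** base_frame"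
  by (simp add: vec_eq_iff matrix_mul_base_frame proj_def w_eq_0)

lemma base_lift:
  assumes V: "V \<in> base_tangent"
  obtains X where "X \<in> tangent" "X ** base_frame = V"
proof -
  define X :: "'m sqmat" where "X = (\<chi> a b. case b of
      Inl j \<Rightarrow> V $ a $ j | Inr s \<Rightarrow> (case a of Inl i \<Rightarrow> - V $ Inr s $ i | Inr r \<Rightarrow> 0))"
  have sk: "V $ Inl j $ i = - V $ Inl i $ j" for i j
    using V skew_nth[of "transpose base_frame ** V" j i] by (simp add: base_tangent_def transpose_base_frame_mult)
  have "X $ b $ a = - X $ a $ b" for a b
    by (cases a; cases b; simp add: X_def) (rule sk)
  then have "X \<in> skew" by (rule skewI)
  then have "X \<in> tangent" by (simp add: tangent_iff X_def)
  moreover have "X ** base_frame = V" by (simp add: vec_eq_iff matrix_mul_base_frame X_def)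
  ultimately show ?thesis by (rule that)
qed

lemma g_sym: "g A V W = g A W V"
proof -
  have "(transpose V ** W) $ j $ j = (transpose W ** V) $ j $ j" for j
    by (simp add: matrix_matrix_mult_def transpose_def mult.commute)
  then show ?thesis by (simp add: g_def mult_ac)
qed

lemma g_bilinear: "bilinear (g A)"
proof -
  have 1: "linear (\<lambda>V. g A V W)" for W
  proof (rule linearI)
    show "g A (V + V') W = g A V W + g A V' W" for V V'
      by (simp add: g_def mat_simps linear_add[OF linear_transpose] distrib_left distrib_right sum.distrib)
    show "g A (c *\<^sub>R V) W = c *\<^sub>R g A V W" for c V
    proof -
      have f1: "(e i j - 2 * d j) * (transpose A ** (c *\<^sub>R V)) $ i $ j * (transpose A ** W) $ i $ j
          = c * ((e i j - 2 * d j) * (transpose A ** V) $ i $ j * (transpose A ** W) $ i $ j)" for i j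
        by (simp add: mat_simps)
      have f2: "d j * (transpose (c *\<^sub>R V) ** W) $ j $ j = c * (d j * (transpose V ** W) $ j $ j)" for j
        by (simp add: mat_simps linear_cmul[OF linear_transpose])
      show ?thesis
        by (simp only: g_def f1 f2 sum_distrib_left[symmetric]) (simp add: distrib_left)
    qed
  qed
  moreover have "linear (\<lambda>W. g A V W)" for V
    unfolding g_sym[of A V] by (rule 1)
  ultimately show ?thesis by (simp add: bilinear_def)
qed

lemma scalar_product_g:
  assumes A: "A \<in> stiefel"
  shows "scalar_product_on (tangent_space stiefel A) (g A)"
  unfolding scalar_product_on_def
proof (intro conjI allI ballI impI)
  note b = g_bilinear[of A]
  have "linear (\<lambda>V. transpose A ** V)" by (rule linear_matrix_mult)
  then show "subspace (tangent_space stiefel A)"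
    unfolding tangent_space_stiefel[OF A] using linear_subspace_vimage[OF _ subspace_skew] by (auto simp: vimage_def)
  fix V W Z c
  show "g A V W = g A W V" by (rule g_sym)
  show "g A (V + W) Z = g A V Z + g A W Z" by (rule bilinear_ladd[OF b])
  show "g A (c *\<^sub>R V) Z = c * g A V Z" using bilinear_lmul[OF b] by simp
  assume V: "V \<in> tangent_space stiefel A" "V \<noteq> 0"
  obtain Q :: "'m sqmat" where Q: "transpose Q ** Q = mat 1" and AQ: "A = Q ** base_frame"
    using A by (rule stiefel_orthogonal)
  have "transpose base_frame ** (transpose Q ** V) = transpose A ** V"
    by (simp add: AQ matrix_transpose_mul matrix_mul_assoc)
  then have "transpose Q ** V \<in> base_tangent"
    using V(1) by (simp add: base_tangent_def tangent_space_stiefel[OF A])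
  then obtain X where X: "X \<in> tangent" "X ** base_frame = transpose Q ** V" by (rule base_lift)
  have VX: "V = Q ** (X ** base_frame)" by (simp add: X matrix_mul_assoc orthogonal_both[OF Q])
  then have "X \<noteq> 0" using V(2) by (auto simp: mat_simps)
  moreover have "g A V V = form X X"
    unfolding AQ VX g_orthogonal[OF Q] using X(1) by (simp add: g_base tangent_def)
  ultimately show "g A V V > 0" using form_pos[OF X(1)] by simp
qed

lemma SO_invariant_g: "SO_invariant g"
  unfolding SO_invariant_def by (auto simp: rotation_matrix_def orthogonal_matrix g_orthogonal)

lemma smooth_g:
  fixes \<phi> V W :: "real ^ 'd::finite \<Rightarrow> 'm frame"
  assumes U: "open U" and s: "smooth_on U \<phi>" "smooth_on U V" "smooth_on U W"
  shows "smooth_on U (\<lambda>u. g (\<phi> u) (V u) (W u))"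
proof -
  have e: "smooth_on U (\<lambda>u. (transpose (X u) ** Y u) $ i $ j)" if "smooth_on U X" "smooth_on U Y"
    for X Y :: "real ^ 'd \<Rightarrow> 'm frame" and i j
    by (intro smooth_on_entry smooth_on_matrix_mult smooth_on_linear[OF U linear_transpose that(1)] that U)
  show ?thesis
    unfolding g_def by (intro smooth_on_add smooth_on_sum smooth_on_mult smooth_on_const e s U)
qed

lemma riemannian_g: "riemannian_metric TYPE(6 + 4 \<times> 'm) stiefel g"
  unfolding riemannian_metric_def
proof (intro conjI ballI allI impI)
  show "submanifold TYPE(6 + 4 \<times> 'm) (stiefel :: 'm frame set)" by (rule submanifold_stiefel)
  show "scalar_product_on (tangent_space stiefel A) (g A)" if "A \<in> stiefel" for A
    using that by (rule scalar_product_g)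
  fix U and \<phi> :: "real ^ (6 + 4 \<times> 'm) \<Rightarrow> 'm frame" and i j
  assume "local_param stiefel U \<phi>"
  then have "open U" "smooth_on U \<phi>" by (auto simp: local_param_def)
  then show "smooth_on U (\<lambda>u. coord_metric \<phi> g u $ i $ j)"
    by (simp add: coord_metric_def smooth_g smooth_on_partial)
qed

text \<open>
  The lift \<open>Q\<close> of the parametrization supplies the data for \<open>ricci_of_frame\<close>. That the forms \<open>proj (\<omega> k)\<close> form
  a basis of the tangent space follows from the injectivity of the derivative of \<open>\<phi>\<close> and a count of
  dimensions through the coordinates \<open>of_tangent\<close>.
\<close>

lemma ricci_g:
  fixes \<phi> :: "real ^ (6 + 4 \<times> 'm) \<Rightarrow> 'm frame"
  assumes k: "\<And>b c. b \<noteq> c \<Longrightarrow> w b c \<noteq> 0 \<Longrightarrow> ricci_weight b c = 2 * k * w b c"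
    and \<phi>: "local_param stiefel U \<phi>" and u: "u \<in> U"
  shows "ricci (coord_metric \<phi> g) i j u = k * coord_metric \<phi> g u $ i $ j"
proof -
  have U: "open U" and s: "smooth_on U \<phi>" and inj: "\<And>u. u \<in> U \<Longrightarrow> inj (frechet_derivative \<phi> (at u))"
    and st: "\<And>u. u \<in> U \<Longrightarrow> \<phi> u \<in> stiefel"
    using \<phi> openin_imp_subset unfolding local_param_def by blast+
  obtain V and Q :: "real ^ (6 + 4 \<times> 'm) \<Rightarrow> 'm sqmat" where V: "open V" "u \<in> V" "V \<subseteq> U" and sQ: "smooth_on V Q"
    and Q: "\<And>u. u \<in> V \<Longrightarrow> transpose (Q u) ** Q u = mat 1" and \<phi>Q: "\<And>u. u \<in> V \<Longrightarrow> \<phi> u = Q u ** base_frame"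
    using moving_frame[OF U s st u] by metis
  define \<omega> where "\<omega> i u = transpose (Q u) ** partial i Q u" for i u
  have "\<forall>u\<in>V. transpose (Q u) ** Q u = mat 1" using Q by blast
  note MC = maurer_cartan[OF V(1) sQ this, folded \<omega>_def]
  have d\<phi>: "partial i \<phi> v = Q v ** (proj (\<omega> i v) ** base_frame)" if v: "v \<in> V" for i v
  proof -
    have "partial i \<phi> v = partial i (\<lambda>u. Q u ** base_frame) v"
      using V(3) v by (intro partial_cong_open[OF smooth_on_differentiable[OF U s] V(1) v \<phi>Q]) auto
    also have "\<dots> = partial i Q v ** base_frame"
      by (rule partial_linear[OF linear_matrix_mult_right smooth_on_differentiable[OF V(1) sQ v]])
    finally show ?thesis by (simp add: proj_base MC(5)[OF v] matrix_mul_assoc)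
  qed
  have pt: "proj (\<omega> i v) \<in> tangent" if "v \<in> V" for i v
    by (rule proj_in_tangent[OF MC(2)[OF that]])
  have G: "coord_metric \<phi> g v $ i $ j = form (proj (\<omega> i v)) (proj (\<omega> j v))" if v: "v \<in> V" for v i j
    unfolding coord_metric_def vec_lambda_beta d\<phi>[OF v] \<phi>Q[OF v] g_orthogonal[OF Q[OF v]]
    using pt[OF v] by (simp add: g_base tangent_def)
  have ind: "c = 0" if v: "v \<in> V" and c: "(\<Sum>k\<in>UNIV. c $ k *\<^sub>R proj (\<omega> k v)) = 0"
    for v and c :: "real ^ (6 + 4 \<times> 'm)"
  proof -
    have lin: "linear (\<lambda>X. Q v ** (X ** base_frame))"
      using linear_compose[OF linear_matrix_mult_right linear_matrix_mult] by (simp add: o_def)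
    have dv: "\<phi> differentiable at v" using V(3) v smooth_on_differentiable[OF U s] by blast
    have "frechet_derivative \<phi> (at v) c = Q v ** ((\<Sum>k\<in>UNIV. c $ k *\<^sub>R proj (\<omega> k v)) ** base_frame)"
      unfolding frechet_derivative_partials[OF dv] d\<phi>[OF v] by (simp add: linear_sum[OF lin] linear_cmul[OF lin])
    then have "frechet_derivative \<phi> (at v) c = 0" using c by (simp add: mat_simps)
    moreover have "inj (frechet_derivative \<phi> (at v))" using inj V(3) v by blast
    ultimately show "c = 0" using linear_injective_0[OF linear_frechet_derivative[OF dv]] by blast
  qed
  have spn: "\<exists>c :: real ^ (6 + 4 \<times> 'm). X = (\<Sum>k\<in>UNIV. c $ k *\<^sub>R proj (\<omega> k v))" if v: "v \<in> V" and X: "X \<in> tangent" for v X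
  proof -
    let ?f = "\<lambda>c :: real ^ (6 + 4 \<times> 'm). \<Sum>k\<in>UNIV. c $ k *\<^sub>R proj (\<omega> k v)"
    let ?h = "\<lambda>X :: 'm sqmat. of_tangent (X ** base_frame)"
    have lf: "linear ?f" by (rule linearI) (simp_all add: algebra_simps sum.distrib scaleR_sum_right)
    have lh: "linear ?h" using linear_compose[OF linear_matrix_mult_right linear_of_tangent] by (simp add: o_def)
    have ft: "?f c \<in> tangent" for c
      using pt[OF v] by (intro subspace_sum[OF subspace_tangent] subspace_scale[OF subspace_tangent])
    have h0: "X = 0" if "X \<in> tangent" "?h X = 0" for X
    proof -
      have "X ** base_frame \<in> base_tangent" using that(1) by (intro skew_base) (simp add: tangent_def)
      then have "X ** base_frame = to_tangent (?h X)" by (simp add: to_of_tangent)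
      then have "X ** base_frame = 0" using that(2) to_tangent_0 by simp
      then show ?thesis using tangent_base_0 that(1) by blast
    qed
    have l: "linear (\<lambda>c. ?h (?f c))" using linear_compose[OF lf lh] by (simp add: o_def)
    have "c = 0" if "?h (?f c) = 0" for c
      using h0[OF ft that] ind[OF v] by blast
    then have "inj (\<lambda>c. ?h (?f c))" using linear_injective_0[OF l] by blast
    then have "surj (\<lambda>c. ?h (?f c))" by (rule linear_inj_imp_surj[OF l])
    from surjD[OF this, of "?h X"] obtain c where "?h X = ?h (?f c)" by blast
    then have "?h (X - ?f c) = 0" by (simp add: linear_diff[OF lh])
    moreover have "X - ?f c \<in> tangent" by (rule subspace_diff[OF subspace_tangent X ft])
    ultimately have "X - ?f c = 0" using h0 by blast
    then show ?thesis by (intro exI[of _ c]) simp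
  qed
  have "ricci (coord_metric \<phi> g) i j u =
      (\<Sum>p\<in>{(a, b). w a b \<noteq> 0}. (\<lambda>(a, b) X. (1 / 2) * X $ a $ b) p (curv ((\<lambda>(a, b). gen a b) p) (proj (\<omega> j u)) (proj (\<omega> i u))))"
  proof (rule ricci_of_frame[OF V(1) MC(1) MC(2) MC(3) MC(4) ind spn G V(2)])
    show "(\<lambda>(a, b). gen a b) p \<in> tangent" if "p \<in> {(a, b). w a b \<noteq> 0}" for p
      using that gen_tangent by (cases p) simp
    show "linear ((\<lambda>(a, b) X. (1 / 2) * X $ a $ b) p :: 'm sqmat \<Rightarrow> real)" for p :: "(4 + 'm) \<times> (4 + 'm)"
      by (cases p) (auto intro!: linearI simp: algebra_simps)
    show "X = (\<Sum>p\<in>{(a, b). w a b \<noteq> 0}. (\<lambda>(a, b) X. (1 / 2) * X $ a $ b) p X *\<^sub>R (\<lambda>(a, b). gen a b) p)"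
      if "X \<in> tangent" for X
      using expand_in_generators[OF that] by (simp add: case_prod_beta')
    show "comm X Y \<in> skew" if "X \<in> skew" "Y \<in> skew" for X Y :: "'m sqmat"
      using that by (rule comm_skew)
  qed simp_all
  also have "\<dots> = (\<Sum>(a, b) | w a b \<noteq> 0. (1 / 2) * curv (gen a b) (proj (\<omega> j u)) (proj (\<omega> i u)) $ a $ b)"
    by (simp add: case_prod_beta')
  also have "\<dots> = k * form (proj (\<omega> j u)) (proj (\<omega> i u))"
    by (rule einstein_trace[OF k pt[OF V(2)] pt[OF V(2)]])
  also have "\<dots> = k * coord_metric \<phi> g u $ i $ j"
    by (simp add: G[OF V(2)] b_sym)
  finally show ?thesis .
qed

corollary einstein_g:
  assumes "\<And>b c. b \<noteq> c \<Longrightarrow> w b c \<noteq> 0 \<Longrightarrow> ricci_weight b c = 2 * k * w b c"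
  shows "einstein_metric TYPE(6 + 4 \<times> 'm) stiefel g"
  unfolding einstein_metric_def using riemannian_g ricci_g[OF assms] by blast

end

section \<open>Solving the Einstein equations\<close>

text \<open>
  A fixed point of \<open>z \<mapsto> z - (f z, g z)\<close>, truncated to the box, cannot lie on a side, where the signs push it
  inwards; in the interior it is a common zero.
\<close>

lemma poincare_miranda:
  fixes f g :: "real \<times> real \<Rightarrow> real"
  assumes ab: "a < b" and cd: "c < d"
    and cf: "continuous_on (cbox (a, c) (b, d)) f" and cg: "continuous_on (cbox (a, c) (b, d)) g"
    and f: "\<And>t. c \<le> t \<Longrightarrow> t \<le> d \<Longrightarrow> f (a, t) < 0" "\<And>t. c \<le> t \<Longrightarrow> t \<le> d \<Longrightarrow> f (b, t) > 0"
    and g: "\<And>s. a \<le> s \<Longrightarrow> s \<le> b \<Longrightarrow> g (s, c) < 0" "\<And>s. a \<le> s \<Longrightarrow> s \<le> b \<Longrightarrow> g (s, d) > 0"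
  obtains s t where "a \<le> s" "s \<le> b" "c \<le> t" "t \<le> d" "f (s, t) = 0" "g (s, t) = 0"
proof -
  let ?S = "cbox (a, c) (b, d)"
  define F where "F z = (max a (min b (fst z - f z)), max c (min d (snd z - g z)))" for z
  have mem: "z \<in> ?S \<longleftrightarrow> a \<le> fst z \<and> fst z \<le> b \<and> c \<le> snd z \<and> snd z \<le> d" for z
    by (cases z) (auto simp: cbox_Pair_eq)
  have cF: "continuous_on ?S F"
    unfolding F_def by (intro continuous_intros cf cg)
  have im: "F \<in> ?S \<rightarrow> ?S"
    using ab cd by (auto simp: mem F_def)
  have "(a, c) \<in> ?S" unfolding mem using ab cd by simp
  then have ne: "?S \<noteq> {}" by blast
  obtain z where z: "z \<in> ?S" "F z = z"
    by (rule brouwer[OF compact_cbox convex_box(1) ne cF im])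
  obtain s t where st: "z = (s, t)" by (cases z)
  have box: "a \<le> s" "s \<le> b" "c \<le> t" "t \<le> d" using z(1) by (auto simp: mem st)
  have fix1: "max a (min b (s - f (s, t))) = s" and fix2: "max c (min d (t - g (s, t))) = t"
    using z(2) by (auto simp: F_def st)
  have "f (s, t) = 0"
  proof (rule ccontr)
    assume "f (s, t) \<noteq> 0"
    then have "s = a \<or> s = b" using fix1 by (auto simp: max_def min_def split: if_splits)
    then show False using fix1 f[OF box(3,4)] ab by (auto simp: max_def min_def split: if_splits)
  qed
  moreover have "g (s, t) = 0"
  proof (rule ccontr)
    assume "g (s, t) \<noteq> 0"
    then have "t = c \<or> t = d" using fix2 by (auto simp: max_def min_def split: if_splits)
    then show False using fix2 g[OF box(1,2)] cd by (auto simp: max_def min_def split: if_splits)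
  qed
  ultimately show ?thesis using that box by blast
qed

text \<open>
  With \<open>x\<^sub>2\<^sub>3 = 1\<close>, \<open>y = x\<^sub>1\<^sub>2\<close>, \<open>p = x\<^sub>1\<^sub>3 = 1 + w\<close> and \<open>m = n - 4\<close>, the difference of the third and \<open>p\<close> times the
  fourth of the equations \<open>einstein_eqs\<close> below is linear in \<open>x = x\<^sub>2\<close> and free of the Einstein constant. It says
  that \<open>p x y\<close> equals \<open>pxy m y w\<close>.
\<close>

definition pxy :: "real \<Rightarrow> real \<Rightarrow> real \<Rightarrow> real" where
  "pxy m y w = y\<^sup>2 + w * ((m + 2) * y - 4 - 2 * w)"

text \<open>
  After elimination of \<open>x\<close> and of the Einstein constant by the third and fourth equation, \<open>G2 = 0\<close> is the second
  equation. The first equation minus \<open>x / y\<close> times the second is a multiple of \<open>w G1\<close>; the factor \<open>w\<close>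
  accounts for Jensen's solutions.
\<close>

definition G1 :: "real \<Rightarrow> real \<Rightarrow> real \<Rightarrow> real" where
  "G1 m y w = m * y\<^sup>2 * pxy m y w * ((m + 2) * y - 4 - w)
     - ((m + 2) * y - 4 - 2 * w - y\<^sup>2) * ((1 + w) * y\<^sup>2 - 3 * pxy m y w)"

definition G2 :: "real \<Rightarrow> real \<Rightarrow> real \<Rightarrow> real" where
  "G2 m y w = y\<^sup>2 * ((m + 3) * y\<^sup>2 - 2 * (m + 2) * y + 2) + 2 * (4 - (m + 2) * y - y\<^sup>2) * w + (4 - (m + 3) * y\<^sup>2) * w\<^sup>2"

text \<open>
  The Ricci tensor on \<open>\<s>\<o>(3)\<close>, \<open>\<m>\<^sub>1\<^sub>2\<close>, \<open>\<m>\<^sub>1\<^sub>3\<close>, \<open>\<m>\<^sub>2\<^sub>3\<close> equals \<open>l\<close> times the metric, for the weights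
  \<open>x\<close>, \<open>y\<close>, \<open>p\<close>, \<open>1\<close>. An index triple whose edges have weights \<open>s, t, r\<close> contributes
  \<open>(r\<^sup>2 - (s - t)\<^sup>2) / (2 s t)\<close> to the edge of weight \<open>r\<close>.
\<close>

definition einstein_eqs :: "real \<Rightarrow> real \<Rightarrow> real \<Rightarrow> real \<Rightarrow> real \<Rightarrow> bool" where
  "einstein_eqs m x y p l \<longleftrightarrow>
     1 / 2 + x\<^sup>2 / (2 * y\<^sup>2) + m * (x\<^sup>2 / 2) = l * x \<and>
     2 - x / y + m * ((y\<^sup>2 - (p - 1)\<^sup>2) / (2 * p)) = l * y \<and>
     3 * ((p\<^sup>2 - (y - 1)\<^sup>2) / (2 * y)) + (m - 1) = l * p \<and>
     (1 - (y - p)\<^sup>2) / (2 * y * p) + (2 - x) + (m - 1) = l"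

lemma einstein_eqs_of_zero:
  fixes m y w :: real
  assumes y: "y > 0" and w: "w \<noteq> 0" and p: "1 + w > 0" and X: "pxy m y w \<noteq> 0" and 1: "G1 m y w = 0" and 2: "G2 m y w = 0"
  shows "\<exists>l. einstein_eqs m (pxy m y w / ((1 + w) * y)) y (1 + w) l"
proof -
  define p where "p = 1 + w"
  have w': "w = p - 1" and p0: "p > 0" "p \<noteq> 1" using p w by (auto simp: p_def)
  define x where "x = pxy m y w / (p * y)"
  have xX: "pxy m y w = p * x * y" using y p0 by (simp add: x_def)
  have x: "p * x * y = y\<^sup>2 + (p - 1) * ((m + 2) * y - 2 - 2 * p)"
    unfolding xX[symmetric] unfolding pxy_def w' by algebra
  define l where "l = (1 - (y - p)\<^sup>2) / (2 * y * p) + (2 - x) + (m - 1)"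
  have l: "2 * y * p * l = 1 - (y - p)\<^sup>2 + 2 * y * p * (m + 1 - x)"
    using y p0 by (simp add: l_def field_simps)
  have E3: "3 * (p\<^sup>2 - (y - 1)\<^sup>2) + 2 * y * (m - 1) = 2 * y * p * l"
    unfolding l using x by algebra
  have E2: "4 * p * y - 2 * p * x + m * y * (y\<^sup>2 - (p - 1)\<^sup>2) = 2 * p * y\<^sup>2 * l"
  proof -
    have "y * (4 * p * y - 2 * p * x + m * y * (y\<^sup>2 - (p - 1)\<^sup>2) - 2 * p * y\<^sup>2 * l) = G2 m y w"
      using x l unfolding G2_def w' by algebra
    then show ?thesis using 2 y by simp
  qed
  have E1: "y\<^sup>2 + x\<^sup>2 + m * x\<^sup>2 * y\<^sup>2 = 2 * y\<^sup>2 * x * l"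
  proof -
    have "p * y\<^sup>2 * (p * (y\<^sup>2 + x\<^sup>2 + m * x\<^sup>2 * y\<^sup>2 - 2 * y\<^sup>2 * x * l)) = (p - 1) * G1 m y w"
      using x E2 unfolding G1_def xX unfolding w' by algebra
    then show ?thesis using 1 y p0 by simp
  qed
  have "einstein_eqs m x y p l"
    unfolding einstein_eqs_def
  proof (intro conjI)
    show "1 / 2 + x\<^sup>2 / (2 * y\<^sup>2) + m * (x\<^sup>2 / 2) = l * x"
      using E1 y by (simp add: field_simps)
    have "2 - x / y + m * ((y\<^sup>2 - (p - 1)\<^sup>2) / (2 * p)) = (4 * p * y - 2 * p * x + m * y * (y\<^sup>2 - (p - 1)\<^sup>2)) / (2 * p * y)"
      using y p0 by (simp add: divide_simps) (simp add: algebra_simps)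
    also have "\<dots> = l * y"
      unfolding E2 using y p0 by (simp add: divide_simps power2_eq_square)
    finally show "2 - x / y + m * ((y\<^sup>2 - (p - 1)\<^sup>2) / (2 * p)) = l * y" .
    have "3 * ((p\<^sup>2 - (y - 1)\<^sup>2) / (2 * y)) + (m - 1) = (3 * (p\<^sup>2 - (y - 1)\<^sup>2) + 2 * y * (m - 1)) / (2 * y)"
      using y by (simp add: divide_simps)
    also have "\<dots> = l * p"
      unfolding E3 using y by (simp add: divide_simps)
    finally show "3 * ((p\<^sup>2 - (y - 1)\<^sup>2) / (2 * y)) + (m - 1) = l * p" .
  qed (simp add: l_def)
  then show ?thesis unfolding x_def p_def by blast
qed

lemma jensen_eqs:
  assumes x: "x > 0" and e: "(m + 3) * x\<^sup>2 - 2 * (m + 2) * x + 2 = 0"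
  shows "einstein_eqs m x x 1 (m + 2 - 3 * x / 2)"
proof -
  have "x * (1 / 2 + x\<^sup>2 / (2 * x\<^sup>2) + m * (x\<^sup>2 / 2)) = x * ((m + 2 - 3 * x / 2) * x)"
    using x e by (simp add: field_simps) algebra
  then show ?thesis
    using x e by (simp add: einstein_eqs_def field_simps) algebra
qed

text \<open>
  With \<open>K = (m + 2) y - 4 - 2 w - y\<^sup>2\<close> and \<open>L = (m + 2) y - 4 - w\<close>, \<open>G1\<close> is
  \<open>m y\<^sup>2 pxy L - K ((1 + w) y\<^sup>2 - 3 pxy)\<close>. If \<open>0 < K \<le> L\<close>, its sign is decided by bounds on the quadratic
  polynomial \<open>pxy\<close> alone; this lemma and the next replace sign estimates of \<open>G1\<close> itself.
\<close>

lemma G1_pos: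
  assumes m: "m \<ge> 0" and K: "0 < (m + 2) * y - 4 - 2 * w - y\<^sup>2" and w: "- w \<le> y\<^sup>2"
    and X: "pxy m y w > 0" "1 + w \<le> m * pxy m y w"
  shows "G1 m y w > 0"
proof -
  let ?K = "(m + 2) * y - 4 - 2 * w - y\<^sup>2" and ?L = "(m + 2) * y - 4 - w"
  have "?K * ((1 + w) * y\<^sup>2) \<le> ?K * (m * pxy m y w * y\<^sup>2)"
    using K X by (intro mult_left_mono mult_right_mono) auto
  also have "\<dots> \<le> ?L * (m * pxy m y w * y\<^sup>2)"
    using w m X by (intro mult_right_mono) auto
  finally have "?K * ((1 + w) * y\<^sup>2) \<le> m * y\<^sup>2 * pxy m y w * ?L" by (simp add: mult_ac)
  moreover have "?K * pxy m y w > 0" using K X by simp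
  moreover have "G1 m y w = m * y\<^sup>2 * pxy m y w * ?L - ?K * ((1 + w) * y\<^sup>2) + 3 * (?K * pxy m y w)"
    unfolding G1_def by algebra
  ultimately show ?thesis by linarith
qed

lemma G1_neg:
  assumes m: "m \<ge> 0" and K: "0 < (m + 2) * y - 4 - 2 * w - y\<^sup>2" and w: "- w \<le> y\<^sup>2" "1 + w > 0" and y: "y > 0"
    and X: "pxy m y w \<le> 0"
  shows "G1 m y w < 0"
proof -
  let ?K = "(m + 2) * y - 4 - 2 * w - y\<^sup>2" and ?L = "(m + 2) * y - 4 - w"
  have "m * y\<^sup>2 * ?L * pxy m y w \<le> 0"
    using m K w X by (intro mult_nonneg_nonpos mult_nonneg_nonneg) auto
  moreover have "0 < ?K * ((1 + w) * y\<^sup>2 - 3 * pxy m y w)"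
  proof (rule mult_pos_pos[OF K])
    have "0 < (1 + w) * y\<^sup>2" using w(2) y by simp
    then show "0 < (1 + w) * y\<^sup>2 - 3 * pxy m y w" using X by linarith
  qed
  moreover have "G1 m y w = m * y\<^sup>2 * ?L * pxy m y w - ?K * ((1 + w) * y\<^sup>2 - 3 * pxy m y w)"
    unfolding G1_def by algebra
  ultimately show ?thesis by linarith
qed

text \<open>
  Hence the weight \<open>x\<close> belonging to a common zero is automatically positive.
\<close>

lemma pxy_pos_of_zero:
  assumes m: "m \<ge> 0" and K: "0 < (m + 2) * y - 4 - 2 * w - y\<^sup>2" and w: "- w \<le> y\<^sup>2" "1 + w > 0" and y: "y > 0"
    and G: "G1 m y w = 0"
  shows "pxy m y w > 0"
  using G1_neg[OF m K w y] G by linarith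

lemma cont_G:
  assumes "continuous_on S f" "continuous_on S h"
  shows "continuous_on S (\<lambda>z. G1 m (f z) (h z))" "continuous_on S (\<lambda>z. G2 m (f z) (h z))"
  unfolding G1_def G2_def pxy_def by (intro continuous_intros assms)+

text \<open>
  The solution is close to \<open>y = 1.027\<close>, \<open>w = - 0.683\<close>. Along the side \<open>y = 1\<close> one has \<open>G2 = - (1 + w)\<^sup>2\<close>.
  The box used for larger \<open>m\<close> does not separate the signs when \<open>m = 2\<close>.
\<close>

lemma second_family_2:
  obtains y w where "y > 0" "-1 < w" "w < 0" "pxy 2 y w > 0" "G1 2 y w = 0" "G2 2 y w = 0"
proof -
  have c: "continuous_on S (\<lambda>z :: real \<times> real. G1 2 (fst z) (snd z))" "continuous_on S (\<lambda>z :: real \<times> real. G2 2 (fst z) (snd z))" for S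
    by (intro cont_G continuous_intros)+
  have K: "0 < (2 + 2) * y - 4 - 2 * w - y\<^sup>2" "- w \<le> y\<^sup>2" if y: "1 \<le> y" "y \<le> 11/10" and w: "-18/25 \<le> w" "w \<le> -3/5" for y w :: real
  proof -
    have "0 \<le> (y - 1) * (3 - y)" using y by (intro mult_nonneg_nonneg) auto
    then show "0 < (2 + 2) * y - 4 - 2 * w - y\<^sup>2" using w by (simp add: algebra_simps power2_eq_square)
    have "1 \<le> y * y" using mult_mono[of 1 y 1 y] y by simp
    then show "- w \<le> y\<^sup>2" using w by (simp add: power2_eq_square)
  qed
  obtain y w :: real where b: "1 \<le> y" "y \<le> 11/10" "-18/25 \<le> w" "w \<le> -3/5"
    and z: "G2 2 y w = 0" "G1 2 y w = 0"
  proof (rule poincare_miranda[of 1 "11/10" "-18/25" "-3/5" "\<lambda>z. G2 2 (fst z) (snd z)" "\<lambda>z. G1 2 (fst z) (snd z)"])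
    show "G2 2 (fst (1 :: real, w)) (snd (1 :: real, w)) < 0" if "-18/25 \<le> w" "w \<le> -3/5" for w :: real
    proof -
      have "G2 2 1 w = - (1 + w)\<^sup>2" by (simp add: G2_def power2_eq_square algebra_simps)
      then show ?thesis using that by simp
    qed
    show "G2 2 (fst (11/10 :: real, w)) (snd (11/10 :: real, w)) > 0" if "-18/25 \<le> w" "w \<le> -3/5" for w :: real
    proof -
      have "0 \<le> (w + 18/25) * (- 3/5 - w)" using that by (intro mult_nonneg_nonneg) auto
      then show ?thesis using that by (simp add: G2_def power2_eq_square algebra_simps)
    qed
    show "G1 2 (fst (y, -18/25 :: real)) (snd (y, -18/25)) < 0" if y: "1 \<le> y" "y \<le> 11/10" for y :: real
    proof -
      define q where "q = (y - 1) * (11/10 - y)"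
      have "0 \<le> q" unfolding q_def using y by (intro mult_nonneg_nonneg) auto
      moreover define v where "v = pxy 2 y (-18/25)"
      moreover have "v = - q - 39/50 * (y - 1) - 23/625"
        unfolding v_def pxy_def q_def by algebra
      ultimately have "v \<le> 0" using y by argo
      then have "pxy 2 y (-18/25) \<le> 0" by (simp add: v_def)
      then show ?thesis using G1_neg[of 2 y "-18/25"] K[of y "-18/25"] y by simp
    qed
    show "G1 2 (fst (y, -3/5 :: real)) (snd (y, -3/5)) > 0" if y: "1 \<le> y" "y \<le> 11/10" for y :: real
    proof -
      have "0 \<le> (11/10 - y) * (13/10 - y)" using y by (intro mult_nonneg_nonneg) auto
      then have "1 - 3/5 \<le> 2 * pxy 2 y (-3/5)" using y by (simp add: pxy_def power2_eq_square algebra_simps)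
      then show ?thesis using G1_pos[of 2 y "-3/5"] K[of y "-3/5"] y by simp
    qed
  qed (auto intro: c)
  show ?thesis
    using that[of y w] b z K[OF b] pxy_pos_of_zero[of 2 y w] by simp
qed

text \<open>
  As \<open>m\<close> grows, the solution behaves like \<open>y = 2 - 4 / m\<close>, \<open>w = - 2 / m\<close>. In terms of \<open>r = 1 / (m + 1)\<close> the
  sides of the box are linear in \<open>r\<close>, and because of \<open>m r = 1 - r\<close> all estimates are polynomial inequalities
  on \<open>0 < r \<le> 1/4\<close>.
\<close>

lemma second_family_ge3:
  assumes m: "m \<ge> 3"
  obtains y w where "y > 0" "-1 < w" "w < 0" "pxy m y w > 0" "G1 m y w = 0" "G2 m y w = 0"
proof -
  define r where "r = 1 / (m + 1)"
  have r: "0 < r" "r \<le> 1/4" using m by (auto simp: r_def field_simps)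
  have mr: "m * r = 1 - r" using m by (simp add: r_def field_simps)
  have rr: "0 \<le> r * (1 - 4 * r)" using r by (intro mult_nonneg_nonneg) auto
  have rr2: "0 \<le> r\<^sup>2 * (1 - 4 * r)" using r by (intro mult_nonneg_nonneg) auto
  define a b where "a = 2 - 9/2 * r" and "b = 2 - 2 * r"
  have c: "continuous_on S (\<lambda>z :: real \<times> real. G1 m (fst z) (snd z))" "continuous_on S (\<lambda>z :: real \<times> real. G2 m (fst z) (snd z))" for S
    by (intro cont_G continuous_intros)+
  have box: "7/8 \<le> y" "y \<le> 2" "- 5/8 \<le> w" "w < 0" "- w \<le> y\<^sup>2" "0 < (m + 2) * y - 4 - 2 * w - y\<^sup>2"
    if y: "a \<le> y" "y \<le> b" and w: "- (5/2) * r \<le> w" "w \<le> - (3/2) * r" for y w :: real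
  proof -
    show y': "7/8 \<le> y" "y \<le> 2" and w': "- 5/8 \<le> w" "w < 0" using y w r by (auto simp: a_def b_def)
    show "- w \<le> y\<^sup>2" using w' power_mono[of "7/8" y 2] y' by (simp add: power2_eq_square)
    have "0 \<le> (y - a) * (1 + r - r * (y + a))"
    proof (intro mult_nonneg_nonneg)
      have "r * (y + a) \<le> r * 4" using r y' by (intro mult_left_mono) (auto simp: a_def)
      then show "0 \<le> 1 + r - r * (y + a)" using r by linarith
    qed (use y in simp)
    moreover have "0 < (1 + r) * a - r * a\<^sup>2 - 4 * r + 3 * r\<^sup>2"
    proof -
      have "0 \<le> (1 - 4 * r) * (2 - 5/2 * r)" using r by (intro mult_nonneg_nonneg) auto
      moreover have "(1 + r) * a - r * a\<^sup>2 - 4 * r + 3 * r\<^sup>2 = (1 - 4 * r) * (2 - 5/2 * r) + 23/16 * r\<^sup>2 + 81/16 * (r\<^sup>2 * (1 - 4 * r))"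
        unfolding a_def by algebra
      moreover have "0 < r\<^sup>2" using r by simp
      ultimately show ?thesis using rr2 by linarith
    qed
    moreover have "0 \<le> r * (- (3/2) * r - w)" using w r by (intro mult_nonneg_nonneg) auto
    moreover have "r * ((m + 2) * y - 4 - 2 * w - y\<^sup>2) = (y - a) * (1 + r - r * (y + a)) + ((1 + r) * a - r * a\<^sup>2 - 4 * r + 3 * r\<^sup>2)
       + 2 * (r * (- (3/2) * r - w))"
      using mr by algebra
    ultimately have "0 < r * ((m + 2) * y - 4 - 2 * w - y\<^sup>2)" by linarith
    then show "0 < (m + 2) * y - 4 - 2 * w - y\<^sup>2" using r by (simp add: zero_less_mult_iff)
  qed
  \<comment> \<open>Polynomials that are positive on \<open>[0, 1/4]\<close> are written in the Bernstein basis \<open>u\<^sup>i r\<^sup>j\<close>, where their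
    coefficients turn out to have one sign.\<close>
  define u where "u = 1 - 4 * r"
  have u: "u \<ge> 0" using r by (simp add: u_def)
  have G2a: "G2 m a w < 0" if w: "- (5/2) * r \<le> w" "w \<le> - (3/2) * r" for w
  proof -
    define t where "t = - w / r"
    have t: "w = - t * r" "3/2 \<le> t" "t \<le> 5/2" using w r by (auto simp: t_def field_simps)
    define B C where "B = 2 * ((1 + r) * a + r * a\<^sup>2 - 4 * r)" and "C = r * ((1 + 2 * r) * a\<^sup>2 - 4 * r)"
    have "r * G2 m a (- t * r) = r * (a\<^sup>2 * (- 3 - 27/4 * r + 81/2 * r\<^sup>2) + B * t - C * t\<^sup>2)"
      unfolding G2_def B_def C_def a_def using mr by algebra
    then have G: "G2 m a w = a\<^sup>2 * (- 3 - 27/4 * r + 81/2 * r\<^sup>2) + B * t - C * t\<^sup>2"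
      using r t(1) by simp
    have C: "C = r * (4 * u ^ 3 + 34 * (u ^ 2 * r) + 257/4 * (u * r ^ 2) + 19/2 * r ^ 3)"
      unfolding C_def a_def u_def by algebra
    have "C \<ge> 0" unfolding C using u r by (intro mult_nonneg_nonneg add_nonneg_nonneg) auto
    have "B - 5 * C = 4 * u ^ 4 + 39 * (u ^ 3 * r) + 109 * (u ^ 2 * r ^ 2) + 573/4 * (u * r ^ 3) + 197/2 * r ^ 4"
      unfolding B_def C_def a_def u_def by algebra
    moreover have "\<dots> \<ge> 0" using u r by (intro mult_nonneg_nonneg add_nonneg_nonneg) auto
    moreover have "C * (5/2 + t) \<le> C * 5" using \<open>C \<ge> 0\<close> t by (intro mult_left_mono) auto
    ultimately have "0 \<le> (5/2 - t) * (B - C * (5/2 + t))" using t by (intro mult_nonneg_nonneg) auto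
    moreover have "a\<^sup>2 * (- 3 - 27/4 * r + 81/2 * r\<^sup>2) + B * (5/2) - C * (5/2)\<^sup>2
        = - (2 * u ^ 4 + 85/2 * (u ^ 3 * r) + 481/4 * (u ^ 2 * r ^ 2) + 100 * (u * r ^ 3) + 117 * r ^ 4)"
      unfolding B_def C_def a_def u_def by algebra
    moreover have "0 < 2 * u ^ 4 + 85/2 * (u ^ 3 * r) + 481/4 * (u ^ 2 * r ^ 2) + 100 * (u * r ^ 3) + 117 * r ^ 4"
      using u r by (intro add_nonneg_pos mult_nonneg_nonneg add_nonneg_nonneg) auto
    moreover have "G2 m a w = a\<^sup>2 * (- 3 - 27/4 * r + 81/2 * r\<^sup>2) + B * (5/2) - C * (5/2)\<^sup>2 - (5/2 - t) * (B - C * (5/2 + t))"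
      unfolding G by algebra
    ultimately show ?thesis by linarith
  qed
  have G2b: "G2 m b w > 0" if w: "- (5/2) * r \<le> w" "w \<le> - (3/2) * r" for w
  proof -
    define t where "t = - w / r"
    have t: "w = - t * r" "3/2 \<le> t" "t \<le> 5/2" using w r by (auto simp: t_def field_simps)
    define B C where "B = 2 * ((1 + r) * b + r * b\<^sup>2 - 4 * r)" and "C = r * ((1 + 2 * r) * b\<^sup>2 - 4 * r)"
    have "r * G2 m b (- t * r) = r * (b\<^sup>2 * (2 * (1 - 2 * r)\<^sup>2) + t * (B - C * t))"
      unfolding G2_def B_def C_def b_def using mr by algebra
    then have G: "G2 m b w = b\<^sup>2 * (2 * (1 - 2 * r)\<^sup>2) + t * (B - C * t)"
      using r t(1) by simp
    have C: "C = r * (4 * u ^ 3 + 44 * (u ^ 2 * r) + 148 * (u * r ^ 2) + 152 * r ^ 3)"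
      unfolding C_def b_def u_def by algebra
    have "C \<ge> 0" unfolding C using u r by (intro mult_nonneg_nonneg add_nonneg_nonneg) auto
    have "B - 5/2 * C = 4 * u ^ 4 + 54 * (u ^ 3 * r) + 254 * (u ^ 2 * r ^ 2) + 502 * (u * r ^ 3) + 356 * r ^ 4"
      unfolding B_def C_def b_def u_def by algebra
    moreover have "\<dots> > 0" using u r by (intro add_nonneg_pos mult_nonneg_nonneg add_nonneg_nonneg) auto
    moreover have "C * t \<le> C * (5/2)" using \<open>C \<ge> 0\<close> t by (intro mult_left_mono) auto
    ultimately have "0 < t * (B - C * t)" using t by (intro mult_pos_pos) auto
    then show ?thesis unfolding G by (intro add_nonneg_pos mult_nonneg_nonneg) auto
  qed
  obtain y w :: real where yw: "a \<le> y" "y \<le> b" "- (5/2) * r \<le> w" "w \<le> - (3/2) * r"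
    and z: "G2 m y w = 0" "G1 m y w = 0"
  proof (rule poincare_miranda[of a b "- (5/2) * r" "- (3/2) * r" "\<lambda>z. G2 m (fst z) (snd z)" "\<lambda>z. G1 m (fst z) (snd z)"])
    show "a < b" "- (5/2) * r < - (3/2) * r" using r by (auto simp: a_def b_def)
    show "G2 m (fst (a, w)) (snd (a, w)) < 0" if "- (5/2) * r \<le> w" "w \<le> - (3/2) * r" for w
      using G2a[OF that] by simp
    show "G2 m (fst (b, w)) (snd (b, w)) > 0" if "- (5/2) * r \<le> w" "w \<le> - (3/2) * r" for w
      using G2b[OF that] by simp
    show "G1 m (fst (y, - (5/2) * r)) (snd (y, - (5/2) * r)) < 0" if y: "a \<le> y" "y \<le> b" for y
    proof -
      have X: "pxy m y (- (5/2) * r) = y\<^sup>2 - 5/2 * (1 + r) * y + 10 * r - 25/2 * r\<^sup>2" for y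
        unfolding pxy_def using mr by algebra
      have Xa: "pxy m a (- (5/2) * r) \<le> 0"
      proof -
        have "pxy m a (- (5/2) * r) = - 1 + 3 * r - 19/4 * (r * (1 - 4 * r))"
          unfolding X a_def by algebra
        then show ?thesis using rr r by linarith
      qed
      have Xb: "pxy m b (- (5/2) * r) \<le> 0"
      proof -
        have "pxy m b (- (5/2) * r) = - 1 + 2 * r - 7/2 * r\<^sup>2"
          unfolding X b_def by algebra
        then show ?thesis using zero_le_power2[of r] r by linarith
      qed
      have "pxy m y (- (5/2) * r) \<le> 0"
      proof (cases "y + a \<le> 5/2 * (1 + r)")
        case True
        then have "0 \<le> (y - a) * (5/2 * (1 + r) - (y + a))" using y by (intro mult_nonneg_nonneg) auto
        moreover have "pxy m y (- (5/2) * r) = pxy m a (- (5/2) * r) - (y - a) * (5/2 * (1 + r) - (y + a))"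
          unfolding X by algebra
        ultimately show ?thesis using Xa by linarith
      next
        case False
        then have "0 \<le> (b - y) * (y + b - 5/2 * (1 + r))" using y by (intro mult_nonneg_nonneg) auto
        moreover have "pxy m y (- (5/2) * r) = pxy m b (- (5/2) * r) - (b - y) * (y + b - 5/2 * (1 + r))"
          unfolding X by algebra
        ultimately show ?thesis using Xb by linarith
      qed
      then show ?thesis using G1_neg[of m y "- (5/2) * r"] box[OF y, of "- (5/2) * r"] m r by simp
    qed
    show "G1 m (fst (y, - (3/2) * r)) (snd (y, - (3/2) * r)) > 0" if y: "a \<le> y" "y \<le> b" for y
    proof -
      define \<delta> where "\<delta> = y - a"
      have X: "pxy m y (- (3/2) * r) = 1 - 33/4 * r + 45/2 * r\<^sup>2 + (5/2 - 21/2 * r) * \<delta> + \<delta>\<^sup>2"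
        unfolding pxy_def \<delta>_def a_def using mr by algebra
      have "0 \<le> (21/8 - 21/2 * r) * \<delta>" using r y by (intro mult_nonneg_nonneg) (auto simp: \<delta>_def)
      moreover have "0 \<le> (\<delta> - 1/16)\<^sup>2" by simp
      ultimately have "pxy m y (- (3/2) * r) \<ge> 1 - 33/4 * r + 45/2 * r\<^sup>2 - 1/256"
        unfolding X by (simp add: power2_eq_square algebra_simps)
      then have "(1 - r) * pxy m y (- (3/2) * r) \<ge> (1 - r) * (1 - 33/4 * r + 45/2 * r\<^sup>2 - 1/256)"
        using r by (intro mult_left_mono) auto
      moreover have "(1 - r) * (1 - 33/4 * r + 45/2 * r\<^sup>2 - 1/256) - r * (1 - 3/2 * r)
          = 255/256 - 2623/256 * r + 213/8 * r\<^sup>2 + 45/8 * (r\<^sup>2 * (1 - 4 * r))"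
        by algebra
      moreover have "0 \<le> (r - 5/26)\<^sup>2" by simp
      then have "r\<^sup>2 \<ge> 5/13 * r - 25/676" by (simp add: power2_eq_square algebra_simps)
      ultimately have "(1 - r) * pxy m y (- (3/2) * r) \<ge> r * (1 - 3/2 * r)"
        using rr2 r by linarith
      moreover have "(1 - r) * pxy m y (- (3/2) * r) = r * (m * pxy m y (- (3/2) * r))"
        using mr by algebra
      ultimately have "r * (m * pxy m y (- (3/2) * r)) \<ge> r * (1 - 3/2 * r)" by linarith
      then have "m * pxy m y (- (3/2) * r) \<ge> 1 - 3/2 * r" using r by simp
      moreover have "0 < 1 - 3/2 * r" using r by simp
      ultimately have "0 < m * pxy m y (- (3/2) * r)" by linarith
      then have "0 < pxy m y (- (3/2) * r)" using m by (simp add: zero_less_mult_iff)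
      with \<open>m * pxy m y (- (3/2) * r) \<ge> 1 - 3/2 * r\<close> show ?thesis
        using G1_pos[of m y "- (3/2) * r"] box[OF y, of "- (3/2) * r"] m r by simp
    qed
  qed (auto intro: c)
  show ?thesis
    using that[of y w] yw z box[OF yw] pxy_pos_of_zero[of m y w] m by simp
qed

text \<open>
  As \<open>m\<close> grows, the solution behaves like \<open>y = 5 / (3 m)\<close> and \<open>w = y\<^sup>2 t / (4 - (m + 2) y)\<close> with \<open>t = 2/3\<close>. In the
  coordinates \<open>(y, t)\<close> the sign of \<open>G1\<close> is governed by \<open>t\<close> and that of \<open>G2\<close> by \<open>y\<close>, so one rectangular box
  works for all \<open>m \<ge> 2\<close>; \<open>4 m + 3\<close> is a scale that keeps the solution inside for small \<open>m\<close> as well.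
\<close>

lemma first_family:
  assumes m: "m \<ge> 2"
  obtains y w where "y > 0" "w > 0" "pxy m y w > 0" "G1 m y w = 0" "G2 m y w = 0"
proof -
  define D where "D = 4 * m + 3"
  have D: "D \<ge> 11" using m by (simp add: D_def)
  define k where "k = m - 2"
  have k: "k \<ge> 0" using m by (simp add: k_def)
  define L where "L y = 4 - (m + 2) * y" for y
  define W where "W z = (fst z)\<^sup>2 * snd z / L (fst z)" for z :: "real \<times> real"
  have box: "0 < y" "y \<le> 8/11" "12/11 \<le> L y" "L y < 4" "m * y\<^sup>2 \<le> 1 + 3/4 * y\<^sup>2" if y: "5/D \<le> y" "y \<le> 8/D" for y
  proof -
    have "0 < 5/D" using D by simp
    then show y0: "0 < y" using y by linarith
    have yD: "y * D \<le> 8" using y D by (simp add: field_simps)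
    have "y * 11 \<le> y * D" using y0 D by (intro mult_left_mono) auto
    then show "y \<le> 8/11" using yD by linarith
    have "0 \<le> (m - 2) * y" using m y0 by simp
    then show "12/11 \<le> L y" using yD by (simp add: L_def D_def algebra_simps)
    show "L y < 4" using m y0 by (simp add: L_def)
    have "y * (y * D) \<le> y * 8" using yD y0 by (intro mult_left_mono) auto
    moreover have "0 \<le> 6 * (y - 2/3)\<^sup>2" by simp
    ultimately show "m * y\<^sup>2 \<le> 1 + 3/4 * y\<^sup>2" by (simp add: D_def power2_eq_square algebra_simps)
  qed
  \<comment> \<open>On the box both factors \<open>(m + 2) y - 4 - w\<close> and \<open>(m + 2) y - 4 - 2 w - y\<^sup>2\<close> of \<open>G1\<close> are negative.\<close>
  have G1L: "G1 m y w = (L y + 2 * w + y\<^sup>2) * ((1 + w) * y\<^sup>2 - 3 * pxy m y w) - m * y\<^sup>2 * (L y + w) * pxy m y w" for y w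
    unfolding G1_def L_def by algebra
  have XL: "pxy m y w = y\<^sup>2 - w * L y - 2 * w\<^sup>2" for y w
    unfolding pxy_def L_def by algebra
  have Wl: "W (y, t) * L y = y\<^sup>2 * t" "0 < W (y, t)" if "5/D \<le> y" "y \<le> 8/D" "t > 0" for y t
    using box[OF that(1,2)] that(3) by (simp_all add: W_def)
  have cont: "continuous_on (cbox (5/D, 2/5) (8/D, 3/4)) W"
    unfolding W_def L_def
  proof (intro continuous_intros)
    show "\<forall>z\<in>cbox (5/D, 2/5) (8/D, 3/4). 4 - (m + 2) * fst z \<noteq> 0"
      using box(3) by (force simp: cbox_Pair_eq L_def)
  qed
  have c1: "continuous_on (cbox (5/D, 2/5) (8/D, 3/4)) (\<lambda>z. G1 m (fst z) (W z))"
    and c2: "continuous_on (cbox (5/D, 2/5) (8/D, 3/4)) (\<lambda>z. - G2 m (fst z) (W z))"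
    by (intro continuous_on_minus cont_G cont continuous_on_fst continuous_on_id)+
  \<comment> \<open>Along the two sides \<open>y = c / D\<close> the numerator of \<open>G2\<close> is a quadratic polynomial in \<open>t\<close>;
    expanded in \<open>k = m - 2\<close> around the extremal value of \<open>t\<close> its coefficients have one sign.\<close>
  have G2D: "(L y)\<^sup>2 * D ^ 4 * G2 m y (W (y, t)) = y\<^sup>2 *
      ((c\<^sup>2 * (m + 3) - 2 * c * (m + 2) * D + 2 * D\<^sup>2) * (4 * D - c * (m + 2))\<^sup>2
        + 2 * ((4 * D - c * (m + 2)) * D - c\<^sup>2) * (4 * D - c * (m + 2)) * D * t
        + (4 * D\<^sup>2 - c\<^sup>2 * (m + 3)) * c\<^sup>2 * t\<^sup>2)"
    if y: "5/D \<le> y" "y \<le> 8/D" "t > 0" "y = c / D" for y t c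
  proof -
    have "c = y * D" using y(4) D by simp
    moreover have "L y * L y * G2 m y (W (y, t)) = y\<^sup>2 * (((m + 3) * y\<^sup>2 - 2 * (m + 2) * y + 2) * (L y)\<^sup>2
        + 2 * (L y - y\<^sup>2) * t * L y + (4 - (m + 3) * y\<^sup>2) * y\<^sup>2 * t\<^sup>2)"
      using Wl(1)[OF y(1-3)] unfolding G2_def L_def by algebra
    ultimately show ?thesis unfolding L_def by algebra
  qed
  have pos: "0 < (L y)\<^sup>2 * D ^ 4" if "5/D \<le> y" "y \<le> 8/D" for y
    using box(3)[OF that] D by simp
  obtain y t where yt: "5/D \<le> y" "y \<le> 8/D" "2/5 \<le> t" "t \<le> 3/4"
    and z: "- G2 m y (W (y, t)) = 0" "G1 m y (W (y, t)) = 0"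
  proof (rule poincare_miranda[OF _ _ c2 c1])
    show "5/D < 8/D" "2/5 < (3/4 :: real)" using D by (auto simp: field_simps)
    show "- G2 m (fst (5/D, t)) (W (5/D, t)) < 0" if t: "2/5 \<le> t" "t \<le> 3/4" for t
    proof -
      have y: "5/D \<le> 5/D" "5/D \<le> 8/D" using D by (auto simp: field_simps)
      have "(5\<^sup>2 * (m + 3) - 2 * 5 * (m + 2) * D + 2 * D\<^sup>2) * (4 * D - 5 * (m + 2))\<^sup>2
          + 2 * ((4 * D - 5 * (m + 2)) * D - 5\<^sup>2) * (4 * D - 5 * (m + 2)) * D * t + (4 * D\<^sup>2 - 5\<^sup>2 * (m + 3)) * 5\<^sup>2 * t\<^sup>2
        = (49324 + 51704 * k + 28799 * k ^ 2 + 13519 * k ^ 3 + 2904 * k ^ 4) / 5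
          + (126192 + 218302 * k + 138442 * k ^ 2 + 38192 * k ^ 3 + 3872 * k ^ 4) * (t - 2/5)
          + (8975 + 8175 * k + 1600 * k ^ 2) * ((t - 2/5) * (t + 2/5))"
        unfolding D_def k_def by algebra
      moreover have "\<dots> > 0"
        using k t by (intro add_pos_nonneg mult_nonneg_nonneg divide_pos_pos add_nonneg_nonneg) auto
      ultimately have "0 < (L (5/D))\<^sup>2 * D ^ 4 * G2 m (5/D) (W (5/D, t))"
        using t D by (subst G2D[OF y _ refl]) auto
      then show ?thesis using pos[OF y] by (simp add: zero_less_mult_iff)
    qed
    show "- G2 m (fst (8/D, t)) (W (8/D, t)) > 0" if t: "2/5 \<le> t" "t \<le> 3/4" for t
    proof -
      have y: "5/D \<le> 8/D" "8/D \<le> 8/D" using D by (auto simp: field_simps)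
      have "(8\<^sup>2 * (m + 3) - 2 * 8 * (m + 2) * D + 2 * D\<^sup>2) * (4 * D - 8 * (m + 2))\<^sup>2
          + 2 * ((4 * D - 8 * (m + 2)) * D - 8\<^sup>2) * (4 * D - 8 * (m + 2)) * D * t + (4 * D\<^sup>2 - 8\<^sup>2 * (m + 3)) * 8\<^sup>2 * t\<^sup>2
        = - ((1080 + 3744 * k + 10912 * k ^ 2 + 5376 * k ^ 3 + 512 * k ^ 4)
          + (17952 + 54400 * k + 49792 * k ^ 2 + 17408 * k ^ 3 + 2048 * k ^ 4) * (3/4 - t)
          + (10496 + 18432 * k + 4096 * k ^ 2) * ((3/4 - t) * (3/4 + t)))"
        unfolding D_def k_def by algebra
      moreover have "0 < (1080 + 3744 * k + 10912 * k ^ 2 + 5376 * k ^ 3 + 512 * k ^ 4)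
          + (17952 + 54400 * k + 49792 * k ^ 2 + 17408 * k ^ 3 + 2048 * k ^ 4) * (3/4 - t)
          + (10496 + 18432 * k + 4096 * k ^ 2) * ((3/4 - t) * (3/4 + t))"
        using k t by (intro add_pos_nonneg mult_nonneg_nonneg add_nonneg_nonneg) auto
      ultimately have "(L (8/D))\<^sup>2 * D ^ 4 * G2 m (8/D) (W (8/D, t)) < 0"
        using t D by (subst G2D[OF y _ refl]) (auto simp: mult_less_0_iff)
      then show ?thesis using pos[OF y] by (simp add: mult_less_0_iff)
    qed
    show "G1 m (fst (y, 2/5)) (W (y, 2/5)) < 0" if y: "5/D \<le> y" "y \<le> 8/D" for y
    proof -
      define w where "w = W (y, 2/5)"
      note b = box[OF y]
      have w: "w * L y = 2/5 * y\<^sup>2" "0 < w" using Wl[OF y, of "2/5"] by (auto simp: w_def)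
      have y2: "y\<^sup>2 \<le> 64/121" using power_mono[OF b(2), of 2] b(1) by (simp add: power2_eq_square)
      have "w * (12/11) \<le> w * L y" using w b by (intro mult_left_mono) auto
      then have w1: "w \<le> 11/30 * y\<^sup>2" using w by simp
      then have w2: "w \<le> 32/165" using y2 by simp
      have "w * w \<le> 32/165 * (11/30 * y\<^sup>2)" using w w1 w2 by (intro mult_mono) auto
      then have "w\<^sup>2 \<le> 32/165 * (11/30 * y\<^sup>2)" by (simp only: power2_eq_square[of w])
      moreover have "w * y\<^sup>2 \<le> 32/165 * y\<^sup>2" using w2 by (intro mult_right_mono) auto
      moreover have "0 < y\<^sup>2" using b by simp
      ultimately have X: "(1 + w) * y\<^sup>2 \<le> 3 * pxy m y w"
        unfolding XL w(1) distrib_right by argo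
      have "(L y + 2 * w + y\<^sup>2) * ((1 + w) * y\<^sup>2 - 3 * pxy m y w) \<le> 0"
        using b w X by (intro mult_nonneg_nonpos) auto
      moreover have "0 < (1 + w) * y\<^sup>2" using w b by simp
      then have "0 < pxy m y w" using X by linarith
      then have "0 < m * y\<^sup>2 * (L y + w) * pxy m y w"
        using m b w by (intro mult_pos_pos) auto
      ultimately show ?thesis unfolding w_def[symmetric] fst_conv G1L by linarith
    qed
    show "G1 m (fst (y, 3/4)) (W (y, 3/4)) > 0" if y: "5/D \<le> y" "y \<le> 8/D" for y
    proof -
      define w where "w = W (y, 3/4)"
      note b = box[OF y]
      have w: "w * L y = 3/4 * y\<^sup>2" "0 < w" using Wl[OF y, of "3/4"] by (auto simp: w_def)
      have "w * L y \<le> w * 4" using w b by (intro mult_left_mono) auto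
      then have w1: "3/16 * y\<^sup>2 \<le> w" using w by simp
      have X: "pxy m y w = y\<^sup>2 / 4 - 2 * w\<^sup>2" unfolding XL w(1) by simp
      have y2: "0 < y\<^sup>2" using b by simp
      have K: "0 < L y + 2 * w + y\<^sup>2" using b(3) w(2) y2 by linarith
      show ?thesis
      proof (cases "pxy m y w \<le> 0")
        case True
        have "0 < (1 + w) * y\<^sup>2" using w y2 by simp
        then have "0 < (1 + w) * y\<^sup>2 - 3 * pxy m y w" using True by linarith
        then have "0 < (L y + 2 * w + y\<^sup>2) * ((1 + w) * y\<^sup>2 - 3 * pxy m y w)"
          using K by (intro mult_pos_pos)
        moreover have "m * y\<^sup>2 * (L y + w) * pxy m y w \<le> 0"
          using m b w True by (intro mult_nonneg_nonpos mult_nonneg_nonneg) auto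
        ultimately show ?thesis unfolding w_def[symmetric] fst_conv G1L by linarith
      next
        case False
        have "(m * y\<^sup>2 + 3) * pxy m y w \<le> (m * y\<^sup>2 + 3) * (y\<^sup>2 / 4)"
          using m by (intro mult_left_mono) (auto simp: X)
        also have "\<dots> \<le> (4 + 4 * w) * (y\<^sup>2 / 4)"
          using b(5) w1 y2 by (intro mult_right_mono) auto
        finally have le: "m * y\<^sup>2 * pxy m y w \<le> (1 + w) * y\<^sup>2 - 3 * pxy m y w" by (simp add: algebra_simps)
        have pos: "0 < m * y\<^sup>2 * pxy m y w" using False m y2 by (intro mult_pos_pos) auto
        have "(L y + w) * (m * y\<^sup>2 * pxy m y w) < (L y + 2 * w + y\<^sup>2) * (m * y\<^sup>2 * pxy m y w)"
        proof (rule mult_strict_right_mono[OF _ pos])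
          show "L y + w < L y + 2 * w + y\<^sup>2" using w(2) y2 by linarith
        qed
        also have "\<dots> \<le> (L y + 2 * w + y\<^sup>2) * ((1 + w) * y\<^sup>2 - 3 * pxy m y w)"
          by (rule mult_left_mono[OF le less_imp_le[OF K]])
        finally show ?thesis unfolding w_def[symmetric] fst_conv G1L by (simp add: mult_ac)
      qed
    qed
  qed simp_all
  define w where "w = W (y, t)"
  note b = box[OF yt(1,2)]
  have w: "0 < w" using Wl(2)[OF yt(1,2), of t] yt by (simp add: w_def)
  have "0 < pxy m y w"
  proof (rule ccontr)
    assume "\<not> 0 < pxy m y w"
    then have X: "pxy m y w \<le> 0" by simp
    have "0 < (1 + w) * y\<^sup>2" using w b by simp
    then have "0 < (1 + w) * y\<^sup>2 - 3 * pxy m y w" using X by linarith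
    then have "0 < (L y + 2 * w + y\<^sup>2) * ((1 + w) * y\<^sup>2 - 3 * pxy m y w)"
      using b w by (intro mult_pos_pos add_pos_nonneg) auto
    moreover have "m * y\<^sup>2 * (L y + w) * pxy m y w \<le> 0"
      using m b w X by (intro mult_nonneg_nonpos mult_nonneg_nonneg) auto
    ultimately show False using z(2) unfolding w_def[symmetric] G1L by linarith
  qed
  then show ?thesis using that[of y w] b w z by (simp add: w_def)
qed

section \<open>The four Einstein metrics\<close>

text \<open>
  The contribution of one third index to \<open>ricci_weight\<close>, where \<open>s\<close> and \<open>t\<close> are the weights of the two pairs
  containing it. Division by zero gives the correct value \<open>1\<close> if one of these pairs lies in the isotropy
  subalgebra.
\<close>

definition ricci_term :: "real \<Rightarrow> real \<Rightarrow> real \<Rightarrow> real" where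
  "ricci_term s t r = (s + r - t) / (2 * s) - (s + t - r) / (2 * s) * ((t + r - s) / (2 * t))
     + ((t + r - s) / (2 * t) - (t + s - r) / (2 * t) * ((s + r - t) / (2 * s)))"

lemma ricci_term_pos: "s > 0 \<Longrightarrow> t > 0 \<Longrightarrow> ricci_term s t r = (r\<^sup>2 - (s - t)\<^sup>2) / (2 * s * t)"
  by (simp add: ricci_term_def field_simps) algebra

lemma ricci_term_0: "s \<noteq> 0 \<Longrightarrow> ricci_term s 0 s = 1" "s \<noteq> 0 \<Longrightarrow> ricci_term 0 s s = 1"
  by (simp_all add: ricci_term_def)

lemma (in weights) ricci_weight_eq:
  "ricci_weight b c = (\<Sum>a\<in>UNIV. if a = b \<or> a = c then 0 else ricci_term (x a b) (x a c) (x b c))"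
proof -
  have "ricci_weight b c = (\<Sum>a\<in>- {b, c}. ricci_term (x a b) (x a c) (x b c))"
    unfolding ricci_weight_def coef_def ricci_term_def
  proof (intro sum.cong refl)
    fix a
    show "(x a b + x c b - x a c) / (2 * x a b) - (x b a + x c a - x b c) / (2 * x b a) * ((x a c + x b c - x a b) / (2 * x a c)) +
        ((x a c + x b c - x a b) / (2 * x a c) - (x c a + x b a - x c b) / (2 * x c a) * ((x a b + x c b - x a c) / (2 * x a b)))
      = (x a b + x b c - x a c) / (2 * x a b) - (x a b + x a c - x b c) / (2 * x a b) * ((x a c + x b c - x a b) / (2 * x a c)) +
        ((x a c + x b c - x a b) / (2 * x a c) - (x a c + x a b - x b c) / (2 * x a c) * ((x a b + x b c - x a c) / (2 * x a b)))"
      unfolding sym[of b a] sym[of c a] sym[of c b] ..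
  qed
  also have "\<dots> = (\<Sum>a\<in>- {b, c}. if a = b \<or> a = c then 0 else ricci_term (x a b) (x a c) (x b c))"
    by (intro sum.cong) auto
  also have "\<dots> = (\<Sum>a\<in>UNIV. if a = b \<or> a = c then 0 else ricci_term (x a b) (x a c) (x b c))"
    by (intro sum.mono_neutral_left) auto
  finally show ?thesis .
qed

lemma (in weights) ricci_weight_sym: "ricci_weight b c = ricci_weight c b"
  unfolding ricci_weight_def by (simp add: insert_commute add.commute)

context stiefel_weights
begin

lemma ricci_weight_Inl_Inl:
  "ricci_weight (Inl i) (Inl j) = (\<Sum>k\<in>UNIV. if k = i \<or> k = j then 0 else ricci_term (e k i) (e k j) (e i j))
     + real CARD('m) * ricci_term (d i) (d j) (e i j)"
  unfolding ricci_weight_eq sum_UNIV_sum by (simp cong: if_cong)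

lemma ricci_weight_Inl_Inr:
  "ricci_weight (Inl i) (Inr s) = (\<Sum>k\<in>UNIV. if k = i then 0 else ricci_term (e k i) (d k) (d i)) + (real CARD('m) - 1)"
proof -
  have "(\<Sum>r\<in>UNIV. if Inr r = (Inl i :: 4 + 'm) \<or> Inr r = (Inr s :: 4 + 'm) then 0 else ricci_term (w (Inr r) (Inl i)) (w (Inr r) (Inr s)) (w (Inl i) (Inr s)))
      = (\<Sum>r\<in>UNIV. 1 - (if r = s then 1 else 0 :: real))"
    using d_pos[of i] by (intro sum.cong) (auto simp: ricci_term_0)
  then show ?thesis unfolding ricci_weight_eq sum_UNIV_sum by (simp add: sum_subtractf cong: if_cong)
qed

lemma g_gen: "a \<noteq> b \<Longrightarrow> g base_frame (gen a b ** base_frame) (gen a b ** base_frame) = 2 * w a b"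
proof -
  assume ab: "a \<noteq> b"
  have "gen a b $ c $ d * gen a b $ c $ d = (if c = a then if d = b then 1 else 0 else 0) + (if c = b then if d = a then 1 else 0 else 0)" for c d
    using ab by (simp add: gen_nth)
  then have "w c d * gen a b $ c $ d * gen a b $ c $ d = (if c = a then if d = b then w a b else 0 else 0) + (if c = b then if d = a then w b a else 0 else 0)" for c d
    by (simp add: mult.assoc)
  moreover have "(\<Sum>b\<in>UNIV. if P then f b else 0) = (if P then \<Sum>b\<in>UNIV. f b else 0)" for P and f :: "4 + 'm \<Rightarrow> real"
    by simp
  ultimately have "form (gen a b) (gen a b) = w a b + w b a"
    by (simp only: form_def matrix_inner hadamard_nth sum.distrib) simp
  then show ?thesis unfolding g_base[OF gen_skew gen_skew] sym[of b a] by simp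
qed

end

subsection \<open>Weights constant on blocks\<close>

text \<open>
  The factor \<open>N = n - 2\<close> comes from the Killing form. It drops out of the Ricci tensor.
\<close>

definition block_e :: "real \<Rightarrow> real \<Rightarrow> real \<Rightarrow> 4 \<Rightarrow> 4 \<Rightarrow> real" where
  "block_e N x y i j = N * (if i = 1 \<or> j = 1 then y else x)"

definition block_d :: "real \<Rightarrow> real \<Rightarrow> 4 \<Rightarrow> real" where
  "block_d N p j = N * (if j = 1 then p else 1)"

lemma stiefel_weights_block: "N > 0 \<Longrightarrow> x > 0 \<Longrightarrow> y > 0 \<Longrightarrow> p > 0 \<Longrightarrow> stiefel_weights (block_e N x y) (block_d N p)"
  by unfold_locales (auto simp: block_e_def block_d_def)

lemma ricci_term_scale: "N > 0 \<Longrightarrow> s > 0 \<Longrightarrow> t > 0 \<Longrightarrow> ricci_term (N * s) (N * t) (N * r) = (r\<^sup>2 - (s - t)\<^sup>2) / (2 * s * t)"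
proof -
  assume a: "N > 0" "s > 0" "t > 0"
  then have "ricci_term (N * s) (N * t) (N * r) = (N\<^sup>2 * (r\<^sup>2 - (s - t)\<^sup>2)) / (N\<^sup>2 * (2 * s * t))"
    by (simp add: ricci_term_pos power2_eq_square algebra_simps)
  then show ?thesis using a by simp
qed

lemma einstein_block:
  assumes N: "N > 0" and pos: "x > 0" "y > 0" "p > 0" and E: "einstein_eqs (real CARD('m)) x y p l"
  shows "einstein_metric TYPE(6 + 4 \<times> 'm) (stiefel :: 'm::finite frame set) (stiefel_weights.g (block_e N x y) (block_d N p))"
proof -
  interpret stiefel_weights "block_e N x y" "block_d N p" "TYPE('m)"
    by (rule stiefel_weights_block[OF N pos])
  let ?m = "real CARD('m)"
  have t1: "ricci_term (N * s) N (N * r) = (r\<^sup>2 - (s - 1)\<^sup>2) / (2 * s)"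
    "ricci_term N (N * s) (N * r) = (r\<^sup>2 - (s - 1)\<^sup>2) / (2 * s)"
    "ricci_term (N * s) N N = (1 - (s - 1)\<^sup>2) / (2 * s)" if "s > 0" for s r
    using ricci_term_scale[OF N, of s 1 r] ricci_term_scale[OF N, of 1 s r] ricci_term_scale[OF N, of s 1 1] that
    by (simp_all add: power2_commute)
  have t2: "ricci_term N N (N * r) = r\<^sup>2 / 2" "ricci_term (N * s) (N * t) N = (1 - (s - t)\<^sup>2) / (2 * s * t)" if "s > 0" "t > 0" for r s t
    using ricci_term_scale[OF N, of 1 1 r] ricci_term_scale[OF N, of s t 1] that by simp_all
  note t = ricci_term_scale[OF N] t1 t2(1)[OF zero_less_one zero_less_one] t2(2)
  have xx: "(x\<^sup>2 - (x - x)\<^sup>2) / (2 * x * x) = 1/2" "(y\<^sup>2 - (x - y)\<^sup>2) / (2 * x * y) = 1 - x / (2 * y)"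
     "(y\<^sup>2 - (y - x)\<^sup>2) / (2 * y * x) = 1 - x / (2 * y)" "(1\<^sup>2 - (x - 1)\<^sup>2) / (2 * x * 1) = 1 - x / 2"
    "x\<^sup>2 / (2 * x * x) = 1/2" "x\<^sup>2 / (2 * y * y) = x\<^sup>2 / (2 * y\<^sup>2)" "(1 - (x - 1)\<^sup>2) / (2 * x) = 1 - x / 2"
    using pos by (simp_all add: field_simps power2_eq_square)
  have 11: "ricci_weight (Inl i) (Inl j) = l * (if i = 1 \<or> j = 1 then y else x)" if "i \<noteq> j" for i j
  proof -
    have "\<forall>i j :: 4. i \<noteq> j \<longrightarrow> ricci_weight (Inl i) (Inl j) = l * (if i = 1 \<or> j = 1 then y else x)"
      unfolding forall_4 ricci_weight_Inl_Inl block_e_def block_d_def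
      using E pos by (simp add: sum_4 t xx einstein_eqs_def)
    then show ?thesis using that by blast
  qed
  have 12: "ricci_weight (Inl i) (Inr s) = l * (if i = 1 then p else 1)" for i s
  proof -
    have "\<forall>i :: 4. ricci_weight (Inl i) (Inr s) = l * (if i = 1 then p else 1)"
      unfolding forall_4 ricci_weight_Inl_Inr block_e_def block_d_def
      using E pos by (simp add: sum_4 t xx einstein_eqs_def)
    then show ?thesis by blast
  qed
  show ?thesis
  proof (rule einstein_g)
    show "ricci_weight b c = 2 * (l / (2 * N)) * w b c" if "b \<noteq> c" "w b c \<noteq> 0" for b c
      using that N by (cases b; cases c) (auto simp: 11 12 ricci_weight_sym[of "Inr _" "Inl _"] block_e_def block_d_def)
  qed
qed

text \<open>
  The generators recover the weights from the metric; the weight \<open>N\<close> common to both metrics on the block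
  \<open>(2, 3)\<close> forces the scaling factor to be \<open>1\<close>.
\<close>

lemma g_block_proportional:
  fixes r :: "'m::finite"
  assumes N: "N > 0" and pos: "x > 0" "y > 0" "p > 0" "x' > 0" "y' > 0" "p' > 0"
    and eq: "equal_up_to_scaling (stiefel :: 'm frame set)
       (stiefel_weights.g (block_e N x y) (block_d N p)) (stiefel_weights.g (block_e N x' y') (block_d N p'))"
  shows "x = x'" "p = p'"
proof -
  interpret A: stiefel_weights "block_e N x y" "block_d N p" "TYPE('m)" by (rule stiefel_weights_block[OF N pos(1-3)])
  interpret B: stiefel_weights "block_e N x' y'" "block_d N p'" "TYPE('m)" by (rule stiefel_weights_block[OF N pos(4-6)])
  obtain c where c: "\<And>A V W. A \<in> stiefel \<Longrightarrow> V \<in> tangent_space stiefel A \<Longrightarrow> W \<in> tangent_space stiefel A \<Longrightarrow> A.g A V W = c * B.g A V (W :: 'm frame)"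
    using eq unfolding equal_up_to_scaling_def by blast
  have base: "base_frame \<in> (stiefel :: 'm frame set)" by (simp add: stiefel_def base_frame_orthonormal)
  have "A.gen a b ** base_frame \<in> tangent_space stiefel (base_frame :: 'm frame)" for a b
    using A.skew_base[OF A.gen_skew] by (simp add: tangent_space_stiefel[OF base] base_tangent_def)
  then have w: "A.w a b = c * B.w a b" if "a \<noteq> b" for a b
    using c[OF base, of "A.gen a b ** base_frame" "A.gen a b ** base_frame"] A.g_gen[OF that] B.g_gen[OF that] by simp
  have "c = 1" using w[of "Inl 2" "Inr r"] N by (simp add: block_d_def)
  then show "p = p'" using w[of "Inl 1" "Inr r"] N by (simp add: block_d_def)
  show "x = x'" using w[of "Inl 2" "Inl 3"] N \<open>c = 1\<close> by (simp add: block_e_def)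
qed

subsection \<open>Comparison with scalar products on \<open>\<p>\<close>\<close>

lemma so_skew: "so = skew"
  by (simp add: so_def skew_def)

lemma frak_p_tangent:
  assumes "stiefel_weights e d"
  shows "frak_p = weights.tangent (stiefel_weights.w e d :: 4 + 'm::finite \<Rightarrow> _)"
proof -
  interpret stiefel_weights e d "TYPE('m)" by (rule assms)
  show ?thesis by (auto simp: frak_p_iff tangent_iff so_skew)
qed

lemma killing_block_part:
  fixes Y :: "'m::finite sqmat"
  assumes "Y \<in> skew"
  shows "- killing (block_part a b X) (block_part a b Y) = (\<Sum>i\<in>UNIV. \<Sum>j\<in>UNIV.
     (real CARD(4 + 'm) - 2) * (if i \<in> block a \<and> j \<in> block b \<or> i \<in> block b \<and> j \<in> block a then 1 else 0) * (X $ i $ j * Y $ i $ j))"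
proof -
  have "killing (block_part a b X) (block_part a b Y) = (\<Sum>i\<in>UNIV. \<Sum>j\<in>UNIV.
     (real CARD(4 + 'm) - 2) * (block_part a b X $ i $ j * block_part a b Y $ j $ i))"
    by (simp add: killing_def trace_def matrix_matrix_mult_def sum_distrib_left)
  also have "\<dots> = (\<Sum>i\<in>UNIV. \<Sum>j\<in>UNIV.
     - ((real CARD(4 + 'm) - 2) * (if i \<in> block a \<and> j \<in> block b \<or> i \<in> block b \<and> j \<in> block a then 1 else 0) * (X $ i $ j * Y $ i $ j)))"
  proof (intro sum.cong refl)
    fix i j
    have "block_part a b Y $ j $ i = - block_part a b Y $ i $ j"
      using skew_nth[OF assms, of j i] by (auto simp: block_part_def)
    then show "(real CARD(4 + 'm) - 2) * (block_part a b X $ i $ j * block_part a b Y $ j $ i)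
      = - ((real CARD(4 + 'm) - 2) * (if i \<in> block a \<and> j \<in> block b \<or> i \<in> block b \<and> j \<in> block a then 1 else 0) * (X $ i $ j * Y $ i $ j))"
      by (simp add: block_part_def)
  qed
  finally show ?thesis by (simp add: sum_negf)
qed

lemma diag_form_eq:
  fixes X Y :: "'m::finite sqmat"
  assumes pos: "x > 0" "y > 0" "p > 0" and X: "X \<in> frak_p" and Y: "Y \<in> frak_p"
  defines "N \<equiv> real CARD(4 + 'm) - 2"
  shows "diag_form x y p 1 X Y = weights.form (stiefel_weights.w (block_e N x y) (block_d N p)) X Y"
proof -
  have N: "N > 0" by (simp add: N_def card_UNIV_sum)
  interpret stiefel_weights "block_e N x y" "block_d N p" "TYPE('m)" by (rule stiefel_weights_block[OF N pos])
  have Ys: "Y \<in> skew" and Xt: "X \<in> skew" "\<And>r s. X $ Inr r $ Inr s = 0" using X Y by (auto simp: frak_p_iff so_skew)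
  let ?I = "\<lambda>a b i j. if i \<in> block a \<and> j \<in> block b \<or> i \<in> block b \<and> j \<in> (block a :: (4 + 'm) set) then 1 else 0 :: real"
  have "diag_form x y p 1 X Y = (\<Sum>i\<in>UNIV. \<Sum>j\<in>UNIV.
      (x * (N * ?I 2 2 i j * (X $ i $ j * Y $ i $ j)) + y * (N * ?I 1 2 i j * (X $ i $ j * Y $ i $ j))
      + p * (N * ?I 1 3 i j * (X $ i $ j * Y $ i $ j)) + 1 * (N * ?I 2 3 i j * (X $ i $ j * Y $ i $ j))))"
    unfolding diag_form_def killing_block_part[OF Ys] N_def[symmetric] by (simp only: sum_distrib_left sum.distrib)
  also have "\<dots> = (\<Sum>i\<in>UNIV. \<Sum>j\<in>UNIV. w i j * X $ i $ j * Y $ i $ j)"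
  proof (intro sum.cong refl)
    fix i j :: "4 + 'm"
    define T where "T i j = x * (N * ?I 2 2 i j) + y * (N * ?I 1 2 i j) + p * (N * ?I 1 3 i j) + 1 * (N * ?I 2 3 i j)"
      for i j :: "4 + 'm"
    define S where "S = T i j"
    have rng: "(Inl a :: 4 + 'm) \<in> range Inr \<longleftrightarrow> False" for a by auto
    have T11: "\<forall>a b :: 4. a \<noteq> b \<longrightarrow> T (Inl a) (Inl b) = block_e N x y a b"
      unfolding forall_4 by (simp add: T_def block_def block_e_def rng)
    have T12: "\<forall>a :: 4. T (Inl a) (Inr r) = block_d N p a" for r
      unfolding forall_4 by (simp add: T_def block_def block_d_def rng)
    have T21: "\<forall>a :: 4. T (Inr r) (Inl a) = block_d N p a" for r
      unfolding forall_4 by (simp add: T_def block_def block_d_def rng)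
    have "S = w i j \<or> X $ i $ j = 0"
    proof (cases "i = j")
      case True
      then show ?thesis using skew_diag[OF Xt(1)] by simp
    next
      case False
      then show ?thesis using T11 T12 T21 Xt(2) by (cases i; cases j) (auto simp: S_def)
    qed
    then have "S * (X $ i $ j * Y $ i $ j) = w i j * X $ i $ j * Y $ i $ j" by (elim disjE) simp_all
    moreover have "x * (N * ?I 2 2 i j * (X $ i $ j * Y $ i $ j)) + y * (N * ?I 1 2 i j * (X $ i $ j * Y $ i $ j))
      + p * (N * ?I 1 3 i j * (X $ i $ j * Y $ i $ j)) + 1 * (N * ?I 2 3 i j * (X $ i $ j * Y $ i $ j))
      = S * (X $ i $ j * Y $ i $ j)"
      unfolding S_def T_def by (simp only: distrib_right mult.assoc)
    ultimately show "x * (N * ?I 2 2 i j * (X $ i $ j * Y $ i $ j)) + y * (N * ?I 1 2 i j * (X $ i $ j * Y $ i $ j))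
      + p * (N * ?I 1 3 i j * (X $ i $ j * Y $ i $ j)) + 1 * (N * ?I 2 3 i j * (X $ i $ j * Y $ i $ j))
      = w i j * X $ i $ j * Y $ i $ j" by (rule trans[rotated])
  qed
  finally show ?thesis by (simp add: form_def matrix_inner)
qed

text \<open>
  A column with index outside the block is a unit vector by assumption, and then so is the row, by orthogonality.
\<close>

lemma SO_block_entry:
  fixes Q :: "'m::finite sqmat"
  assumes Q: "Q \<in> SO_block n" and ac: "a \<noteq> c" "\<not> (a \<in> block n \<and> c \<in> block n)"
  shows "Q $ a $ c = 0"
proof -
  have e: "(M *v axis k 1) $ i = M $ i $ k" for M :: "'m sqmat" and i k
    by (simp add: matrix_vector_mul_component inner_axis)
  have o: "transpose Q ** Q = mat 1" using Q by (simp add: SO_block_def rotation_matrix_def orthogonal_matrix)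
  have fx: "Q *v axis i 1 = axis i 1" if "i \<notin> block n" for i using Q that by (simp add: SO_block_def)
  show ?thesis
  proof (cases "c \<in> block n")
    case False
    then show ?thesis using e[of Q c a] fx[OF False] ac(1) by (simp add: axis_def)
  next
    case True
    then have "a \<notin> block n" using ac by simp
    then have "transpose Q *v axis a 1 = (transpose Q ** Q) *v axis a 1"
      using fx by (simp add: matrix_vector_mul_assoc[symmetric])
    then have "(transpose Q *v axis a 1) $ c = axis a 1 $ c" by (simp add: o)
    then show ?thesis using e[of "transpose Q" a c] ac(1) by (simp add: axis_def transpose_def)
  qed
qed

text \<open>
  Entrywise multiplication by a function of the blocks commutes with conjugation by a matrix that does not mix
  the blocks. Applied to the weights this is the invariance of the scalar product.
\<close>

lemma (in stiefel_weights) hadamard_conj: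
  fixes Q X :: "'m sqmat"
  assumes Q: "\<And>a c. Q $ a $ c \<noteq> 0 \<Longrightarrow> (\<forall>b. h a b = h c b) \<and> (\<forall>b. h b a = h b c)"
  shows "hadamard h (Q ** X ** transpose Q) = Q ** hadamard h X ** transpose Q"
proof -
  have H: "h a b * (Q $ a $ c * X $ c $ k * Q $ b $ k) = Q $ a $ c * (h c k * X $ c $ k) * Q $ b $ k" for a b c k
    using Q[of a c] Q[of b k] by (cases "Q $ a $ c = 0"; cases "Q $ b $ k = 0") auto
  show ?thesis
    by (simp only: vec_eq_iff hadamard_nth matrix_matrix_mult_def transpose_def vec_lambda_beta
        sum_distrib_left sum_distrib_right H) simp
qed

lemma SO3_SOm_preserves_blocks:
  fixes Q :: "'m::finite sqmat"
  assumes "Q \<in> SO3_SOm"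
  shows "transpose Q ** Q = mat 1" and "Q $ a $ c \<noteq> 0 \<Longrightarrow> a = c \<or> a \<in> block 2 \<and> c \<in> block 2 \<or> a \<in> block 3 \<and> c \<in> block 3"
proof -
  obtain R S :: "'m sqmat" where Q: "Q = R ** S" and R: "R \<in> SO_block 2" and S: "S \<in> SO_block 3"
    using assms by (auto simp: SO3_SOm_def)
  have "transpose R ** R = mat 1" "transpose S ** S = mat 1"
    using R S by (simp_all add: SO_block_def rotation_matrix_def orthogonal_matrix)
  moreover have "transpose Q ** Q = transpose S ** (transpose R ** R) ** S"
    by (simp add: Q matrix_transpose_mul matrix_mul_assoc)
  ultimately show "transpose Q ** Q = mat 1" by simp
  assume "Q $ a $ c \<noteq> 0"
  then obtain b where "R $ a $ b * S $ b $ c \<noteq> 0"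
    unfolding Q matrix_matrix_mult_def vec_lambda_beta by (meson sum.not_neutral_contains_not_neutral)
  then have "a = b \<or> a \<in> block 2 \<and> b \<in> block 2" "b = c \<or> b \<in> block 3 \<and> c \<in> block 3"
    using SO_block_entry[OF R, of a b] SO_block_entry[OF S, of b c] by auto
  moreover have "block 2 \<inter> (block 3 :: (4 + 'm) set) = {}" by (auto simp: block_def)
  ultimately show "a = c \<or> a \<in> block 2 \<and> c \<in> block 2 \<or> a \<in> block 3 \<and> c \<in> block 3" by blast
qed

lemma diag_form_invariant:
  assumes pos: "x > 0" "y > 0" "p > 0"
  shows "scalar_product_on frak_p (diag_form x y p 1 :: 'm::finite sqmat \<Rightarrow> 'm sqmat \<Rightarrow> real)"
    and "Ad_invariant_on SO3_SOm frak_p (diag_form x y p 1 :: 'm sqmat \<Rightarrow> 'm sqmat \<Rightarrow> real)"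
    and "given_by (stiefel_weights.g (block_e (real CARD(4 + 'm) - 2) x y) (block_d (real CARD(4 + 'm) - 2) p)) (diag_form x y p 1 :: 'm sqmat \<Rightarrow> _)"
proof -
  define N where "N = real CARD(4 + 'm) - 2"
  have N: "N > 0" by (simp add: N_def card_UNIV_sum)
  interpret stiefel_weights "block_e N x y" "block_d N p" "TYPE('m)" by (rule stiefel_weights_block[OF N pos])
  have p: "(frak_p :: 'm sqmat set) = tangent" by (rule frak_p_tangent[OF stiefel_weights_block[OF N pos]])
  have f: "diag_form x y p 1 X Y = form X Y" if "X \<in> tangent" "Y \<in> tangent" for X Y
    using diag_form_eq[OF pos, of X Y] that unfolding p N_def by simp
  note sub = subspace_tangent
  show "scalar_product_on frak_p (diag_form x y p 1 :: 'm sqmat \<Rightarrow> 'm sqmat \<Rightarrow> real)"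
    unfolding scalar_product_on_def p
    using sub by (auto simp: f subspace_add subspace_scale bilinear_ladd[OF bil(3)] bilinear_lmul[OF bil(3)] form_pos intro: b_sym)
  show "given_by (stiefel_weights.g (block_e (real CARD(4 + 'm) - 2) x y) (block_d (real CARD(4 + 'm) - 2) p)) (diag_form x y p 1 :: 'm sqmat \<Rightarrow> _)"
    unfolding given_by_def p N_def[symmetric] by (auto simp: f g_base tangent_def)
  show "Ad_invariant_on SO3_SOm frak_p (diag_form x y p 1 :: 'm sqmat \<Rightarrow> 'm sqmat \<Rightarrow> real)"
    unfolding Ad_invariant_on_def p
  proof (intro ballI conjI)
    fix Q X Y :: "'m sqmat"
    assume Q: "Q \<in> SO3_SOm" and X: "X \<in> tangent" and Y: "Y \<in> tangent"
    note o = SO3_SOm_preserves_blocks(1)[OF Q]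
    have cls: "(\<forall>b. w a b = w c b) \<and> (\<forall>b. w b a = w b c)" if "Q $ a $ c \<noteq> 0" for a c
    proof -
      have row: "w a b = w c b" for b
        using SO3_SOm_preserves_blocks(2)[OF Q that]
        by (cases b) (auto simp: block_def block_e_def block_d_def)
      moreover have "w b a = w b c" for b
        by (simp only: sym[of b a] sym[of b c] row)
      ultimately show ?thesis by blast
    qed
    have h: "hadamard w (Q ** X ** transpose Q) = Q ** hadamard w X ** transpose Q" for X
      by (rule hadamard_conj[OF cls])
    have pr: "proj (Q ** X ** transpose Q) = Q ** proj X ** transpose Q" for X
      unfolding proj_def
    proof (rule hadamard_conj)
      fix a c assume "Q $ a $ c \<noteq> 0"
      from cls[OF this] show "(\<forall>b. (if w a b = 0 then 0 else 1 :: real) = (if w c b = 0 then 0 else 1)) \<and>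
          (\<forall>b. (if w b a = 0 then 0 else 1 :: real) = (if w b c = 0 then 0 else 1))"
        by simp
    qed
    have in_t: "Q ** X ** transpose Q \<in> tangent" if "X \<in> tangent" for X
    proof -
      have "transpose X = - X" using that by (simp add: tangent_def skew_def)
      then have "transpose (Q ** X ** transpose Q) = - (Q ** X ** transpose Q)"
        by (simp add: matrix_transpose_mul mat_simps matrix_mul_assoc)
      then have "Q ** X ** transpose Q \<in> skew" by (simp add: skew_def)
      from proj_in_tangent[OF this] show ?thesis by (simp add: pr proj_tangent[OF that])
    qed
    show "Q ** X ** transpose Q \<in> tangent" by (rule in_t[OF X])
    have "form (Q ** X ** transpose Q) (Q ** Y ** transpose Q) = (Q ** hadamard w X ** transpose Q) \<bullet> (Q ** Y ** transpose Q)"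
      by (simp add: form_def h)
    also have "\<dots> = (Q ** hadamard w X) \<bullet> (Q ** Y ** (transpose Q ** Q))"
      unfolding inner_matrix_mult(2)[of "Q ** hadamard w X"] by (simp add: matrix_mul_assoc)
    also have "\<dots> = hadamard w X \<bullet> ((transpose Q ** Q) ** Y)"
      unfolding o inner_matrix_mult(1)[of Q] by (simp add: matrix_mul_assoc o)
    also have "\<dots> = form X Y" by (simp add: o form_def)
    finally show "diag_form x y p 1 (Q ** X ** transpose Q) (Q ** Y ** transpose Q) = diag_form x y p 1 X Y"
      using f[OF in_t[OF X] in_t[OF Y]] f[OF X Y] by simp
  qed
qed

lemma jensen_parameter_solves:
  fixes m :: nat
  assumes "m \<ge> 2" "s\<^sup>2 = 1"
  defines "z \<equiv> jensen_parameter s (4 + m)"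
  shows "z > 0" "(real m + 3) * z\<^sup>2 - 2 * (real m + 2) * z + 2 = 0"
proof -
  define D where "D = (real m)\<^sup>2 + 2 * real m - 2"
  have D: "D > 0" using assms(1) power_mono[of 2 "real m" 2] by (simp add: D_def)
  have n: "(real (4 + m))\<^sup>2 - 6 * real (4 + m) + 6 = D"
    by (simp add: D_def power2_eq_square algebra_simps)
  have z: "z = (real m + 2 + s * sqrt D) / (real m + 3)"
    unfolding z_def jensen_parameter_def n by (simp add: add.commute)
  have "D < (real m + 2)\<^sup>2" by (simp add: D_def power2_eq_square algebra_simps)
  define q where "q = sqrt D"
  have "q < real m + 2" unfolding q_def using \<open>D < (real m + 2)\<^sup>2\<close> by (intro real_less_lsqrt) auto
  moreover have "0 < q" using D by (simp add: q_def)
  moreover have "s = 1 \<or> s = - 1" using assms(2) by (simp add: power2_eq_1_iff)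
  ultimately have "0 < real m + 2 + s * q" by auto
  then show "z > 0" unfolding z q_def by simp
  have "(real m + 3) * z = real m + 2 + s * sqrt D" unfolding z by simp
  moreover have "(sqrt D)\<^sup>2 = (real m)\<^sup>2 + 2 * real m - 2" using D by (simp add: D_def)
  ultimately have "(real m + 3) * ((real m + 3) * z\<^sup>2 - 2 * (real m + 2) * z + 2) = 0"
    using assms(2) by algebra
  then show "(real m + 3) * z\<^sup>2 - 2 * (real m + 2) * z + 2 = 0" by auto
qed

lemma jensen_parameters_distinct: "m \<ge> 2 \<Longrightarrow> jensen_parameter 1 (4 + m) \<noteq> jensen_parameter (- 1) (4 + m)"
proof -
  assume m: "m \<ge> 2"
  have "(real (4 + m))\<^sup>2 - 6 * real (4 + m) + 6 = (real m)\<^sup>2 + 2 * real m - 2"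
    by (simp add: power2_eq_square algebra_simps)
  moreover have "(real m)\<^sup>2 + 2 * real m - 2 > 0" using m power_mono[of 2 "real m" 2] by simp
  ultimately show ?thesis by (simp add: jensen_parameter_def divide_eq_eq)
qed

lemma einstein_parameters:
  fixes m :: nat
  assumes "m \<ge> 2"
  obtains x y p l x' y' p' l' where "x > 0" "y > 0" "p > 1" "einstein_eqs (real m) x y p l"
    and "x' > 0" "y' > 0" "0 < p'" "p' < 1" "einstein_eqs (real m) x' y' p' l'"
proof -
  have m: "real m \<ge> 2" using assms by simp
  obtain y w where a: "y > 0" "w > 0" "pxy m y w > 0" "G1 m y w = 0" "G2 m y w = 0"
    by (rule first_family[OF m])
  obtain y' w' where b: "y' > 0" "-1 < w'" "w' < 0" "pxy m y' w' > 0" "G1 m y' w' = 0" "G2 m y' w' = 0"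
  proof (cases "m = 2")
    case True
    show ?thesis by (rule second_family_2) (use that True in simp)
  next
    case False
    then have "real m \<ge> 3" using assms by simp
    then show ?thesis by (rule second_family_ge3) (rule that)
  qed
  obtain l where l: "einstein_eqs m (pxy m y w / ((1 + w) * y)) y (1 + w) l"
    using einstein_eqs_of_zero[of y w m] a by auto
  obtain l' where l': "einstein_eqs m (pxy m y' w' / ((1 + w') * y')) y' (1 + w') l'"
    using einstein_eqs_of_zero[of y' w' m] b by auto
  show ?thesis by (rule that[OF _ _ _ l _ _ _ _ l']) (use a b in auto)
qed

theorem theorem6p1:
  fixes n :: nat
  assumes "n = CARD(4 + 'm::finite)" and "n \<ge> 6"
  shows "\<exists>g :: nat \<Rightarrow> 'm frame \<Rightarrow> 'm frame \<Rightarrow> 'm frame \<Rightarrow> real.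
    (\<forall>k\<in>{1..4}. SO_invariant (g k) \<and> einstein_metric TYPE(6 + 4 \<times> 'm) stiefel (g k)) \<and>
    (\<forall>k\<in>{1..4}. \<forall>l\<in>{1..4}. k \<noteq> l \<longrightarrow> \<not> equal_up_to_scaling stiefel (g k) (g l)) \<and>
    given_by (g 1) (jensen_form 1) \<and>
    given_by (g 2) (jensen_form (-1)) \<and>
    (\<forall>k\<in>{3,4}. \<exists>x2 x12 x13 x23. x2 > 0 \<and> x12 > 0 \<and> x13 > 0 \<and> x23 > 0 \<and>
       scalar_product_on frak_p (diag_form x2 x12 x13 x23 :: 'm sqmat \<Rightarrow> 'm sqmat \<Rightarrow> real) \<and>
       Ad_invariant_on SO3_SOm frak_p (diag_form x2 x12 x13 x23 :: 'm sqmat \<Rightarrow> 'm sqmat \<Rightarrow> real) \<and>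
       given_by (g k) (diag_form x2 x12 x13 x23))"
proof -
  have n: "CARD(4 + 'm) = 4 + CARD('m)" by (simp add: card_UNIV_sum)
  have m: "CARD('m) \<ge> 2" using assms n by simp
  define N where "N = real CARD(4 + 'm) - 2"
  have N: "N > 0" by (simp add: N_def card_UNIV_sum)
  define j where "j s = jensen_parameter s (4 + CARD('m))" for s
  have j: "j 1 > 0" "j (- 1) > 0" "j 1 \<noteq> j (- 1)"
    using jensen_parameter_solves(1)[OF m] jensen_parameters_distinct[OF m] by (simp_all add: j_def)
  have jE: "einstein_eqs (real CARD('m)) (j s) (j s) 1 (real CARD('m) + 2 - 3 * j s / 2)" if "s\<^sup>2 = 1" for s
    unfolding j_def by (intro jensen_eqs jensen_parameter_solves[OF m that])
  obtain x y p l x' y' p' l' where a: "x > 0" "y > 0" "p > 1" "einstein_eqs (real CARD('m)) x y p l"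
    and b: "x' > 0" "y' > 0" "0 < p'" "p' < 1" "einstein_eqs (real CARD('m)) x' y' p' l'"
    by (rule einstein_parameters[OF m])
  \<comment> \<open>The weights \<open>x\<close>, \<open>y\<close>, \<open>p\<close> of the four metrics.\<close>
  define P :: "nat \<Rightarrow> real \<times> real \<times> real" where
    "P k = (if k = 1 then (j 1, j 1, 1) else if k = 2 then (j (- 1), j (- 1), 1) else if k = 3 then (x, y, p) else (x', y', p'))" for k
  define M :: "nat \<Rightarrow> 'm frame \<Rightarrow> 'm frame \<Rightarrow> 'm frame \<Rightarrow> real" where
    "M k = (case P k of (x, y, p) \<Rightarrow> stiefel_weights.g (block_e N x y) (block_d N p))" for k
  have pos: "fst (P k) > 0" "fst (snd (P k)) > 0" "snd (snd (P k)) > 0" for k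
    using j a b by (auto simp: P_def)
  have M: "M k = stiefel_weights.g (block_e N (fst (P k)) (fst (snd (P k)))) (block_d N (snd (snd (P k))))" for k
    by (simp add: M_def case_prod_beta')
  have eqs: "\<exists>l. einstein_eqs (real CARD('m)) (fst (P k)) (fst (snd (P k))) (snd (snd (P k))) l" for k
    using jE[of 1] jE[of "- 1"] a b by (auto simp: P_def)
  have SO: "SO_invariant (M k)" for k
  proof -
    interpret stiefel_weights "block_e N (fst (P k)) (fst (snd (P k)))" "block_d N (snd (snd (P k)))" "TYPE('m)"
      by (rule stiefel_weights_block[OF N pos])
    show ?thesis unfolding M by (rule SO_invariant_g)
  qed
  have E: "einstein_metric TYPE(6 + 4 \<times> 'm) stiefel (M k)" for k
    using eqs[of k] einstein_block[OF N pos] unfolding M by blast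
  have dist: "\<not> equal_up_to_scaling stiefel (M k) (M l)" if "k \<in> {1..4}" "l \<in> {1..4}" "k \<noteq> l" for k l
  proof
    assume "equal_up_to_scaling stiefel (M k) (M l)"
    then have "fst (P k) = fst (P l)" "snd (snd (P k)) = snd (snd (P l))"
      unfolding M using g_block_proportional[OF N pos pos] by blast+
    moreover have "k = 1 \<or> k = 2 \<or> k = 3 \<or> k = 4" "l = 1 \<or> l = 2 \<or> l = 3 \<or> l = 4" using that by auto
    ultimately show False using that(3) j(3) a(3) b(4) by (auto simp: P_def)
  qed
  have given: "given_by (M k) (diag_form (fst (P k)) (fst (snd (P k))) (snd (snd (P k))) 1 :: 'm sqmat \<Rightarrow> _)" for k
    unfolding M N_def by (rule diag_form_invariant(3)[OF pos])
  have jf: "jensen_form s = (diag_form (j s) (j s) 1 1 :: 'm sqmat \<Rightarrow> _)" for s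
    by (simp add: jensen_form_def j_def n Let_def)
  have "given_by (M 1) (jensen_form 1)" "given_by (M 2) (jensen_form (- 1))"
    using given[of 1] given[of 2] by (simp_all add: jf P_def)
  moreover have "\<exists>x2 x12 x13 x23. x2 > 0 \<and> x12 > 0 \<and> x13 > 0 \<and> x23 > 0 \<and>
       scalar_product_on frak_p (diag_form x2 x12 x13 x23 :: 'm sqmat \<Rightarrow> 'm sqmat \<Rightarrow> real) \<and>
       Ad_invariant_on SO3_SOm frak_p (diag_form x2 x12 x13 x23 :: 'm sqmat \<Rightarrow> 'm sqmat \<Rightarrow> real) \<and>
       given_by (M k) (diag_form x2 x12 x13 x23)" for k
    using pos[of k] diag_form_invariant(1,2)[OF pos[of k]] given[of k] zero_less_one by blast
  ultimately show ?thesis using SO E dist by (intro exI[of _ M]) blast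
qed

end
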